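(* Let $\mathcal{C}$ be a fusion category over $\mathbb{C}$ which is a $C_2$-graded extension of a pointed fusion category. If $\mathcal{C}$ is braided, then $\mathcal{O}(\mathcal{C}_{\mathrm{ad}})$, as a group under tensor product, is an elementary abelian $2$-group.
   Context: A fusion category over $\mathbb{C}$ is a $\mathbb{C}$-linear semisimple rigid monoidal category with finitely many isomorphism classes of simple objects (the set of which is denoted $\mathcal{O}(\mathcal{C})$) and simple unit $\mathbf{1}$. A simple object $X$ is invertible if $X\otimes X^*\cong\mathbf{1}$; a fusion category is pointed if all its simple objects are invertible. $C_2$ is the cyclic group of order 2. $\mathcal{C}$ is a $C_2$-graded extension of a fusion category $\mathcal{D}$ if $\mathcal{C}=\mathcal{C}_0\oplus\mathcal{C}_1$ as a $C_2$-graded category, with $\otimes$ mapping $\mathcal{C}_i\times\mathcal{C}_j$ to $\mathcal{C}_{i+j}$ (indices mod 2), and the trivial component is $\mathcal{C}_0\simeq\mathcal{D}$. The adjoint subcategory $\mathcal{C}_{\mathrm{ad}}$ is the fusion subcategory generated by all $X\otimes X^*$, $X\in\mathcal{O}(\mathcal{C})$; in the present situation it is contained in the trivial component, so all its simple objects are invertible and $\mathcal{O}(\mathcal{C}_{\mathrm{ad}})$ is a finite group under $\otimes$. An elementary abelian $2$-group is a group isomorphic to $C_2^n$ for some $n\ge 0$. *)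

theory Defs
  imports
    Complex_Main
    "HOL-Algebra.Module"
    "HOL-Algebra.Elementary_Groups"
    "HOL-Algebra.Product_Groups"
begin

section \<open>Monoidal categories enriched in complex vector spaces: raw data\<close>

text \<open>
  Objects and arrows are carved out of two arbitrary types by carrier sets; nothing is assumed
  about the operations outside these carriers.  \<open>Assoc X Y Z\<close> goes from
  \<open>(X \<otimes> Y) \<otimes> Z\<close> to \<open>X \<otimes> (Y \<otimes> Z)\<close>, \<open>LUnit X\<close> from \<open>\<I> \<otimes> X\<close> to \<open>X\<close> and
  \<open>RUnit X\<close> from \<open>X \<otimes> \<I>\<close> to \<open>X\<close>.  The composite \<open>g \<cdot> f\<close> is "\<open>g\<close> after \<open>f\<close>".
\<close>

record ('o, 'm) moncat =
  Obj :: "'o set"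
  Arr :: "'m set"
  Dom :: "'m \<Rightarrow> 'o"
  Cod :: "'m \<Rightarrow> 'o"
  Idn :: "'o \<Rightarrow> 'm"
  Cmp :: "'m \<Rightarrow> 'm \<Rightarrow> 'm"  (infixr "\<cdot>\<index>" 72)
  ZeroArr :: "'o \<Rightarrow> 'o \<Rightarrow> 'm"
  AddArr :: "'m \<Rightarrow> 'm \<Rightarrow> 'm"  (infixl "+\<^sub>a\<index>" 65)
  ScaleArr :: "complex \<Rightarrow> 'm \<Rightarrow> 'm"  (infixr "*\<^sub>a\<index>" 70)
  UnitObj :: "'o"  ("\<I>\<index>")
  TenObj :: "'o \<Rightarrow> 'o \<Rightarrow> 'o"  (infixl "\<otimes>\<^sub>o\<index>" 75)
  TenArr :: "'m \<Rightarrow> 'm \<Rightarrow> 'm"  (infixl "\<otimes>\<^sub>a\<index>" 75)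
  Assoc :: "'o \<Rightarrow> 'o \<Rightarrow> 'o \<Rightarrow> 'm"
  LUnit :: "'o \<Rightarrow> 'm"
  RUnit :: "'o \<Rightarrow> 'm"

definition mor :: "('o, 'm) moncat \<Rightarrow> 'o \<Rightarrow> 'o \<Rightarrow> 'm set" where
  "mor C X Y = {f \<in> Arr C. Dom C f = X \<and> Cod C f = Y}"

definition complex_ring :: "complex ring" where
  "complex_ring = \<lparr>carrier = UNIV, monoid.mult = (*), one = 1, zero = 0, add = (+)\<rparr>"

text \<open>
  The multiplicative fields of the record are irrelevant for the predicate \<open>module\<close>; for
  \<open>X = Y\<close> they are those of the endomorphism algebra.
\<close>

definition hom_space :: "('o, 'm) moncat \<Rightarrow> 'o \<Rightarrow> 'o \<Rightarrow> (complex, 'm) module" where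
  "hom_space C X Y =
    \<lparr>carrier = mor C X Y, monoid.mult = Cmp C, one = Idn C X,
     zero = ZeroArr C X Y, add = AddArr C, smult = ScaleArr C\<rparr>"

definition full_subcat :: "('o, 'm) moncat \<Rightarrow> 'o set \<Rightarrow> ('o, 'm) moncat" where
  "full_subcat C S =
    C\<lparr>Obj := Obj C \<inter> S, Arr := {f \<in> Arr C. Dom C f \<in> S \<and> Cod C f \<in> S}\<rparr>"

section \<open>Notions from the theory of abelian categories\<close>

definition inverse_arrows :: "('o, 'm) moncat \<Rightarrow> 'm \<Rightarrow> 'm \<Rightarrow> bool" where
  "inverse_arrows C f g \<longleftrightarrow>
    f \<in> Arr C \<and> g \<in> mor C (Cod C f) (Dom C f) \<and>
    g \<cdot>\<^bsub>C\<^esub> f = Idn C (Dom C f) \<and> f \<cdot>\<^bsub>C\<^esub> g = Idn C (Cod C f)"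

definition iso_arr :: "('o, 'm) moncat \<Rightarrow> 'm \<Rightarrow> bool" where
  "iso_arr C f \<longleftrightarrow> (\<exists>g. inverse_arrows C f g)"

definition inv_arr :: "('o, 'm) moncat \<Rightarrow> 'm \<Rightarrow> 'm" where
  "inv_arr C f = (THE g. inverse_arrows C f g)"

definition isomorphic :: "('o, 'm) moncat \<Rightarrow> 'o \<Rightarrow> 'o \<Rightarrow> bool" where
  "isomorphic C X Y \<longleftrightarrow> (\<exists>f \<in> mor C X Y. iso_arr C f)"

definition mono_arr :: "('o, 'm) moncat \<Rightarrow> 'm \<Rightarrow> bool" where
  "mono_arr C f \<longleftrightarrow> f \<in> Arr C \<and>
    (\<forall>W \<in> Obj C. \<forall>u \<in> mor C W (Dom C f). \<forall>v \<in> mor C W (Dom C f).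
       f \<cdot>\<^bsub>C\<^esub> u = f \<cdot>\<^bsub>C\<^esub> v \<longrightarrow> u = v)"

definition epi_arr :: "('o, 'm) moncat \<Rightarrow> 'm \<Rightarrow> bool" where
  "epi_arr C f \<longleftrightarrow> f \<in> Arr C \<and>
    (\<forall>W \<in> Obj C. \<forall>u \<in> mor C (Cod C f) W. \<forall>v \<in> mor C (Cod C f) W.
       u \<cdot>\<^bsub>C\<^esub> f = v \<cdot>\<^bsub>C\<^esub> f \<longrightarrow> u = v)"

definition zero_obj :: "('o, 'm) moncat \<Rightarrow> 'o \<Rightarrow> bool" where
  "zero_obj C Z \<longleftrightarrow> Z \<in> Obj C \<and>
    (\<forall>X \<in> Obj C. (\<exists>!f. f \<in> mor C Z X) \<and> (\<exists>!f. f \<in> mor C X Z))"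

definition simple_obj :: "('o, 'm) moncat \<Rightarrow> 'o \<Rightarrow> bool" where
  "simple_obj C X \<longleftrightarrow> X \<in> Obj C \<and> \<not> zero_obj C X \<and>
    (\<forall>Y \<in> Obj C. \<forall>f \<in> mor C Y X. mono_arr C f \<longrightarrow> zero_obj C Y \<or> iso_arr C f)"

definition is_direct_sum :: "('o, 'm) moncat \<Rightarrow> nat \<Rightarrow> (nat \<Rightarrow> 'o) \<Rightarrow> 'o \<Rightarrow> bool" where
  "is_direct_sum C n S X \<longleftrightarrow> X \<in> Obj C \<and> (\<forall>k<n. S k \<in> Obj C) \<and>
    (\<exists>\<iota> \<pi>.
      (\<forall>k<n. \<iota> k \<in> mor C (S k) X \<and> \<pi> k \<in> mor C X (S k)) \<and>
      (\<forall>j<n. \<forall>k<n. \<pi> j \<cdot>\<^bsub>C\<^esub> \<iota> k = (if j = k then Idn C (S k) else ZeroArr C (S k) (S j))) \<and>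
      Idn C X = finsum (hom_space C X X) (\<lambda>k. \<iota> k \<cdot>\<^bsub>C\<^esub> \<pi> k) {..<n})"

definition is_kernel :: "('o, 'm) moncat \<Rightarrow> 'm \<Rightarrow> 'm \<Rightarrow> bool" where
  "is_kernel C f k \<longleftrightarrow>
    f \<in> Arr C \<and> k \<in> Arr C \<and> Cod C k = Dom C f \<and>
    f \<cdot>\<^bsub>C\<^esub> k = ZeroArr C (Dom C k) (Cod C f) \<and>
    (\<forall>W \<in> Obj C. \<forall>h \<in> mor C W (Dom C f). f \<cdot>\<^bsub>C\<^esub> h = ZeroArr C W (Cod C f) \<longrightarrow>
       (\<exists>!u. u \<in> mor C W (Dom C k) \<and> k \<cdot>\<^bsub>C\<^esub> u = h))"

definition is_cokernel :: "('o, 'm) moncat \<Rightarrow> 'm \<Rightarrow> 'm \<Rightarrow> bool" where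
  "is_cokernel C f q \<longleftrightarrow>
    f \<in> Arr C \<and> q \<in> Arr C \<and> Dom C q = Cod C f \<and>
    q \<cdot>\<^bsub>C\<^esub> f = ZeroArr C (Dom C f) (Cod C q) \<and>
    (\<forall>W \<in> Obj C. \<forall>h \<in> mor C (Cod C f) W. h \<cdot>\<^bsub>C\<^esub> f = ZeroArr C (Dom C f) W \<longrightarrow>
       (\<exists>!u. u \<in> mor C (Cod C q) W \<and> u \<cdot>\<^bsub>C\<^esub> q = h))"

definition iso_class :: "('o, 'm) moncat \<Rightarrow> 'o \<Rightarrow> 'o set" where
  "iso_class C X = {Y \<in> Obj C. isomorphic C Y X}"

definition simple_classes :: "('o, 'm) moncat \<Rightarrow> 'o set set" where
  "simple_classes C = iso_class C ` {X. simple_obj C X}"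

text \<open>
  \<open>left_dual C X Y\<close> says that \<open>Y\<close> is a (choice of) \<open>X\<^sup>*\<close>, with evaluation
  \<open>X\<^sup>* \<otimes> X \<rightarrow> \<I>\<close> and coevaluation \<open>\<I> \<rightarrow> X \<otimes> X\<^sup>*\<close> satisfying the two zigzag identities.
\<close>

definition left_dual :: "('o, 'm) moncat \<Rightarrow> 'o \<Rightarrow> 'o \<Rightarrow> bool" where
  "left_dual C X Y \<longleftrightarrow> X \<in> Obj C \<and> Y \<in> Obj C \<and>
    (\<exists>ev \<in> mor C (Y \<otimes>\<^sub>o\<^bsub>C\<^esub> X) \<I>\<^bsub>C\<^esub>. \<exists>coev \<in> mor C \<I>\<^bsub>C\<^esub> (X \<otimes>\<^sub>o\<^bsub>C\<^esub> Y).
       RUnit C X \<cdot>\<^bsub>C\<^esub> (Idn C X \<otimes>\<^sub>a\<^bsub>C\<^esub> ev) \<cdot>\<^bsub>C\<^esub> Assoc C X Y X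
         \<cdot>\<^bsub>C\<^esub> (coev \<otimes>\<^sub>a\<^bsub>C\<^esub> Idn C X) \<cdot>\<^bsub>C\<^esub> inv_arr C (LUnit C X) = Idn C X \<and>
       LUnit C Y \<cdot>\<^bsub>C\<^esub> (ev \<otimes>\<^sub>a\<^bsub>C\<^esub> Idn C Y) \<cdot>\<^bsub>C\<^esub> inv_arr C (Assoc C Y X Y)
         \<cdot>\<^bsub>C\<^esub> (Idn C Y \<otimes>\<^sub>a\<^bsub>C\<^esub> coev) \<cdot>\<^bsub>C\<^esub> inv_arr C (RUnit C Y) = Idn C Y)"

section \<open>Fusion categories\<close>

locale plain_category =
  fixes C :: "('o, 'm) moncat" (structure)
  assumes dom_obj: "f \<in> Arr C \<Longrightarrow> Dom C f \<in> Obj C"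
    and cod_obj: "f \<in> Arr C \<Longrightarrow> Cod C f \<in> Obj C"
    and id_mor: "X \<in> Obj C \<Longrightarrow> Idn C X \<in> mor C X X"
    and comp_mor: "\<lbrakk>f \<in> mor C X Y; g \<in> mor C Y Z\<rbrakk> \<Longrightarrow> g \<cdot> f \<in> mor C X Z"
    and comp_id_left: "f \<in> mor C X Y \<Longrightarrow> Idn C Y \<cdot> f = f"
    and comp_id_right: "f \<in> mor C X Y \<Longrightarrow> f \<cdot> Idn C X = f"
    and comp_assoc: "\<lbrakk>f \<in> mor C W X; g \<in> mor C X Y; h \<in> mor C Y Z\<rbrakk>
      \<Longrightarrow> (h \<cdot> g) \<cdot> f = h \<cdot> (g \<cdot> f)"

text \<open>Hom spaces are finite-dimensional complex vector spaces and composition is bilinear.\<close>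

locale linear_category = plain_category +
  assumes hom_module: "\<lbrakk>X \<in> Obj C; Y \<in> Obj C\<rbrakk>
      \<Longrightarrow> module complex_ring (hom_space C X Y)"
    and hom_finite_dim: "\<lbrakk>X \<in> Obj C; Y \<in> Obj C\<rbrakk>
      \<Longrightarrow> \<exists>(n::nat) e. (\<forall>k<n. e k \<in> mor C X Y) \<and>
            (\<forall>f \<in> mor C X Y. \<exists>a. f = finsum (hom_space C X Y) (\<lambda>k. a k *\<^sub>a e k) {..<n})"
    and comp_add_left: "\<lbrakk>f \<in> mor C X Y; g \<in> mor C Y Z; g' \<in> mor C Y Z\<rbrakk>
      \<Longrightarrow> (g +\<^sub>a g') \<cdot> f = g \<cdot> f +\<^sub>a g' \<cdot> f"
    and comp_add_right: "\<lbrakk>f \<in> mor C X Y; f' \<in> mor C X Y; g \<in> mor C Y Z\<rbrakk>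
      \<Longrightarrow> g \<cdot> (f +\<^sub>a f') = g \<cdot> f +\<^sub>a g \<cdot> f'"
    and comp_scale_left: "\<lbrakk>f \<in> mor C X Y; g \<in> mor C Y Z\<rbrakk> \<Longrightarrow> (a *\<^sub>a g) \<cdot> f = a *\<^sub>a (g \<cdot> f)"
    and comp_scale_right: "\<lbrakk>f \<in> mor C X Y; g \<in> mor C Y Z\<rbrakk> \<Longrightarrow> g \<cdot> (a *\<^sub>a f) = a *\<^sub>a (g \<cdot> f)"

text \<open>The empty direct sum (\<open>n = 0\<close>) provides a zero object.\<close>

locale abelian_linear_category = linear_category +
  assumes direct_sums: "(\<And>k. k < n \<Longrightarrow> S k \<in> Obj C) \<Longrightarrow> \<exists>X. is_direct_sum C n S X"
    and kernels: "f \<in> Arr C \<Longrightarrow> \<exists>k. is_kernel C f k"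
    and cokernels: "f \<in> Arr C \<Longrightarrow> \<exists>q. is_cokernel C f q"
    and mono_normal: "mono_arr C k \<Longrightarrow> \<exists>f. is_kernel C f k"
    and epi_normal: "epi_arr C q \<Longrightarrow> \<exists>f. is_cokernel C f q"

locale semisimple_category = abelian_linear_category +
  assumes semisimple: "X \<in> Obj C
      \<Longrightarrow> \<exists>n S. (\<forall>k<n. simple_obj C (S k)) \<and> is_direct_sum C n S X"

text \<open>A monoidal structure whose tensor product is bilinear on arrows.\<close>

locale linear_monoidal_category = linear_category +
  assumes unit_obj: "\<I> \<in> Obj C"
    and tensor_obj: "\<lbrakk>X \<in> Obj C; Y \<in> Obj C\<rbrakk> \<Longrightarrow> X \<otimes>\<^sub>o Y \<in> Obj C"
    and tensor_mor: "\<lbrakk>f \<in> mor C X X'; g \<in> mor C Y Y'\<rbrakk>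
      \<Longrightarrow> f \<otimes>\<^sub>a g \<in> mor C (X \<otimes>\<^sub>o Y) (X' \<otimes>\<^sub>o Y')"
    and tensor_id: "\<lbrakk>X \<in> Obj C; Y \<in> Obj C\<rbrakk> \<Longrightarrow> Idn C X \<otimes>\<^sub>a Idn C Y = Idn C (X \<otimes>\<^sub>o Y)"
    and tensor_comp: "\<lbrakk>f \<in> mor C X X'; f' \<in> mor C X' X''; g \<in> mor C Y Y'; g' \<in> mor C Y' Y''\<rbrakk>
      \<Longrightarrow> (f' \<cdot> f) \<otimes>\<^sub>a (g' \<cdot> g) = (f' \<otimes>\<^sub>a g') \<cdot> (f \<otimes>\<^sub>a g)"
    and tensor_add_left: "\<lbrakk>f \<in> mor C X X'; f' \<in> mor C X X'; g \<in> mor C Y Y'\<rbrakk>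
      \<Longrightarrow> (f +\<^sub>a f') \<otimes>\<^sub>a g = f \<otimes>\<^sub>a g +\<^sub>a f' \<otimes>\<^sub>a g"
    and tensor_add_right: "\<lbrakk>f \<in> mor C X X'; g \<in> mor C Y Y'; g' \<in> mor C Y Y'\<rbrakk>
      \<Longrightarrow> f \<otimes>\<^sub>a (g +\<^sub>a g') = f \<otimes>\<^sub>a g +\<^sub>a f \<otimes>\<^sub>a g'"
    and tensor_scale_left: "\<lbrakk>f \<in> mor C X X'; g \<in> mor C Y Y'\<rbrakk>
      \<Longrightarrow> (a *\<^sub>a f) \<otimes>\<^sub>a g = a *\<^sub>a (f \<otimes>\<^sub>a g)"
    and tensor_scale_right: "\<lbrakk>f \<in> mor C X X'; g \<in> mor C Y Y'\<rbrakk>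
      \<Longrightarrow> f \<otimes>\<^sub>a (a *\<^sub>a g) = a *\<^sub>a (f \<otimes>\<^sub>a g)"
    and assoc_mor: "\<lbrakk>X \<in> Obj C; Y \<in> Obj C; Z \<in> Obj C\<rbrakk>
      \<Longrightarrow> Assoc C X Y Z \<in> mor C (X \<otimes>\<^sub>o Y \<otimes>\<^sub>o Z) (X \<otimes>\<^sub>o (Y \<otimes>\<^sub>o Z))"
    and assoc_iso: "\<lbrakk>X \<in> Obj C; Y \<in> Obj C; Z \<in> Obj C\<rbrakk> \<Longrightarrow> iso_arr C (Assoc C X Y Z)"
    and assoc_natural: "\<lbrakk>f \<in> mor C X X'; g \<in> mor C Y Y'; h \<in> mor C Z Z'\<rbrakk>
      \<Longrightarrow> Assoc C X' Y' Z' \<cdot> (f \<otimes>\<^sub>a g \<otimes>\<^sub>a h) = (f \<otimes>\<^sub>a (g \<otimes>\<^sub>a h)) \<cdot> Assoc C X Y Z"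
    and lunit_mor: "X \<in> Obj C \<Longrightarrow> LUnit C X \<in> mor C (\<I> \<otimes>\<^sub>o X) X"
    and lunit_iso: "X \<in> Obj C \<Longrightarrow> iso_arr C (LUnit C X)"
    and lunit_natural: "f \<in> mor C X Y \<Longrightarrow> LUnit C Y \<cdot> (Idn C \<I> \<otimes>\<^sub>a f) = f \<cdot> LUnit C X"
    and runit_mor: "X \<in> Obj C \<Longrightarrow> RUnit C X \<in> mor C (X \<otimes>\<^sub>o \<I>) X"
    and runit_iso: "X \<in> Obj C \<Longrightarrow> iso_arr C (RUnit C X)"
    and runit_natural: "f \<in> mor C X Y \<Longrightarrow> RUnit C Y \<cdot> (f \<otimes>\<^sub>a Idn C \<I>) = f \<cdot> RUnit C X"
    and triangle: "\<lbrakk>X \<in> Obj C; Y \<in> Obj C\<rbrakk>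
      \<Longrightarrow> (Idn C X \<otimes>\<^sub>a LUnit C Y) \<cdot> Assoc C X \<I> Y = RUnit C X \<otimes>\<^sub>a Idn C Y"
    and pentagon: "\<lbrakk>W \<in> Obj C; X \<in> Obj C; Y \<in> Obj C; Z \<in> Obj C\<rbrakk>
      \<Longrightarrow> Assoc C W X (Y \<otimes>\<^sub>o Z) \<cdot> Assoc C (W \<otimes>\<^sub>o X) Y Z =
          (Idn C W \<otimes>\<^sub>a Assoc C X Y Z) \<cdot> Assoc C W (X \<otimes>\<^sub>o Y) Z \<cdot> (Assoc C W X Y \<otimes>\<^sub>a Idn C Z)"

locale fusion_category = semisimple_category + linear_monoidal_category +
  assumes left_duals: "X \<in> Obj C \<Longrightarrow> \<exists>Y. left_dual C X Y"
    and right_duals: "X \<in> Obj C \<Longrightarrow> \<exists>Y. left_dual C Y X"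
    and finite_simple_classes: "finite (simple_classes C)"
    and unit_simple: "simple_obj C \<I>"

definition invertible_obj :: "('o, 'm) moncat \<Rightarrow> 'o \<Rightarrow> bool" where
  "invertible_obj C X \<longleftrightarrow> (\<exists>Y. left_dual C X Y \<and> isomorphic C (X \<otimes>\<^sub>o\<^bsub>C\<^esub> Y) \<I>\<^bsub>C\<^esub>)"

locale pointed_fusion_category = fusion_category +
  assumes simple_invertible: "simple_obj C X \<Longrightarrow> invertible_obj C X"

section \<open>Braidings\<close>

locale braiding =
  fixes C :: "('o, 'm) moncat" (structure) and c :: "'o \<Rightarrow> 'o \<Rightarrow> 'm"
  assumes braid_mor: "\<lbrakk>X \<in> Obj C; Y \<in> Obj C\<rbrakk> \<Longrightarrow> c X Y \<in> mor C (X \<otimes>\<^sub>o Y) (Y \<otimes>\<^sub>o X)"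
    and braid_iso: "\<lbrakk>X \<in> Obj C; Y \<in> Obj C\<rbrakk> \<Longrightarrow> iso_arr C (c X Y)"
    and braid_natural: "\<lbrakk>f \<in> mor C X X'; g \<in> mor C Y Y'\<rbrakk>
      \<Longrightarrow> c X' Y' \<cdot> (f \<otimes>\<^sub>a g) = (g \<otimes>\<^sub>a f) \<cdot> c X Y"
    and hexagon1: "\<lbrakk>X \<in> Obj C; Y \<in> Obj C; Z \<in> Obj C\<rbrakk>
      \<Longrightarrow> Assoc C Y Z X \<cdot> c X (Y \<otimes>\<^sub>o Z) \<cdot> Assoc C X Y Z =
          (Idn C Y \<otimes>\<^sub>a c X Z) \<cdot> Assoc C Y X Z \<cdot> (c X Y \<otimes>\<^sub>a Idn C Z)"
    and hexagon2: "\<lbrakk>X \<in> Obj C; Y \<in> Obj C; Z \<in> Obj C\<rbrakk>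
      \<Longrightarrow> inv_arr C (Assoc C Z X Y) \<cdot> c (X \<otimes>\<^sub>o Y) Z \<cdot> inv_arr C (Assoc C X Y Z) =
          (c X Z \<otimes>\<^sub>a Idn C Y) \<cdot> inv_arr C (Assoc C X Z Y) \<cdot> (Idn C X \<otimes>\<^sub>a c Y Z)"

definition braided :: "('o, 'm) moncat \<Rightarrow> bool" where
  "braided C \<longleftrightarrow> (\<exists>c. braiding C c)"

section \<open>Equivalences of fusion categories and graded extensions\<close>

text \<open>
  A linear, strong monoidal, fully faithful and essentially surjective functor with object part
  \<open>Fo\<close>, arrow part \<open>Fa\<close>, tensor structure \<open>J\<close> and unit structure \<open>e\<close>.
\<close>

locale monoidal_equivalence =
  fixes C :: "('o, 'm) moncat" and D :: "('p, 'q) moncat" (structure)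
    and Fo :: "'o \<Rightarrow> 'p" and Fa :: "'m \<Rightarrow> 'q"
    and J :: "'o \<Rightarrow> 'o \<Rightarrow> 'q" and e :: 'q
  assumes map_obj: "X \<in> Obj C \<Longrightarrow> Fo X \<in> Obj D"
    and map_mor: "f \<in> mor C X Y \<Longrightarrow> Fa f \<in> mor D (Fo X) (Fo Y)"
    and map_id: "X \<in> Obj C \<Longrightarrow> Fa (Idn C X) = Idn D (Fo X)"
    and map_comp: "\<lbrakk>f \<in> mor C X Y; g \<in> mor C Y Z\<rbrakk> \<Longrightarrow> Fa (g \<cdot>\<^bsub>C\<^esub> f) = Fa g \<cdot> Fa f"
    and map_add: "\<lbrakk>f \<in> mor C X Y; g \<in> mor C X Y\<rbrakk> \<Longrightarrow> Fa (f +\<^sub>a\<^bsub>C\<^esub> g) = Fa f +\<^sub>a Fa g"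
    and map_scale: "f \<in> mor C X Y \<Longrightarrow> Fa (a *\<^sub>a\<^bsub>C\<^esub> f) = a *\<^sub>a Fa f"
    and fully_faithful: "\<lbrakk>X \<in> Obj C; Y \<in> Obj C\<rbrakk>
      \<Longrightarrow> bij_betw Fa (mor C X Y) (mor D (Fo X) (Fo Y))"
    and essentially_surjective: "P \<in> Obj D \<Longrightarrow> \<exists>X \<in> Obj C. isomorphic D (Fo X) P"
    and map_tensor_mor: "\<lbrakk>X \<in> Obj C; Y \<in> Obj C\<rbrakk>
      \<Longrightarrow> J X Y \<in> mor D (Fo X \<otimes>\<^sub>o Fo Y) (Fo (X \<otimes>\<^sub>o\<^bsub>C\<^esub> Y))"
    and map_tensor_iso: "\<lbrakk>X \<in> Obj C; Y \<in> Obj C\<rbrakk> \<Longrightarrow> iso_arr D (J X Y)"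
    and map_tensor_natural: "\<lbrakk>f \<in> mor C X X'; g \<in> mor C Y Y'\<rbrakk>
      \<Longrightarrow> J X' Y' \<cdot> (Fa f \<otimes>\<^sub>a Fa g) = Fa (f \<otimes>\<^sub>a\<^bsub>C\<^esub> g) \<cdot> J X Y"
    and map_unit_mor: "e \<in> mor D \<I> (Fo \<I>\<^bsub>C\<^esub>)"
    and map_unit_iso: "iso_arr D e"
    and map_assoc: "\<lbrakk>X \<in> Obj C; Y \<in> Obj C; Z \<in> Obj C\<rbrakk>
      \<Longrightarrow> Fa (Assoc C X Y Z) \<cdot> J (X \<otimes>\<^sub>o\<^bsub>C\<^esub> Y) Z \<cdot> (J X Y \<otimes>\<^sub>a Idn D (Fo Z)) =
          J X (Y \<otimes>\<^sub>o\<^bsub>C\<^esub> Z) \<cdot> (Idn D (Fo X) \<otimes>\<^sub>a J Y Z) \<cdot> Assoc D (Fo X) (Fo Y) (Fo Z)"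
    and map_lunit: "X \<in> Obj C
      \<Longrightarrow> Fa (LUnit C X) \<cdot> J \<I>\<^bsub>C\<^esub> X \<cdot> (e \<otimes>\<^sub>a Idn D (Fo X)) = LUnit D (Fo X)"
    and map_runit: "X \<in> Obj C
      \<Longrightarrow> Fa (RUnit C X) \<cdot> J X \<I>\<^bsub>C\<^esub> \<cdot> (Idn D (Fo X) \<otimes>\<^sub>a e) = RUnit D (Fo X)"

definition monoidally_equivalent :: "('o, 'm) moncat \<Rightarrow> ('p, 'q) moncat \<Rightarrow> bool" where
  "monoidally_equivalent C D \<longleftrightarrow> (\<exists>Fo Fa J e. monoidal_equivalence C D Fo Fa J e)"

text \<open>
  The homogeneous components are full replete subcategories, given by their sets of objects
  \<open>G 0\<close> and \<open>G 1\<close>.  The component \<open>G 1\<close> is allowed to consist of zero objects only.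
\<close>

locale C2_grading =
  fixes C :: "('o, 'm) moncat" (structure) and G :: "nat \<Rightarrow> 'o set"
  assumes component_obj: "i < 2 \<Longrightarrow> G i \<subseteq> Obj C"
    and component_replete: "\<lbrakk>i < 2; X \<in> G i; isomorphic C X Y\<rbrakk> \<Longrightarrow> Y \<in> G i"
    and component_orthogonal: "\<lbrakk>i < 2; j < 2; i \<noteq> j; X \<in> G i; Y \<in> G j\<rbrakk>
      \<Longrightarrow> mor C X Y = {ZeroArr C X Y}"
    and component_decomposition: "X \<in> Obj C
      \<Longrightarrow> \<exists>S. (\<forall>i<2. S i \<in> G i) \<and> is_direct_sum C 2 S X"
    and component_tensor: "\<lbrakk>i < 2; j < 2; X \<in> G i; Y \<in> G j\<rbrakk>
      \<Longrightarrow> X \<otimes>\<^sub>o Y \<in> G ((i + j) mod 2)"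

definition C2_graded_extension :: "('o, 'm) moncat \<Rightarrow> ('p, 'q) moncat \<Rightarrow> bool" where
  "C2_graded_extension C D \<longleftrightarrow>
    (\<exists>G. C2_grading C G \<and> monoidally_equivalent (full_subcat C (G 0)) D)"

section \<open>The adjoint subcategory and its group of simple objects\<close>

text \<open>Closure under subobjects includes closure under isomorphism.\<close>

locale fusion_subcategory =
  fixes C :: "('o, 'm) moncat" (structure) and S :: "'o set"
  assumes sub_obj: "S \<subseteq> Obj C"
    and sub_unit: "\<I> \<in> S"
    and sub_tensor: "\<lbrakk>X \<in> S; Y \<in> S\<rbrakk> \<Longrightarrow> X \<otimes>\<^sub>o Y \<in> S"
    and sub_left_dual: "\<lbrakk>X \<in> S; left_dual C X Y\<rbrakk> \<Longrightarrow> Y \<in> S"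
    and sub_right_dual: "\<lbrakk>X \<in> S; left_dual C Y X\<rbrakk> \<Longrightarrow> Y \<in> S"
    and sub_direct_sum: "\<lbrakk>\<And>k. k < n \<Longrightarrow> F k \<in> S; is_direct_sum C n F X\<rbrakk> \<Longrightarrow> X \<in> S"
    and sub_subobject: "\<lbrakk>X \<in> S; f \<in> mor C Y X; mono_arr C f\<rbrakk> \<Longrightarrow> Y \<in> S"
    and sub_quotient: "\<lbrakk>X \<in> S; f \<in> mor C X Y; epi_arr C f\<rbrakk> \<Longrightarrow> Y \<in> S"

definition generated_fusion_subcategory :: "('o, 'm) moncat \<Rightarrow> 'o set \<Rightarrow> ('o, 'm) moncat" where
  "generated_fusion_subcategory C A =
    full_subcat C (\<Inter>{S. fusion_subcategory C S \<and> A \<subseteq> S})"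

definition adjoint_subcategory :: "('o, 'm) moncat \<Rightarrow> ('o, 'm) moncat" where
  "adjoint_subcategory C =
    generated_fusion_subcategory C {X \<otimes>\<^sub>o\<^bsub>C\<^esub> Y | X Y. simple_obj C X \<and> left_dual C X Y}"

text \<open>
  The product of the classes of \<open>X\<close> and \<open>Y\<close> is the class of \<open>X \<otimes> Y\<close>, written without a
  choice of representatives.
\<close>

definition simple_object_group :: "('o, 'm) moncat \<Rightarrow> 'o set monoid" where
  "simple_object_group C =
    \<lparr>carrier = simple_classes C,
     monoid.mult = (\<lambda>A B. \<Union>X \<in> A. \<Union>Y \<in> B. iso_class C (X \<otimes>\<^sub>o\<^bsub>C\<^esub> Y)),
     one = iso_class C \<I>\<^bsub>C\<^esub>\<rparr>"

definition elementary_abelian_2_group :: "('a, 'b) monoid_scheme \<Rightarrow> bool" where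
  "elementary_abelian_2_group G \<longleftrightarrow>
    group G \<and> (\<exists>n. G \<cong> product_group {..<n::nat} (\<lambda>_. integer_mod_group 2))"

end

theory Submission
  imports Defs "HOL-Computational_Algebra.Fundamental_Theorem_Algebra"
begin

text \<open>
  Let \<open>X\<close> be a simple object and \<open>u\<close> a simple constituent of \<open>X \<otimes> X\<^sup>*\<close>.  By duality there is a
  nonzero arrow \<open>u \<otimes> X \<rightarrow> X\<close>; comparing degrees puts \<open>u\<close> into the trivial component, where it is
  invertible because the equivalence with \<open>D\<close> transports inverses
  (\<open>simple_invertible_transport\<close>).  Hence \<open>u \<otimes> X\<close> is simple and \<open>u \<otimes> X \<cong> X\<close>.  The claim is thus
  that an object \<open>g\<close> with an isomorphism \<open>f : g \<otimes> X \<rightarrow> X\<close> satisfies \<open>g \<otimes> g \<cong> \<I>\<close>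
  (\<open>fixing_object_order_two\<close>).  Once this is known for the constituents of the generators of the
  adjoint subcategory, it holds throughout, because the objects all of whose simple constituents
  square to \<open>\<I>\<close> form a fusion subcategory (\<open>order_two_fusion_subcategory\<close>), and a finite group of
  exponent two is elementary abelian (\<open>exponent_two_imp_elementary\<close>).

  The isomorphism \<open>f\<close> lets \<open>X \<otimes> X\<close> absorb \<open>g\<close> in two ways: \<open>T\<close> applies \<open>f\<close> to the first factor, and
  \<open>S\<close> braids \<open>g\<close> past the first factor and applies \<open>f\<close> to the second.  Let \<open>E\<close> be the automorphism of
  \<open>X \<otimes> X\<close> with \<open>S = E T\<close>, and \<open>b\<close> the braiding of \<open>X\<close> with itself.  Naturality and the hexagons give
  \<open>b T = S (g \<otimes> b)\<close> and \<open>b S = \<chi> T (g \<otimes> b)\<close>, where the double braiding of \<open>g\<close> with \<open>X\<close> is a scalar \<open>\<chi>\<close>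
  by Schur's lemma, and so \<open>E b E = \<chi> b\<close>.  The constituents of \<open>X \<otimes> X\<close> lie in the pointed component
  and occur with multiplicity one, so endomorphisms of \<open>X \<otimes> X\<close> commute and \<open>E\<^sup>2 = \<chi>\<close>.  Another
  application of Schur's lemma shows that \<open>E\<close> commutes with \<open>T\<close> up to a scalar.  Therefore the two ways
  of absorbing \<open>g\<close> twice are proportional (\<open>absorb_second_twice\<close>): up to the braiding,
  \<open>X \<otimes> f\<^sub>2\<close> is a multiple of \<open>f\<^sub>2 \<otimes> X\<close>, where \<open>f\<^sub>2 : g \<otimes> g \<otimes> X \<rightarrow> X\<close> applies \<open>f\<close> twice.  Closing up
  the strand \<open>X\<close> by a split evaluation turns this into \<open>f\<^sub>2 = s \<otimes> X\<close> for some \<open>s : g \<otimes> g \<rightarrow> \<I>\<close>, and \<open>s\<close>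
  is invertible because \<open>f\<^sub>2\<close> is and \<open>\<I>\<close> is a retract of \<open>X \<otimes> X\<^sup>*\<close>.

  Associators are kept out of these computations by a strictification: an object \<open>X\<close> is replaced by
  the functor \<open>X \<otimes> _\<close>, a list of objects by the composite functor, and an arrow by a family of arrows
  that is natural and compatible with tensoring on the right (\<open>module_family\<close>).  Such families compose
  strictly, and each is determined by its value at \<open>\<I>\<close>.
\<close>

section \<open>Arrows, isomorphisms and inverses\<close>

text \<open>
  Membership in a hom set is split into typing conditions on domain and codomain, which the
  simplifier can decide for composite arrows.
\<close>

lemma mor_iff: "f \<in> mor C X Y \<longleftrightarrow> f \<in> Arr C \<and> Dom C f = X \<and> Cod C f = Y"
  by (simp add: mor_def)

context plain_category
begin

lemma id_arr [simp]:
  assumes "X \<in> Obj C"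
  shows "Idn C X \<in> Arr C" "Dom C (Idn C X) = X" "Cod C (Idn C X) = X"
  using id_mor[OF assms] by (simp_all add: mor_iff)

lemma comp_arr [simp]:
  assumes "f \<in> Arr C" "g \<in> Arr C" "Cod C f = Dom C g"
  shows "g \<cdot> f \<in> Arr C" "Dom C (g \<cdot> f) = Dom C f" "Cod C (g \<cdot> f) = Cod C g"
  using comp_mor[of f "Dom C f" "Dom C g" g "Cod C g"] assms by (simp_all add: mor_iff)

lemma dom_cod_obj [simp]: "f \<in> Arr C \<Longrightarrow> Dom C f \<in> Obj C" "f \<in> Arr C \<Longrightarrow> Cod C f \<in> Obj C"
  by (simp_all add: dom_obj cod_obj)

lemma comp_id [simp]:
  "f \<in> Arr C \<Longrightarrow> Cod C f = Y \<Longrightarrow> Idn C Y \<cdot> f = f"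
  "f \<in> Arr C \<Longrightarrow> Dom C f = Y \<Longrightarrow> f \<cdot> Idn C Y = f"
  using comp_id_left[of f "Dom C f" Y] comp_id_right[of f Y "Cod C f"] by (simp_all add: mor_iff)

lemma comp_assoc_arr [simp]:
  assumes "f \<in> Arr C" "g \<in> Arr C" "h \<in> Arr C" "Cod C f = Dom C g" "Cod C g = Dom C h"
  shows "(h \<cdot> g) \<cdot> f = h \<cdot> (g \<cdot> f)"
  by (rule comp_assoc[of f "Dom C f" "Cod C f" g "Cod C g" h "Cod C h"])
    (use assms in \<open>simp_all add: mor_iff\<close>)

text \<open>
  Composites are kept nested to the right, so an equation for \<open>a \<cdot> b\<close> has to be applied at the head
  of a longer composite.
\<close>

lemma comp_cong_left:
  assumes "a \<cdot> b = c" "a \<in> Arr C" "b \<in> Arr C" "k \<in> Arr C" "Cod C b = Dom C a" "Cod C k = Dom C b"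
  shows "a \<cdot> (b \<cdot> k) = c \<cdot> k"
  using comp_assoc_arr[of k b a] assms by simp

lemma mor_obj: "f \<in> mor C X Y \<Longrightarrow> X \<in> Obj C \<and> Y \<in> Obj C"
  by (auto simp: mor_iff)

lemma inverse_arrows_unique:
  assumes "inverse_arrows C f g" "inverse_arrows C f h"
  shows "g = h"
proof -
  have "(h \<cdot> f) \<cdot> g = h \<cdot> (f \<cdot> g)" by (rule comp_assoc_arr) (use assms in \<open>auto simp: inverse_arrows_def mor_iff\<close>)
  then show ?thesis using assms by (simp add: inverse_arrows_def mor_iff)
qed

lemma inverse_arrows_inv_arr: "iso_arr C f \<Longrightarrow> inverse_arrows C f (inv_arr C f)"
  unfolding iso_arr_def inv_arr_def
  by (rule theI') (auto intro: inverse_arrows_unique)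

lemma iso_arr_Arr: "iso_arr C f \<Longrightarrow> f \<in> Arr C"
  by (auto simp: iso_arr_def inverse_arrows_def)

lemma inv_arr [simp]:
  assumes "iso_arr C f"
  shows "inv_arr C f \<in> Arr C" "Dom C (inv_arr C f) = Cod C f" "Cod C (inv_arr C f) = Dom C f"
    "inv_arr C f \<cdot> f = Idn C (Dom C f)" "f \<cdot> inv_arr C f = Idn C (Cod C f)"
  using inverse_arrows_inv_arr[OF assms] by (auto simp: inverse_arrows_def mor_iff)

lemma inv_arr_cancel [simp]:
  assumes "iso_arr C f" "k \<in> Arr C"
  shows "Cod C k = Dom C f \<Longrightarrow> inv_arr C f \<cdot> (f \<cdot> k) = k"
    and "Cod C k = Cod C f \<Longrightarrow> f \<cdot> (inv_arr C f \<cdot> k) = k"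
  using comp_cong_left[OF inv_arr(4)[OF assms(1)], of k] comp_cong_left[OF inv_arr(5)[OF assms(1)], of k]
    iso_arr_Arr[OF assms(1)] assms by simp_all

lemma iso_arrI:
  assumes "f \<in> Arr C" "g \<in> Arr C" "Dom C g = Cod C f" "Cod C g = Dom C f"
    "g \<cdot> f = Idn C (Dom C f)" "f \<cdot> g = Idn C (Cod C f)"
  shows "iso_arr C f"
  using assms by (auto simp: iso_arr_def inverse_arrows_def mor_iff)

lemma iso_arr_id [simp]: "X \<in> Obj C \<Longrightarrow> iso_arr C (Idn C X)"
  by (rule iso_arrI[of _ "Idn C X"]) auto

lemma iso_arr_inv [simp]: "iso_arr C f \<Longrightarrow> iso_arr C (inv_arr C f)"
  using iso_arr_Arr[of f] by (intro iso_arrI[of _ f]) simp_all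

lemma iso_arr_comp [simp]:
  assumes "iso_arr C f" "iso_arr C g" "Cod C f = Dom C g"
  shows "iso_arr C (g \<cdot> f)"
  using assms iso_arr_Arr[OF assms(1)] iso_arr_Arr[OF assms(2)]
  by (intro iso_arrI[of _ "inv_arr C f \<cdot> inv_arr C g"]) simp_all

lemma iso_cancel_left:
  assumes "iso_arr C f" "f \<cdot> a = f \<cdot> b" "a \<in> Arr C" "b \<in> Arr C" "Cod C a = Dom C f" "Cod C b = Dom C f"
  shows "a = b"
  by (rule trans[OF inv_arr_cancel(1)[OF assms(1,3,5), symmetric, unfolded assms(2)]
    inv_arr_cancel(1)[OF assms(1,4,6)]])

lemma iso_cancel_right:
  assumes "iso_arr C f" "a \<cdot> f = b \<cdot> f" "a \<in> Arr C" "b \<in> Arr C" "Dom C a = Cod C f" "Dom C b = Cod C f"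
  shows "a = b"
proof -
  have "(a \<cdot> f) \<cdot> inv_arr C f = (b \<cdot> f) \<cdot> inv_arr C f" by (simp only: assms(2))
  then show ?thesis using assms(1,3-6) iso_arr_Arr[OF assms(1)] by simp
qed

lemma isomorphic_refl: "X \<in> Obj C \<Longrightarrow> isomorphic C X X"
  unfolding isomorphic_def by (rule bexI[of _ "Idn C X"]) (auto simp: mor_iff)

lemma isomorphic_sym: "isomorphic C X Y \<Longrightarrow> isomorphic C Y X"
  unfolding isomorphic_def
proof (elim bexE)
  fix f assume f: "f \<in> mor C X Y" "iso_arr C f"
  then show "\<exists>f\<in>mor C Y X. iso_arr C f" by (intro bexI[of _ "inv_arr C f"]) (auto simp: mor_iff)
qed

lemma isomorphic_trans [trans]: "isomorphic C X Y \<Longrightarrow> isomorphic C Y Z \<Longrightarrow> isomorphic C X Z"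
  unfolding isomorphic_def
proof (elim bexE)
  fix f g assume "f \<in> mor C X Y" "iso_arr C f" "g \<in> mor C Y Z" "iso_arr C g"
  then show "\<exists>f\<in>mor C X Z. iso_arr C f" by (intro bexI[of _ "g \<cdot> f"]) (auto simp: mor_iff)
qed

lemma isomorphicI: "iso_arr C f \<Longrightarrow> f \<in> mor C X Y \<Longrightarrow> isomorphic C X Y"
  unfolding isomorphic_def by blast

lemma isomorphic_obj: "isomorphic C X Y \<Longrightarrow> X \<in> Obj C \<and> Y \<in> Obj C"
  unfolding isomorphic_def using mor_obj by blast

lemma iso_mono: "iso_arr C f \<Longrightarrow> mono_arr C f"
  unfolding mono_arr_def mor_iff
  by (intro conjI ballI impI iso_arr_Arr) (auto simp: mor_iff intro: iso_cancel_left[of f])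

end

section \<open>Zero arrows and sums of arrows\<close>

context linear_category
begin

lemma hom_simps [simp]:
  "carrier (hom_space C X Y) = mor C X Y" "zero (hom_space C X Y) = ZeroArr C X Y"
  "add (hom_space C X Y) = AddArr C" "module.smult (hom_space C X Y) = ScaleArr C"
  by (simp_all add: hom_space_def)

lemma cring_simps [simp]:
  "carrier complex_ring = UNIV" "zero complex_ring = 0" "one complex_ring = 1"
  "add complex_ring = (+)" "monoid.mult complex_ring = (*)"
  by (simp_all add: complex_ring_def)

lemma zero_arr [simp]:
  assumes "X \<in> Obj C" "Y \<in> Obj C"
  shows "ZeroArr C X Y \<in> Arr C" "Dom C (ZeroArr C X Y) = X" "Cod C (ZeroArr C X Y) = Y"
proof -
  interpret module complex_ring "hom_space C X Y" by (rule hom_module[OF assms])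
  show "ZeroArr C X Y \<in> Arr C" "Dom C (ZeroArr C X Y) = X" "Cod C (ZeroArr C X Y) = Y"
    using M.zero_closed by (auto simp: mor_iff)
qed

lemma add_arr [simp]:
  assumes "f \<in> Arr C" "g \<in> Arr C" "Dom C g = Dom C f" "Cod C g = Cod C f"
  shows "f +\<^sub>a g \<in> Arr C" "Dom C (f +\<^sub>a g) = Dom C f" "Cod C (f +\<^sub>a g) = Cod C f"
proof -
  interpret module complex_ring "hom_space C (Dom C f) (Cod C f)" 
    by (rule hom_module) (use assms in auto)
  show "f +\<^sub>a g \<in> Arr C" "Dom C (f +\<^sub>a g) = Dom C f" "Cod C (f +\<^sub>a g) = Cod C f"
    using M.add.m_closed[of f g] assms by (auto simp: mor_iff)
qed

lemma scale_arr [simp]: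
  assumes "f \<in> Arr C"
  shows "a *\<^sub>a f \<in> Arr C" "Dom C (a *\<^sub>a f) = Dom C f" "Cod C (a *\<^sub>a f) = Cod C f"
proof -
  interpret module complex_ring "hom_space C (Dom C f) (Cod C f)"
    by (rule hom_module) (use assms in auto)
  show "a *\<^sub>a f \<in> Arr C" "Dom C (a *\<^sub>a f) = Dom C f" "Cod C (a *\<^sub>a f) = Cod C f"
    using smult_closed[of a f] assms by (auto simp: mor_iff)
qed

lemma
  assumes "f \<in> Arr C"
  shows scale_zero: "0 *\<^sub>a f = ZeroArr C (Dom C f) (Cod C f)"
    and scale_one [simp]: "1 *\<^sub>a f = f"
    and scale_scale [simp]: "a *\<^sub>a b *\<^sub>a f = (a * b) *\<^sub>a f"
    and scale_add_left: "(a + b) *\<^sub>a f = a *\<^sub>a f +\<^sub>a b *\<^sub>a f"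
    and add_zero_right [simp]: "X = Dom C f \<Longrightarrow> Y = Cod C f \<Longrightarrow> f +\<^sub>a ZeroArr C X Y = f"
    and add_zero_left [simp]: "X = Dom C f \<Longrightarrow> Y = Cod C f \<Longrightarrow> ZeroArr C X Y +\<^sub>a f = f"
proof -
  interpret module complex_ring "hom_space C (Dom C f) (Cod C f)"
    by (rule hom_module) (use assms in auto)
  have f: "f \<in> carrier (hom_space C (Dom C f) (Cod C f))" using assms by (simp add: mor_iff)
  show "0 *\<^sub>a f = ZeroArr C (Dom C f) (Cod C f)"
    using smult_l_null[OF f] by simp
  show "1 *\<^sub>a f = f" using smult_one[OF f] by simp
  show "a *\<^sub>a b *\<^sub>a f = (a * b) *\<^sub>a f" using smult_assoc1[of a b f] f by simp
  show "(a + b) *\<^sub>a f = a *\<^sub>a f +\<^sub>a b *\<^sub>a f" using smult_l_distr[of a b f] f by simp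
  show "X = Dom C f \<Longrightarrow> Y = Cod C f \<Longrightarrow> f +\<^sub>a ZeroArr C X Y = f" using M.r_zero[OF f] by simp
  show "X = Dom C f \<Longrightarrow> Y = Cod C f \<Longrightarrow> ZeroArr C X Y +\<^sub>a f = f" using M.l_zero[OF f] by simp
qed

lemma scale_add_right:
  assumes "f \<in> Arr C" "g \<in> Arr C" "Dom C g = Dom C f" "Cod C g = Cod C f"
  shows "a *\<^sub>a (f +\<^sub>a g) = a *\<^sub>a f +\<^sub>a a *\<^sub>a g"
proof -
  interpret module complex_ring "hom_space C (Dom C f) (Cod C f)"
    by (rule hom_module) (use assms in auto)
  show ?thesis using smult_r_distr[of a f g] assms by (simp add: mor_iff)
qed

lemma add_assoc_arr:
  assumes "f \<in> Arr C" "g \<in> Arr C" "h \<in> Arr C" "Dom C g = Dom C f" "Cod C g = Cod C f"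
    "Dom C h = Dom C f" "Cod C h = Cod C f"
  shows "(f +\<^sub>a g) +\<^sub>a h = f +\<^sub>a (g +\<^sub>a h)"
proof -
  interpret module complex_ring "hom_space C (Dom C f) (Cod C f)"
    by (rule hom_module) (use assms in auto)
  show ?thesis using M.add.m_assoc[of f g h] assms by (simp add: mor_iff)
qed

lemma add_comm_arr:
  assumes "f \<in> Arr C" "g \<in> Arr C" "Dom C g = Dom C f" "Cod C g = Cod C f"
  shows "f +\<^sub>a g = g +\<^sub>a f"
proof -
  interpret module complex_ring "hom_space C (Dom C f) (Cod C f)"
    by (rule hom_module) (use assms in auto)
  show ?thesis using M.add.m_comm[of f g] assms by (simp add: mor_iff)
qed

lemma comp_scale [simp]:
  assumes "f \<in> Arr C" "g \<in> Arr C" "Cod C f = Dom C g"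
  shows "(a *\<^sub>a g) \<cdot> f = a *\<^sub>a (g \<cdot> f)" "g \<cdot> (a *\<^sub>a f) = a *\<^sub>a (g \<cdot> f)"
  using comp_scale_left[of f "Dom C f" "Cod C f" g "Cod C g" a]
    comp_scale_right[of f "Dom C f" "Cod C f" g "Cod C g" a] assms by (auto simp: mor_iff)

lemma comp_zero_left [simp]:
  assumes "f \<in> Arr C" "Cod C f = Y" "Z \<in> Obj C"
  shows "ZeroArr C Y Z \<cdot> f = ZeroArr C (Dom C f) Z"
proof -
  have Y: "Y \<in> Obj C" using assms by auto
  show ?thesis using Y assms comp_scale(1)[of f "ZeroArr C Y Z" 0] by (simp add: scale_zero)
qed

lemma comp_zero_right [simp]:
  assumes "f \<in> Arr C" "Dom C f = Y" "Z \<in> Obj C"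
  shows "f \<cdot> ZeroArr C Z Y = ZeroArr C Z (Cod C f)"
proof -
  have Y: "Y \<in> Obj C" using assms by auto
  show ?thesis using Y assms comp_scale(2)[of "ZeroArr C Z Y" f 0] by (simp add: scale_zero)
qed

lemma scale_zero_arr [simp]: "X \<in> Obj C \<Longrightarrow> Y \<in> Obj C \<Longrightarrow> a *\<^sub>a ZeroArr C X Y = ZeroArr C X Y"
  using scale_scale[of "ZeroArr C X Y" a 0] scale_zero[of "ZeroArr C X Y"] by simp

text \<open>
  Monomorphisms, direct sums and linear maps of hom spaces are tested on zero arrows, and differences
  reduce equality of arrows to that case.
\<close>

abbreviation diff_arr :: "'b \<Rightarrow> 'b \<Rightarrow> 'b"  (infixl "-\<^sub>a" 65)
  where "f -\<^sub>a g \<equiv> f +\<^sub>a (-1) *\<^sub>a g"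

lemma diff_self:
  assumes "f \<in> Arr C"
  shows "f -\<^sub>a f = ZeroArr C (Dom C f) (Cod C f)"
  using scale_add_left[OF assms, of 1 "-1"] assms by (simp add: scale_zero)

lemma diff_zero_imp_eq:
  assumes "f \<in> Arr C" "g \<in> Arr C" "Dom C g = Dom C f" "Cod C g = Cod C f"
    "f -\<^sub>a g = ZeroArr C (Dom C f) (Cod C f)"
  shows "f = g"
proof -
  have "g = (f -\<^sub>a g) +\<^sub>a g" using assms by simp
  also have "\<dots> = f +\<^sub>a ((-1) *\<^sub>a g +\<^sub>a g)" using assms by (subst add_assoc_arr) auto
  also have "(-1) *\<^sub>a g +\<^sub>a g = ZeroArr C (Dom C f) (Cod C f)"
    using diff_self[of g] assms add_comm_arr[of g "(-1) *\<^sub>a g"] by simp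
  finally show ?thesis using assms by simp
qed

lemma comp_add:
  assumes "f \<in> Arr C" "g \<in> Arr C" "h \<in> Arr C" "Dom C g = Dom C f" "Cod C g = Cod C f"
  shows comp_add_r: "Dom C h = Cod C f \<Longrightarrow> h \<cdot> (f +\<^sub>a g) = h \<cdot> f +\<^sub>a h \<cdot> g"
    and comp_add_l: "Cod C h = Dom C f \<Longrightarrow> (f +\<^sub>a g) \<cdot> h = f \<cdot> h +\<^sub>a g \<cdot> h"
  using comp_add_right[of f "Dom C f" "Cod C f" g h "Cod C h"]
    comp_add_left[of h "Dom C h" "Cod C h" f "Cod C f" g] assms by (auto simp: mor_iff)

lemma zero_obj_iff: "zero_obj C X \<longleftrightarrow> X \<in> Obj C \<and> Idn C X = ZeroArr C X X"
proof
  assume "zero_obj C X"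
  then have X: "X \<in> Obj C" and "\<exists>!f. f \<in> mor C X X" by (auto simp: zero_obj_def)
  moreover have "Idn C X \<in> mor C X X" "ZeroArr C X X \<in> mor C X X" using X by (auto simp: mor_iff)
  ultimately show "X \<in> Obj C \<and> Idn C X = ZeroArr C X X" by blast
next
  assume a: "X \<in> Obj C \<and> Idn C X = ZeroArr C X X"
  have 1: "f = ZeroArr C X Y" if "f \<in> mor C X Y" for f Y
  proof -
    have "f = f \<cdot> Idn C X" using that by (simp add: mor_iff)
    also have "\<dots> = f \<cdot> ZeroArr C X X" using a by simp
    also have "\<dots> = ZeroArr C X Y" using that a by (auto simp: mor_iff)
    finally show ?thesis .
  qed
  have 2: "f = ZeroArr C Y X" if "f \<in> mor C Y X" for f Y
  proof -
    have "f = Idn C X \<cdot> f" using that by (simp add: mor_iff)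
    also have "\<dots> = ZeroArr C X X \<cdot> f" using a by simp
    also have "\<dots> = ZeroArr C Y X" using that a by (auto simp: mor_iff)
    finally show ?thesis .
  qed
  have "(\<exists>!f. f \<in> mor C X Y) \<and> (\<exists>!f. f \<in> mor C Y X)" if "Y \<in> Obj C" for Y
    using 1[of _ Y] 2[of _ Y] that a by (intro conjI ex1I[of _ "ZeroArr C X Y"] ex1I[of _ "ZeroArr C Y X"]) (auto simp: mor_iff)
  then show "zero_obj C X" using a by (auto simp: zero_obj_def)
qed

text \<open>
  The identity is the sum of the idempotents \<open>\<iota> k \<cdot> \<pi> k\<close>, so an additive operation that does not kill
  the identity does not kill one of them.  Composition and tensoring with a fixed arrow are the
  instances that locate simple constituents.
\<close>

lemma direct_sum_test:
  fixes n :: nat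
  assumes X: "is_direct_sum C n S X" and AO: "A \<in> Obj C" and BO: "B \<in> Obj C"
    and F: "\<And>f. f \<in> mor C X X \<Longrightarrow> F f \<in> mor C A B"
    and F_add: "\<And>f g. f \<in> mor C X X \<Longrightarrow> g \<in> mor C X X \<Longrightarrow> F (f +\<^sub>a g) = F f +\<^sub>a F g"
    and F_zero: "F (ZeroArr C X X) = ZeroArr C A B"
    and nz: "F (Idn C X) \<noteq> ZeroArr C A B"
  obtains k \<iota> \<pi> where "k < n" "\<iota> \<in> mor C (S k) X" "\<pi> \<in> mor C X (S k)" "\<pi> \<cdot> \<iota> = Idn C (S k)"
    "F (\<iota> \<cdot> \<pi>) \<noteq> ZeroArr C A B"
proof -
  from X[unfolded is_direct_sum_def] obtain \<iota> \<pi> where XO: "X \<in> Obj C"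
    and ip: "\<forall>k<n. \<iota> k \<in> mor C (S k) X \<and> \<pi> k \<in> mor C X (S k)"
    and pi: "\<forall>j<n. \<forall>k<n. \<pi> j \<cdot> \<iota> k = (if j = k then Idn C (S k) else ZeroArr C (S k) (S j))"
    and idX: "Idn C X = finsum (hom_space C X X) (\<lambda>k. \<iota> k \<cdot> \<pi> k) {..<n}"
    by (elim conjE exE) (rule that)
  interpret module complex_ring "hom_space C X X" by (rule hom_module[OF XO XO])
  let ?h = "\<lambda>k. \<iota> k \<cdot> \<pi> k"
  have h: "?h k \<in> mor C X X" if "k < n" for k using ip that by (auto simp: mor_iff)
  have "\<exists>k<n. F (?h k) \<noteq> ZeroArr C A B"
  proof (rule ccontr)
    assume "\<not> ?thesis"
    then have Fh: "F (?h k) = ZeroArr C A B" if "k < n" for k using that by blast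
    have "F (finsum (hom_space C X X) ?h {..<m}) = ZeroArr C A B
        \<and> finsum (hom_space C X X) ?h {..<m} \<in> mor C X X" if "m \<le> n" for m
      using that
    proof (induction m)
      case 0
      then show ?case using F_zero XO by (simp add: mor_iff)
    next
      case (Suc m)
      have hm: "?h m \<in> mor C X X" using h Suc by simp
      have hin: "?h \<in> {..<m} \<rightarrow> carrier (hom_space C X X)" using h Suc by auto
      have "finsum (hom_space C X X) ?h {..<Suc m} = ?h m +\<^sub>a finsum (hom_space C X X) ?h {..<m}"
        using M.finsum_insert[of "{..<m}" m ?h] hin hm by (simp add: lessThan_Suc)
      then show ?case using Suc hm AO BO F_add[OF hm] Fh[of m] by (auto simp: mor_iff)
    qed
    then show False using nz unfolding idX by blast
  qed
  then show thesis using that ip pi by auto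
qed

lemma direct_sum_nonzero_out:
  assumes X: "is_direct_sum C n S X" and f: "f \<in> Arr C" "Dom C f = X" "f \<noteq> ZeroArr C X (Cod C f)"
  shows "\<exists>k<n. \<exists>\<iota> \<in> mor C (S k) X. f \<cdot> \<iota> \<noteq> ZeroArr C (S k) (Cod C f)"
proof -
  obtain k \<iota> \<pi> where k: "k < n" "\<iota> \<in> mor C (S k) X" "\<pi> \<in> mor C X (S k)"
    "f \<cdot> (\<iota> \<cdot> \<pi>) \<noteq> ZeroArr C X (Cod C f)"
    by (rule direct_sum_test[OF X, where F = "\<lambda>h. f \<cdot> h" and A = X and B = "Cod C f"])
      (use f in \<open>auto simp: mor_iff comp_add_r\<close>)
  have "f \<cdot> \<iota> \<noteq> ZeroArr C (S k) (Cod C f)"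
  proof
    assume "f \<cdot> \<iota> = ZeroArr C (S k) (Cod C f)"
    from comp_cong_left[OF this, of \<pi>] show False using k f by (simp add: mor_iff)
  qed
  then show ?thesis using k by blast
qed

lemma direct_sum_nonzero_in:
  assumes X: "is_direct_sum C n S X" and f: "f \<in> Arr C" "Cod C f = X" "f \<noteq> ZeroArr C (Dom C f) X"
  shows "\<exists>k<n. \<exists>\<pi> \<in> mor C X (S k). \<exists>\<iota> \<in> mor C (S k) X.
    \<pi> \<cdot> \<iota> = Idn C (S k) \<and> \<pi> \<cdot> f \<noteq> ZeroArr C (Dom C f) (S k)"
proof -
  obtain k \<iota> \<pi> where k: "k < n" "\<iota> \<in> mor C (S k) X" "\<pi> \<in> mor C X (S k)" "\<pi> \<cdot> \<iota> = Idn C (S k)"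
    "(\<iota> \<cdot> \<pi>) \<cdot> f \<noteq> ZeroArr C (Dom C f) X"
    by (rule direct_sum_test[OF X, where F = "\<lambda>h. h \<cdot> f" and A = "Dom C f" and B = X])
      (use f in \<open>auto simp: mor_iff comp_add_l\<close>)
  have "\<pi> \<cdot> f \<noteq> ZeroArr C (Dom C f) (S k)"
  proof
    assume "\<pi> \<cdot> f = ZeroArr C (Dom C f) (S k)"
    then show False using k f by (auto simp: mor_iff)
  qed
  then show ?thesis using k by blast
qed

end

section \<open>Simple objects: Schur's lemma\<close>

text \<open>
  Gaussian elimination by induction on the number \<open>n\<close> of equations.  The unknowns are indexed by an
  arbitrary finite set so that the pivot can be removed from it.
\<close>

lemma homogeneous_system_nontrivial:
  fixes a :: "'i \<Rightarrow> nat \<Rightarrow> 'f :: field"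
  assumes "finite J" "n < card J"
  shows "\<exists>d. (\<exists>j\<in>J. d j \<noteq> 0) \<and> (\<forall>k<n. (\<Sum>j\<in>J. d j * a j k) = 0)"
  using assms
proof (induction n arbitrary: J a)
  case 0
  then have "J \<noteq> {}" by auto
  then show ?case by (intro exI[of _ "\<lambda>_. 1"]) auto
next
  case (Suc n)
  show ?case
  proof (cases "\<forall>j\<in>J. a j n = 0")
    case True
    have "n < card J" using Suc.prems by simp
    then obtain d where d: "\<exists>j\<in>J. d j \<noteq> 0" "\<forall>k<n. (\<Sum>j\<in>J. d j * a j k) = 0"
      using Suc.IH[of J a] Suc.prems(1) by blast
    have "(\<Sum>j\<in>J. d j * a j k) = 0" if "k < Suc n" for k
      using that d(2) True by (cases "k = n") auto
    with d(1) show ?thesis by blast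
  next
    case False
    then obtain p where p: "p \<in> J" "a p n \<noteq> 0" by blast
    define b where "b j k = a j k - a j n / a p n * a p k" for j k
    have "n < card (J - {p})" using Suc.prems p by simp
    then obtain d where d: "\<exists>j\<in>J - {p}. d j \<noteq> 0" "\<forall>k<n. (\<Sum>j\<in>J - {p}. d j * b j k) = 0"
      using Suc.IH[of "J - {p}" b] Suc.prems(1) by blast
    define s where "s = (\<Sum>j\<in>J - {p}. d j * a j n)"
    define d' where "d' j = (if j = p then - s / a p n else d j)" for j
    have *: "(\<Sum>j\<in>J. d' j * a j k) = - s / a p n * a p k + (\<Sum>j\<in>J - {p}. d j * a j k)" for k
      using sum.remove[OF Suc.prems(1) p(1), of "\<lambda>j. d' j * a j k"] by (simp add: d'_def)
    have **: "(\<Sum>j\<in>J - {p}. d j * b j k) = (\<Sum>j\<in>J - {p}. d j * a j k) - s / a p n * a p k" for k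
      by (simp add: b_def s_def right_diff_distrib sum_subtractf sum_distrib_right sum_divide_distrib
          mult.assoc)
    have "(\<Sum>j\<in>J. d' j * a j k) = 0" if "k < Suc n" for k
    proof (cases "k = n")
      case True
      then show ?thesis using p * [of n] by (simp add: s_def)
    next
      case False
      then show ?thesis using that d(2) * [of k] ** [of k] by simp
    qed
    moreover have "\<exists>j\<in>J. d' j \<noteq> 0" using d(1) by (auto simp: d'_def)
    ultimately show ?thesis by blast
  qed
qed

context linear_category
begin

lemma add_interchange:
  assumes "f \<in> mor C X Y" "g \<in> mor C X Y" "h \<in> mor C X Y" "k \<in> mor C X Y"
  shows "(f +\<^sub>a g) +\<^sub>a (h +\<^sub>a k) = (f +\<^sub>a h) +\<^sub>a (g +\<^sub>a k)"
proof -
  have "g +\<^sub>a (h +\<^sub>a k) = h +\<^sub>a (g +\<^sub>a k)"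
    using assms add_assoc_arr[of g h k] add_assoc_arr[of h g k] add_comm_arr[of g h]
    by (simp add: mor_iff)
  then show ?thesis
    using assms add_assoc_arr[of f g "h +\<^sub>a k"] add_assoc_arr[of f h "g +\<^sub>a k"]
    by (simp add: mor_iff)
qed

lemma mono_arrI_zero:
  assumes f: "f \<in> Arr C"
    and z: "\<And>u. u \<in> Arr C \<Longrightarrow> Cod C u = Dom C f \<Longrightarrow> f \<cdot> u = ZeroArr C (Dom C u) (Cod C f)
      \<Longrightarrow> u = ZeroArr C (Dom C u) (Dom C f)"
  shows "mono_arr C f"
  unfolding mono_arr_def
proof (intro conjI ballI impI)
  fix W u v
  assume uv: "u \<in> mor C W (Dom C f)" "v \<in> mor C W (Dom C f)" and eq: "f \<cdot> u = f \<cdot> v"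
  have "f \<cdot> (u -\<^sub>a v) = f \<cdot> u -\<^sub>a f \<cdot> v"
    using uv f by (simp add: mor_iff comp_add_r)
  also have "\<dots> = ZeroArr C W (Cod C f)" 
    unfolding eq using uv f by (simp add: mor_iff diff_self)
  finally have "f \<cdot> (u -\<^sub>a v) = ZeroArr C W (Cod C f)" .
  then have "u -\<^sub>a v = ZeroArr C W (Dom C f)"
    using z[of "u -\<^sub>a v"] uv f by (simp add: mor_iff)
  then show "u = v" using uv f by (auto intro!: diff_zero_imp_eq[of u v] simp: mor_iff)
qed (rule f)

lemma mono_zero:
  assumes "mono_arr C f" "u \<in> Arr C" "Cod C u = Dom C f" "f \<cdot> u = ZeroArr C (Dom C u) (Cod C f)"
  shows "u = ZeroArr C (Dom C u) (Dom C f)"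
proof -
  have f: "f \<in> Arr C" using assms(1) by (simp add: mono_arr_def)
  have "f \<cdot> u = f \<cdot> ZeroArr C (Dom C u) (Dom C f)" unfolding assms(4) using f assms(2) by simp
  moreover have "u \<in> mor C (Dom C u) (Dom C f)" 
    "ZeroArr C (Dom C u) (Dom C f) \<in> mor C (Dom C u) (Dom C f)"
    using f assms(2,3) by (simp_all add: mor_iff)
  ultimately show ?thesis using assms(1,2) dom_cod_obj(1)[of u] unfolding mono_arr_def by blast
qed

lemma epi_zero:
  assumes "epi_arr C f" "u \<in> Arr C" "Dom C u = Cod C f" "u \<cdot> f = ZeroArr C (Dom C f) (Cod C u)"
  shows "u = ZeroArr C (Cod C f) (Cod C u)"
proof -
  have f: "f \<in> Arr C" using assms(1) by (simp add: epi_arr_def)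
  have "u \<cdot> f = ZeroArr C (Cod C f) (Cod C u) \<cdot> f" unfolding assms(4) using f assms(2) by simp
  moreover have "u \<in> mor C (Cod C f) (Cod C u)" 
    "ZeroArr C (Cod C f) (Cod C u) \<in> mor C (Cod C f) (Cod C u)"
    using f assms(2,3) by (simp_all add: mor_iff)
  ultimately show ?thesis using assms(1,2) dom_cod_obj(2)[of u] unfolding epi_arr_def by blast
qed

lemma simple_objD:
  assumes "simple_obj C X"
  shows "X \<in> Obj C" "Idn C X \<noteq> ZeroArr C X X"
  using assms zero_obj_iff by (auto simp: simple_obj_def)

definition poly_end :: "'a \<Rightarrow> 'b \<Rightarrow> complex poly \<Rightarrow> 'b" where
  "poly_end X \<phi> p = fold_coeffs (\<lambda>a f. a *\<^sub>a Idn C X +\<^sub>a \<phi> \<cdot> f) p (ZeroArr C X X)"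

context
  fixes X \<phi>
  assumes X: "X \<in> Obj C" and \<phi>: "\<phi> \<in> Arr C" "Dom C \<phi> = X" "Cod C \<phi> = X"
begin

lemma poly_end_0: "poly_end X \<phi> 0 = ZeroArr C X X"
  by (simp add: poly_end_def)

lemma poly_end_pCons: "poly_end X \<phi> (pCons a p) = a *\<^sub>a Idn C X +\<^sub>a \<phi> \<cdot> poly_end X \<phi> p"
proof (cases "a = 0 \<and> p = 0")
  case True
  then show ?thesis using X \<phi> by (simp add: poly_end_def scale_zero)
next
  case False
  then show ?thesis by (auto simp: poly_end_def)
qed

lemma poly_end_arr [simp]:
  "poly_end X \<phi> p \<in> Arr C" "Dom C (poly_end X \<phi> p) = X" "Cod C (poly_end X \<phi> p) = X"
proof -
  have "poly_end X \<phi> p \<in> Arr C \<and> Dom C (poly_end X \<phi> p) = X \<and> Cod C (poly_end X \<phi> p) = X"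
    using X \<phi> by (induction p) (auto simp: poly_end_0 poly_end_pCons)
  then show "poly_end X \<phi> p \<in> Arr C" "Dom C (poly_end X \<phi> p) = X" "Cod C (poly_end X \<phi> p) = X"
    by auto
qed

lemma poly_end_add: "poly_end X \<phi> (p + q) = poly_end X \<phi> p +\<^sub>a poly_end X \<phi> q"
proof (induction p q rule: poly_induct2)
  case 0
  then show ?case using X by (simp add: poly_end_0)
next
  case (pCons a p b q)
  let ?A = "a *\<^sub>a Idn C X" and ?B = "b *\<^sub>a Idn C X"
    and ?P = "\<phi> \<cdot> poly_end X \<phi> p" and ?Q = "\<phi> \<cdot> poly_end X \<phi> q"
  have arr: "?A \<in> mor C X X" "?B \<in> mor C X X" "?P \<in> mor C X X" "?Q \<in> mor C X X"
    using X \<phi> by (simp_all add: mor_iff)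
  have "poly_end X \<phi> (pCons a p + pCons b q) = (?A +\<^sub>a ?B) +\<^sub>a (?P +\<^sub>a ?Q)"
    using pCons X \<phi> by (simp add: poly_end_pCons scale_add_left comp_add_r)
  also have "\<dots> = (?A +\<^sub>a ?P) +\<^sub>a (?B +\<^sub>a ?Q)"
    by (rule add_interchange[OF arr])
  finally show ?case by (simp add: poly_end_pCons)
qed

lemma poly_end_smult: "poly_end X \<phi> (Polynomial.smult c p) = c *\<^sub>a poly_end X \<phi> p"
  using X \<phi> by (induction p) (auto simp: poly_end_0 poly_end_pCons scale_add_right)

text \<open>
  The one instance of multiplicativity of evaluation that factoring out roots requires.
\<close>

lemma poly_end_linear_factor:
  "poly_end X \<phi> ([:- r, 1:] * q) = (\<phi> -\<^sub>a r *\<^sub>a Idn C X) \<cdot> poly_end X \<phi> q"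
proof -
  have "[:- r, 1:] * q = pCons 0 q + Polynomial.smult (- r) q"
    by (simp add: mult_pCons_left)
  then show ?thesis using X \<phi>
    by (simp only: poly_end_add poly_end_smult poly_end_pCons) (simp add: comp_add_l scale_zero)
qed

text \<open>
  Endomorphism spaces are finite-dimensional: if \<open>n\<close> arrows span, the \<open>n + 1\<close> powers of \<open>\<phi>\<close> up to the
  \<open>n\<close>-th satisfy a nontrivial linear relation.
\<close>

lemma annihilating_polynomial: "\<exists>p. p \<noteq> 0 \<and> poly_end X \<phi> p = ZeroArr C X X"
proof -
  interpret module complex_ring "hom_space C X X" by (rule hom_module[OF X X])
  obtain n :: nat and e where e: "\<And>k. k < n \<Longrightarrow> e k \<in> mor C X X"
    and span: "\<And>f. f \<in> mor C X X \<Longrightarrow> \<exists>a. f = finsum (hom_space C X X) (\<lambda>k. a k *\<^sub>a e k) {..<n}"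
    using hom_finite_dim[OF X X] by blast
  define comb where "comb a = finsum (hom_space C X X) (\<lambda>k. a k *\<^sub>a e k) {..<n}" for a
  have ec: "(\<lambda>k. a k *\<^sub>a e k) \<in> {..<n} \<rightarrow> mor C X X" for a :: "nat \<Rightarrow> complex"
    using e by (auto simp: mor_iff)
  have comb_add: "comb (\<lambda>k. a k + b k) = comb a +\<^sub>a comb b" for a b
  proof -
    have "comb (\<lambda>k. a k + b k) = finsum (hom_space C X X) (\<lambda>k. a k *\<^sub>a e k +\<^sub>a b k *\<^sub>a e k) {..<n}"
      unfolding comb_def
      by (rule M.finsum_cong') (use e in \<open>auto simp: mor_iff scale_add_left\<close>)
    then show ?thesis using M.finsum_addf[of "\<lambda>k. a k *\<^sub>a e k" "{..<n}" "\<lambda>k. b k *\<^sub>a e k"] ec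
      by (simp add: comb_def)
  qed
  have comb_scale: "comb (\<lambda>k. c * a k) = c *\<^sub>a comb a" for c a
  proof -
    have "comb (\<lambda>k. c * a k) = finsum (hom_space C X X) (\<lambda>k. c *\<^sub>a a k *\<^sub>a e k) {..<n}"
      unfolding comb_def
      by (rule M.finsum_cong') (use e in \<open>auto simp: mor_iff\<close>)
    then show ?thesis using finsum_smult_ldistr[of "{..<n}" c "\<lambda>k. a k *\<^sub>a e k"] ec
      by (simp add: comb_def)
  qed
  have comb_zero: "comb (\<lambda>k. 0) = ZeroArr C X X"
  proof -
    have "comb (\<lambda>k. 0) = finsum (hom_space C X X) (\<lambda>k. ZeroArr C X X) {..<n}"
      unfolding comb_def
      by (rule M.finsum_cong') (use e X in \<open>auto simp: mor_iff scale_zero\<close>)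
    then show ?thesis using M.finsum_zero[of "{..<n}"] by simp
  qed
  have "\<forall>j. \<exists>a. poly_end X \<phi> (monom 1 j) = comb a"
    using span by (simp add: comb_def mor_iff)
  then obtain a where a: "\<And>j. poly_end X \<phi> (monom 1 j) = comb (a j)" by metis
  obtain d where d: "\<exists>j\<in>{..n}. d j \<noteq> 0" "\<forall>k<n. (\<Sum>j\<in>{..n}. d j * a j k) = 0"
    using homogeneous_system_nontrivial[of "{..n}" n a] by auto
  define p where "p = (\<Sum>j\<le>n. monom (d j) j)"
  have "poly_end X \<phi> (\<Sum>j\<in>J. monom (d j) j) = comb (\<lambda>k. \<Sum>j\<in>J. d j * a j k)" if "finite J" for J
    using that
  proof (induction J)
    case empty
    then show ?case by (simp add: poly_end_0 comb_zero)
  next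
    case (insert j J)
    have "monom (d j) j = Polynomial.smult (d j) (monom 1 j)" by (simp add: smult_monom)
    then have "poly_end X \<phi> (monom (d j) j) = comb (\<lambda>k. d j * a j k)"
      by (simp only: poly_end_smult a comb_scale)
    then show ?case using insert by (simp add: poly_end_add comb_add)
  qed
  then have "poly_end X \<phi> p = comb (\<lambda>k. \<Sum>j\<le>n. d j * a j k)" by (simp add: p_def)
  also have "\<dots> = comb (\<lambda>k. 0)"
    unfolding comb_def by (rule M.finsum_cong') (use e X d(2) in \<open>auto simp: mor_iff\<close>)
  finally have "poly_end X \<phi> p = ZeroArr C X X" by (simp add: comb_zero)
  moreover obtain j where j: "j \<le> n" "d j \<noteq> 0" using d(1) by auto
  have "coeff p j = d j" using j by (simp add: p_def coeff_sum)
  then have "p \<noteq> 0" using j by auto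
  ultimately show ?thesis by blast
qed

text \<open>Divide an annihilating polynomial by linear factors until it stops annihilating.\<close>

lemma eigenvector_exists:
  assumes "Idn C X \<noteq> ZeroArr C X X"
  shows "\<exists>r. \<exists>h \<in> mor C X X. h \<noteq> ZeroArr C X X \<and> (\<phi> -\<^sub>a r *\<^sub>a Idn C X) \<cdot> h = ZeroArr C X X"
proof -
  have "\<exists>r. \<exists>h \<in> mor C X X. h \<noteq> ZeroArr C X X \<and> (\<phi> -\<^sub>a r *\<^sub>a Idn C X) \<cdot> h = ZeroArr C X X"
    if "p \<noteq> 0" "poly_end X \<phi> p = ZeroArr C X X" for p
    using that
  proof (induction "degree p" arbitrary: p rule: less_induct)
    case less
    show ?case
    proof (cases "degree p = 0")
      case True
      then obtain c where c: "p = [:c:]" by (meson degree_eq_zeroE)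
      then have "c \<noteq> 0" using less by auto
      have "c *\<^sub>a Idn C X = ZeroArr C X X"
        using less(3) X \<phi> by (simp add: c poly_end_pCons poly_end_0)
      then have "(1 / c) *\<^sub>a c *\<^sub>a Idn C X = (1 / c) *\<^sub>a ZeroArr C X X" by simp
      then show ?thesis using \<open>c \<noteq> 0\<close> assms X by simp
    next
      case False
      then have "\<not> constant (poly p)" by (simp add: constant_degree)
      then obtain r where "poly p r = 0" using fundamental_theorem_of_algebra by blast
      then obtain q where q: "p = [:- r, 1:] * q" using poly_eq_0_iff_dvd by blast
      show ?thesis
      proof (cases "poly_end X \<phi> q = ZeroArr C X X")
        case True
        have "q \<noteq> 0" using less q by auto
        then have "degree p = Suc (degree q)" unfolding q by (subst degree_mult_eq) auto
        then show ?thesis using less(1)[of q] True \<open>q \<noteq> 0\<close> by simp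
      next
        case False
        have "(\<phi> -\<^sub>a r *\<^sub>a Idn C X) \<cdot> poly_end X \<phi> q = ZeroArr C X X"
          using less(3) unfolding q poly_end_linear_factor .
        moreover have "poly_end X \<phi> q \<in> mor C X X" by (simp add: mor_iff)
        ultimately show ?thesis using False by blast
      qed
    qed
  qed
  then show ?thesis using annihilating_polynomial by blast
qed

end

end

context abelian_linear_category
begin

text \<open>
  The kernel of a nonzero arrow out of a simple object is zero, so the arrow is a monomorphism into
  a simple object.
\<close>

lemma nonzero_between_simples_iso:
  assumes S: "simple_obj C S" and X: "simple_obj C X" and f: "f \<in> mor C S X" "f \<noteq> ZeroArr C S X"
  shows "iso_arr C f"
proof -
  have fa: "f \<in> Arr C" "Dom C f = S" "Cod C f = X" using f by (auto simp: mor_iff)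
  have SX: "S \<in> Obj C" "X \<in> Obj C" using S X simple_objD by auto
  obtain k where "is_kernel C f k" using kernels fa by blast
  then have k: "k \<in> Arr C" "Cod C k = S" "f \<cdot> k = ZeroArr C (Dom C k) X"
    and uni: "\<And>W h. W \<in> Obj C \<Longrightarrow> h \<in> mor C W S \<Longrightarrow> f \<cdot> h = ZeroArr C W X \<Longrightarrow>
       \<exists>!u. u \<in> mor C W (Dom C k) \<and> k \<cdot> u = h"
    using fa by (auto simp: is_kernel_def)
  have "mono_arr C k"
    unfolding mono_arr_def
  proof (intro conjI ballI impI)
    fix W u v assume a: "W \<in> Obj C" "u \<in> mor C W (Dom C k)" "v \<in> mor C W (Dom C k)" "k \<cdot> u = k \<cdot> v"
    have "k \<cdot> u \<in> mor C W S" using a k by (simp add: mor_iff)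
    moreover have "f \<cdot> (k \<cdot> u) = ZeroArr C W X" 
      using comp_cong_left[OF k(3), of u] a k fa SX by (simp add: mor_iff)
    ultimately have "\<exists>!w. w \<in> mor C W (Dom C k) \<and> k \<cdot> w = k \<cdot> u" using uni a(1) by blast
    then show "u = v" using a by metis
  qed (rule k)
  then have "zero_obj C (Dom C k) \<or> iso_arr C k"
    using S k unfolding simple_obj_def by (auto simp: mor_iff)
  then have zk: "zero_obj C (Dom C k)"
  proof
    assume "iso_arr C k"
    moreover have "f \<cdot> k = ZeroArr C S X \<cdot> k" unfolding k(3) using k SX by simp
    ultimately have "f = ZeroArr C S X" using iso_cancel_right[of k f] k fa SX by auto
    then show ?thesis using f by simp
  qed
  have "mono_arr C f"
  proof (rule mono_arrI_zero)
    fix u assume u: "u \<in> Arr C" "Cod C u = Dom C f" "f \<cdot> u = ZeroArr C (Dom C u) (Cod C f)"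
    then obtain v where v: "v \<in> mor C (Dom C u) (Dom C k)" "k \<cdot> v = u"
      using uni[of "Dom C u" u] fa by (auto simp: mor_iff)
    have K: "Dom C k \<in> Obj C" using k by simp
    have "v = Idn C (Dom C k) \<cdot> v" using v by (simp add: mor_iff)
    also have "\<dots> = ZeroArr C (Dom C u) (Dom C k)" using zk v K unfolding zero_obj_iff by (simp add: mor_iff)
    finally have "u = k \<cdot> ZeroArr C (Dom C u) (Dom C k)" using v by simp
    then show "u = ZeroArr C (Dom C u) (Dom C f)" using k fa u by simp
  qed (rule fa)
  then have "zero_obj C S \<or> iso_arr C f"
    using X f SX unfolding simple_obj_def by blast
  then show ?thesis using S by (simp add: simple_obj_def)
qed

text \<open>
  Schur's lemma: for an eigenvalue \<open>r\<close>, the arrow \<open>f - r\<close> kills something nonzero, so it is not an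
  isomorphism and must vanish.
\<close>

lemma simple_end_scalar:
  assumes X: "simple_obj C X" and f: "f \<in> mor C X X"
  shows "\<exists>r. f = r *\<^sub>a Idn C X"
proof -
  have XO: "X \<in> Obj C" and nz: "Idn C X \<noteq> ZeroArr C X X" using simple_objD[OF X] by auto
  have fa: "f \<in> Arr C" "Dom C f = X" "Cod C f = X" using f by (auto simp: mor_iff)
  obtain r h where h: "h \<in> mor C X X" "h \<noteq> ZeroArr C X X" "(f -\<^sub>a r *\<^sub>a Idn C X) \<cdot> h = ZeroArr C X X"
    using eigenvector_exists[OF XO fa nz] by blast
  have m: "f -\<^sub>a r *\<^sub>a Idn C X \<in> mor C X X" using fa XO by (simp add: mor_iff)
  have "f -\<^sub>a r *\<^sub>a Idn C X = ZeroArr C X X"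
  proof (rule ccontr)
    assume "f -\<^sub>a r *\<^sub>a Idn C X \<noteq> ZeroArr C X X"
    then have "mono_arr C (f -\<^sub>a r *\<^sub>a Idn C X)"
      using nonzero_between_simples_iso[OF X X m] iso_mono by blast
    from mono_zero[OF this, of h] have "h = ZeroArr C X X" using h m by (simp add: mor_iff)
    then show False using h by simp
  qed
  then have "f = r *\<^sub>a Idn C X" using fa XO by (auto intro!: diff_zero_imp_eq[of f])
  then show ?thesis ..
qed

end

context semisimple_category
begin

text \<open>
  Some simple summand of the source is not killed, hence maps isomorphically, and its inverse
  composed with the inclusion is a section.
\<close>

lemma nonzero_to_simple_split:
  assumes X: "simple_obj C X" and f: "f \<in> mor C W X" "f \<noteq> ZeroArr C W X"
  shows "\<exists>t \<in> mor C X W. f \<cdot> t = Idn C X"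
proof -
  have fa: "f \<in> Arr C" "Dom C f = W" "Cod C f = X" using f by (auto simp: mor_iff)
  have "W \<in> Obj C" using fa by auto
  then obtain n S where S: "\<forall>k<n. simple_obj C (S k)" "is_direct_sum C n S W" using semisimple by blast
  obtain k \<iota> where k: "k < n" "\<iota> \<in> mor C (S k) W" "f \<cdot> \<iota> \<noteq> ZeroArr C (S k) X"
    using direct_sum_nonzero_out[OF S(2) fa(1,2)] f fa by auto
  have "f \<cdot> \<iota> \<in> mor C (S k) X" using k fa by (simp add: mor_iff)
  then have "iso_arr C (f \<cdot> \<iota>)" using nonzero_between_simples_iso S(1) X k by blast
  then have i: "iso_arr C (f \<cdot> \<iota>)" .
  have "f \<cdot> (\<iota> \<cdot> inv_arr C (f \<cdot> \<iota>)) = (f \<cdot> \<iota>) \<cdot> inv_arr C (f \<cdot> \<iota>)"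
    using k fa inv_arr(1-3)[OF i] by (intro comp_assoc_arr[symmetric]) (simp_all add: mor_iff)
  also have "\<dots> = Idn C X" using k fa inv_arr(5)[OF i] by (simp only: comp_arr mor_iff)
  finally have "f \<cdot> (\<iota> \<cdot> inv_arr C (f \<cdot> \<iota>)) = Idn C X" .
  moreover have "\<iota> \<cdot> inv_arr C (f \<cdot> \<iota>) \<in> mor C X W"
    using k fa inv_arr(1-3)[OF i] by (simp add: mor_iff)
  ultimately show ?thesis by blast
qed

lemma nonzero_from_simple_split:
  assumes S: "simple_obj C S" and f: "f \<in> mor C S W" "f \<noteq> ZeroArr C S W"
  shows "\<exists>p \<in> mor C W S. p \<cdot> f = Idn C S"
proof -
  have fa: "f \<in> Arr C" "Dom C f = S" "Cod C f = W" using f by (auto simp: mor_iff)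
  have "W \<in> Obj C" using fa by auto
  then obtain n T where T: "\<forall>k<n. simple_obj C (T k)" "is_direct_sum C n T W" using semisimple by blast
  obtain k \<pi> where k: "k < n" "\<pi> \<in> mor C W (T k)" "\<pi> \<cdot> f \<noteq> ZeroArr C S (T k)"
    using direct_sum_nonzero_in[OF T(2) fa(1,3)] f fa by auto
  have "\<pi> \<cdot> f \<in> mor C S (T k)" using k fa by (simp add: mor_iff)
  then have i: "iso_arr C (\<pi> \<cdot> f)" using nonzero_between_simples_iso T(1) S k by blast
  then have "(inv_arr C (\<pi> \<cdot> f) \<cdot> \<pi>) \<cdot> f = Idn C S" "inv_arr C (\<pi> \<cdot> f) \<cdot> \<pi> \<in> mor C W S"
    using k fa inv_arr(4)[OF i] by (simp_all add: mor_iff)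
  then show ?thesis by blast
qed

lemma simple_obj_isomorphic:
  assumes S: "simple_obj C S" and "isomorphic C W S"
  shows "simple_obj C W"
proof -
  obtain j where j: "j \<in> Arr C" "Dom C j = W" "Cod C j = S" "iso_arr C j"
    using assms(2) by (auto simp: isomorphic_def mor_iff)
  have W: "W \<in> Obj C" and SO: "S \<in> Obj C" using j by auto
  have "Idn C W \<noteq> ZeroArr C W W"
  proof
    assume z: "Idn C W = ZeroArr C W W"
    have "Idn C S = j \<cdot> (Idn C W \<cdot> inv_arr C j)" using j by simp
    also have "\<dots> = ZeroArr C S S" unfolding z using j W SO by simp
    finally show False using simple_objD[OF S] by simp
  qed
  moreover have "zero_obj C Y \<or> iso_arr C f" if f: "f \<in> mor C Y W" "mono_arr C f" for f Y
  proof -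
    have fa: "f \<in> Arr C" "Dom C f = Y" "Cod C f = W" using f by (auto simp: mor_iff)
    have "mono_arr C (j \<cdot> f)"
    proof (rule mono_arrI_zero)
      fix u assume u: "u \<in> Arr C" "Cod C u = Dom C (j \<cdot> f)" 
        "(j \<cdot> f) \<cdot> u = ZeroArr C (Dom C u) (Cod C (j \<cdot> f))"
      have "j \<cdot> (f \<cdot> u) = ZeroArr C (Dom C u) (Cod C j)" using u j fa by simp
      then have "f \<cdot> u = ZeroArr C (Dom C u) W"
        using mono_zero[OF iso_mono[OF j(4)], of "f \<cdot> u"] u j fa by simp
      then show "u = ZeroArr C (Dom C u) (Dom C (j \<cdot> f))"
        using mono_zero[OF f(2), of u] u j fa by simp
    qed (use j fa in simp)
    then have "zero_obj C Y \<or> iso_arr C (j \<cdot> f)"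
      using S fa j dom_cod_obj(1)[OF fa(1)] unfolding simple_obj_def by (auto simp: mor_iff)
    moreover have "iso_arr C f" if "iso_arr C (j \<cdot> f)"
      using iso_arr_comp[OF that iso_arr_inv[OF j(4)]] j fa by simp
    ultimately show ?thesis by blast
  qed
  ultimately show ?thesis using W unfolding simple_obj_def zero_obj_iff by blast
qed

text \<open>
  The idempotent \<open>\<iota> \<cdot> \<pi>\<close> of \<open>W\<close> is a scalar, and not zero.
\<close>

lemma scalar_end_retract_iso:
  assumes W: "W \<in> Obj C" and sc: "\<And>f. f \<in> mor C W W \<Longrightarrow> \<exists>r. f = r *\<^sub>a Idn C W"
    and r: "\<pi> \<in> mor C W T" "\<iota> \<in> mor C T W" "\<pi> \<cdot> \<iota> = Idn C T" and nz: "Idn C T \<noteq> ZeroArr C T T"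
  shows "iso_arr C \<pi>"
proof -
  have T: "T \<in> Obj C" using r mor_obj by blast
  note [simp] = W T r(1,2)[unfolded mor_iff]
  have "\<iota> \<cdot> \<pi> \<in> mor C W W" by (simp add: mor_iff)
  then obtain r where r': "\<iota> \<cdot> \<pi> = r *\<^sub>a Idn C W" using sc by blast
  have "Idn C T = (\<pi> \<cdot> \<iota>) \<cdot> (\<pi> \<cdot> \<iota>)" using r(3) by simp
  also have "\<dots> = \<pi> \<cdot> ((\<iota> \<cdot> \<pi>) \<cdot> \<iota>)" by simp
  also have "\<dots> = r *\<^sub>a Idn C T" unfolding r' using r(3) by simp
  finally have rT: "r *\<^sub>a Idn C T = Idn C T" by simp
  have r0: "r \<noteq> 0" using rT nz by (auto simp: scale_zero)
  have "(1 / r) *\<^sub>a (r *\<^sub>a Idn C T) = (1 / r) *\<^sub>a Idn C T" unfolding rT ..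
  then have "(1 / r) *\<^sub>a Idn C T = Idn C T" using r0 by simp
  then show ?thesis using r(3) r' r0 by (intro iso_arrI[of _ "(1 / r) *\<^sub>a \<iota>"]) simp_all
qed

text \<open>
  The converse of Schur's lemma.  Duals, tensor products with invertible objects and images under
  the equivalence are recognized as simple by their endomorphisms.
\<close>

lemma scalar_end_imp_simple:
  assumes W: "W \<in> Obj C" "Idn C W \<noteq> ZeroArr C W W"
    and sc: "\<And>f. f \<in> mor C W W \<Longrightarrow> \<exists>r. f = r *\<^sub>a Idn C W"
  shows "simple_obj C W"
proof -
  obtain n T where T: "\<forall>k<n. simple_obj C (T k)" "is_direct_sum C n T W" using semisimple W by blast
  obtain k \<pi> \<iota> where k: "k < n" "\<pi> \<in> mor C W (T k)" "\<iota> \<in> mor C (T k) W" "\<pi> \<cdot> \<iota> = Idn C (T k)"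
    using direct_sum_nonzero_in[OF T(2), of "Idn C W"] W by auto
  have Tk: "simple_obj C (T k)" using T k by blast
  have "iso_arr C \<pi>" by (rule scalar_end_retract_iso[OF W(1) sc k(2-4) simple_objD(2)[OF Tk]])
  then show ?thesis using simple_obj_isomorphic[OF Tk] isomorphicI k by blast
qed

lemma simple_hom_scalar:
  assumes "simple_obj C S" "simple_obj C X" "f \<in> mor C S X" "g \<in> mor C S X" "f \<noteq> ZeroArr C S X"
  shows "\<exists>r. g = r *\<^sub>a f"
proof -
  have i: "iso_arr C f" using nonzero_between_simples_iso assms by blast
  have "inv_arr C f \<cdot> g \<in> mor C S S" using assms i by (simp add: mor_iff)
  then obtain r where "inv_arr C f \<cdot> g = r *\<^sub>a Idn C S" using simple_end_scalar assms by blast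
  then have "f \<cdot> (inv_arr C f \<cdot> g) = f \<cdot> (r *\<^sub>a Idn C S)" by simp
  then have "g = r *\<^sub>a f" using assms i simple_objD by (simp add: mor_iff)
  then show ?thesis ..
qed

end

section \<open>Strictification by natural families\<close>

context linear_monoidal_category
begin

declare unit_obj [simp] tensor_obj [simp]

abbreviation whisker_left :: "'a \<Rightarrow> 'b \<Rightarrow> 'b"  (infixl "\<rtimes>" 75)
  where "X \<rtimes> f \<equiv> Idn C X \<otimes>\<^sub>a f"

abbreviation whisker_right :: "'b \<Rightarrow> 'a \<Rightarrow> 'b"  (infixl "\<ltimes>" 75)
  where "f \<ltimes> X \<equiv> f \<otimes>\<^sub>a Idn C X"

lemma tensor_arr [simp]:
  assumes "f \<in> Arr C" "g \<in> Arr C"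
  shows "f \<otimes>\<^sub>a g \<in> Arr C" "Dom C (f \<otimes>\<^sub>a g) = Dom C f \<otimes>\<^sub>o Dom C g"
    "Cod C (f \<otimes>\<^sub>a g) = Cod C f \<otimes>\<^sub>o Cod C g"
  using tensor_mor[of f "Dom C f" "Cod C f" g "Dom C g" "Cod C g"] assms by (auto simp: mor_iff)

declare tensor_id [simp]

lemma tensor_comp_arr:
  assumes "f \<in> Arr C" "f' \<in> Arr C" "g \<in> Arr C" "g' \<in> Arr C" "Cod C f = Dom C f'" "Cod C g = Dom C g'"
  shows "(f' \<otimes>\<^sub>a g') \<cdot> (f \<otimes>\<^sub>a g) = (f' \<cdot> f) \<otimes>\<^sub>a (g' \<cdot> g)"
  by (rule tensor_comp[symmetric, where X = "Dom C f" and X' = "Cod C f" and X'' = "Cod C f'"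
    and Y = "Dom C g" and Y' = "Cod C g" and Y'' = "Cod C g'"]) (use assms in \<open>simp_all add: mor_iff\<close>)

lemma tensor_scale [simp]:
  assumes "f \<in> Arr C" "g \<in> Arr C"
  shows "(a *\<^sub>a f) \<otimes>\<^sub>a g = a *\<^sub>a (f \<otimes>\<^sub>a g)" "f \<otimes>\<^sub>a (a *\<^sub>a g) = a *\<^sub>a (f \<otimes>\<^sub>a g)"
  using tensor_scale_left[of f "Dom C f" "Cod C f" g "Dom C g" "Cod C g" a]
    tensor_scale_right[of f "Dom C f" "Cod C f" g "Dom C g" "Cod C g" a] assms by (auto simp: mor_iff)

lemma tensor_add:
  assumes "f \<in> Arr C" "f' \<in> Arr C" "g \<in> Arr C" "Dom C f' = Dom C f" "Cod C f' = Cod C f"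
  shows "(f +\<^sub>a f') \<otimes>\<^sub>a g = f \<otimes>\<^sub>a g +\<^sub>a f' \<otimes>\<^sub>a g" "g \<otimes>\<^sub>a (f +\<^sub>a f') = g \<otimes>\<^sub>a f +\<^sub>a g \<otimes>\<^sub>a f'"
  using tensor_add_left[of f "Dom C f" "Cod C f" f' g "Dom C g" "Cod C g"]
    tensor_add_right[of g "Dom C g" "Cod C g" f "Dom C f" "Cod C f" f'] assms by (auto simp: mor_iff)

lemma tensor_zero [simp]:
  assumes "f \<in> Arr C" "X \<in> Obj C" "Y \<in> Obj C"
  shows "ZeroArr C X Y \<otimes>\<^sub>a f = ZeroArr C (X \<otimes>\<^sub>o Dom C f) (Y \<otimes>\<^sub>o Cod C f)"
    "f \<otimes>\<^sub>a ZeroArr C X Y = ZeroArr C (Dom C f \<otimes>\<^sub>o X) (Cod C f \<otimes>\<^sub>o Y)"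
  using tensor_scale[of "ZeroArr C X Y" f 0] tensor_scale[of f "ZeroArr C X Y" 0] assms
  by (simp_all add: scale_zero)

lemma assoc_arr [simp]:
  assumes "X \<in> Obj C" "Y \<in> Obj C" "Z \<in> Obj C"
  shows "Assoc C X Y Z \<in> Arr C" "Dom C (Assoc C X Y Z) = X \<otimes>\<^sub>o Y \<otimes>\<^sub>o Z"
    "Cod C (Assoc C X Y Z) = X \<otimes>\<^sub>o (Y \<otimes>\<^sub>o Z)" "iso_arr C (Assoc C X Y Z)"
  using assoc_mor[OF assms] assoc_iso[OF assms] by (auto simp: mor_iff)

lemma unit_arr [simp]:
  assumes "X \<in> Obj C"
  shows "LUnit C X \<in> Arr C" "Dom C (LUnit C X) = \<I> \<otimes>\<^sub>o X" "Cod C (LUnit C X) = X" "iso_arr C (LUnit C X)"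
    "RUnit C X \<in> Arr C" "Dom C (RUnit C X) = X \<otimes>\<^sub>o \<I>" "Cod C (RUnit C X) = X" "iso_arr C (RUnit C X)"
  using lunit_mor[OF assms] lunit_iso[OF assms] runit_mor[OF assms] runit_iso[OF assms]
  by (auto simp: mor_iff)

lemma assoc_nat:
  assumes "f \<in> Arr C" "g \<in> Arr C" "h \<in> Arr C"
  shows "Assoc C (Cod C f) (Cod C g) (Cod C h) \<cdot> (f \<otimes>\<^sub>a g \<otimes>\<^sub>a h)
    = (f \<otimes>\<^sub>a (g \<otimes>\<^sub>a h)) \<cdot> Assoc C (Dom C f) (Dom C g) (Dom C h)"
  by (rule assoc_natural) (use assms in \<open>simp_all add: mor_iff\<close>)

lemma iso_arr_tensor [simp]:
  assumes "iso_arr C f" "iso_arr C g"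
  shows "iso_arr C (f \<otimes>\<^sub>a g)"
  using assms iso_arr_Arr[OF assms(1)] iso_arr_Arr[OF assms(2)]
  by (intro iso_arrI[of _ "inv_arr C f \<otimes>\<^sub>a inv_arr C g"]) (simp_all add: tensor_comp_arr)

lemma whisker_comp:
  assumes "f \<in> Arr C" "g \<in> Arr C" "Cod C f = Dom C g" "X \<in> Obj C"
  shows "X \<rtimes> (g \<cdot> f) = (X \<rtimes> g) \<cdot> (X \<rtimes> f)"
    "(g \<cdot> f) \<ltimes> X = (g \<ltimes> X) \<cdot> (f \<ltimes> X)"
  using assms by (simp_all add: tensor_comp_arr)

text \<open>
  Whiskered arrows on different sides of a tensor product slide past each other.
\<close>

lemma interchange:
  assumes "f \<in> Arr C" "g \<in> Arr C" "Dom C f = X" "Cod C f = X'" "Dom C g = Y" "Cod C g = Y'"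
  shows "(f \<ltimes> Y') \<cdot> (X \<rtimes> g) = (X' \<rtimes> g) \<cdot> (f \<ltimes> Y)"
proof -
  have "X \<in> Obj C" "X' \<in> Obj C" "Y \<in> Obj C" "Y' \<in> Obj C" using assms by auto
  then show ?thesis using assms by (simp add: tensor_comp_arr)
qed

text \<open>
  A list of objects stands for the endofunctor "tensor successively on the left".  Composing such
  endofunctors is concatenation of lists, which is strictly associative.
\<close>

primrec act :: "'a list \<Rightarrow> 'a \<Rightarrow> 'a" where
  "act [] W = W"
| "act (X # A) W = X \<otimes>\<^sub>o act A W"

primrec act_arr :: "'a list \<Rightarrow> 'b \<Rightarrow> 'b" where
  "act_arr [] f = f"
| "act_arr (X # A) f = X \<rtimes> act_arr A f"

primrec act_assoc :: "'a list \<Rightarrow> 'a \<Rightarrow> 'a \<Rightarrow> 'b" where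
  "act_assoc [] W V = Idn C (W \<otimes>\<^sub>o V)"
| "act_assoc (X # A) W V = (X \<rtimes> act_assoc A W V) \<cdot> Assoc C X (act A W) V"

lemma act_obj [simp]: "set A \<subseteq> Obj C \<Longrightarrow> W \<in> Obj C \<Longrightarrow> act A W \<in> Obj C"
  by (induction A) auto

lemma act_arr_arr [simp]:
  assumes "set A \<subseteq> Obj C" "f \<in> Arr C"
  shows "act_arr A f \<in> Arr C" "Dom C (act_arr A f) = act A (Dom C f)" "Cod C (act_arr A f) = act A (Cod C f)"
proof -
  have "act_arr A f \<in> Arr C \<and> Dom C (act_arr A f) = act A (Dom C f) \<and> Cod C (act_arr A f) = act A (Cod C f)"
    using assms by (induction A) auto
  then show "act_arr A f \<in> Arr C" "Dom C (act_arr A f) = act A (Dom C f)" "Cod C (act_arr A f) = act A (Cod C f)"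
    by auto
qed

lemma act_arr_iso [simp]: "set A \<subseteq> Obj C \<Longrightarrow> iso_arr C f \<Longrightarrow> iso_arr C (act_arr A f)"
  by (induction A) auto

lemma act_assoc_arr [simp]:
  assumes "set A \<subseteq> Obj C" "W \<in> Obj C" "V \<in> Obj C"
  shows "act_assoc A W V \<in> Arr C" "Dom C (act_assoc A W V) = act A W \<otimes>\<^sub>o V"
    "Cod C (act_assoc A W V) = act A (W \<otimes>\<^sub>o V)" "iso_arr C (act_assoc A W V)"
proof -
  have "act_assoc A W V \<in> Arr C \<and> Dom C (act_assoc A W V) = act A W \<otimes>\<^sub>o V \<and>
    Cod C (act_assoc A W V) = act A (W \<otimes>\<^sub>o V) \<and> iso_arr C (act_assoc A W V)"
    using assms by (induction A) auto
  then show "act_assoc A W V \<in> Arr C" "Dom C (act_assoc A W V) = act A W \<otimes>\<^sub>o V"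
    "Cod C (act_assoc A W V) = act A (W \<otimes>\<^sub>o V)" "iso_arr C (act_assoc A W V)" by auto
qed

lemma act_append [simp]: "act (A @ B) W = act A (act B W)"
  by (induction A) auto

lemma act_arr_append [simp]: "act_arr (A @ B) f = act_arr A (act_arr B f)"
  by (induction A) auto

lemma act_assoc_append:
  "set A \<subseteq> Obj C \<Longrightarrow> set B \<subseteq> Obj C \<Longrightarrow> W \<in> Obj C \<Longrightarrow> V \<in> Obj C \<Longrightarrow>
    act_assoc (A @ B) W V = act_arr A (act_assoc B W V) \<cdot> act_assoc A (act B W) V"
  by (induction A) (auto simp: whisker_comp)

text \<open>
  A natural transformation between the functors of two lists that commutes with tensoring on the
  right, i.e. a map of right module functors.  Such maps from \<open>A\<close> to \<open>B\<close> correspond to the arrows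
  \<open>act A \<I> \<rightarrow> act B \<I>\<close>, but their composition and whiskering involve no associators.
\<close>

definition module_family :: "'a list \<Rightarrow> 'a list \<Rightarrow> ('a \<Rightarrow> 'b) \<Rightarrow> bool" where
  "module_family A B \<phi> \<longleftrightarrow>
    (\<forall>W \<in> Obj C. \<phi> W \<in> mor C (act A W) (act B W)) \<and>
    (\<forall>f \<in> Arr C. \<phi> (Cod C f) \<cdot> act_arr A f = act_arr B f \<cdot> \<phi> (Dom C f)) \<and>
    (\<forall>W \<in> Obj C. \<forall>V \<in> Obj C.
      \<phi> (W \<otimes>\<^sub>o V) \<cdot> act_assoc A W V = act_assoc B W V \<cdot> (\<phi> W \<ltimes> V))"

lemma module_familyD:
  assumes "module_family A B \<phi>"
  shows "W \<in> Obj C \<Longrightarrow> \<phi> W \<in> Arr C" "W \<in> Obj C \<Longrightarrow> Dom C (\<phi> W) = act A W"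
    "W \<in> Obj C \<Longrightarrow> Cod C (\<phi> W) = act B W"
    "f \<in> Arr C \<Longrightarrow> \<phi> (Cod C f) \<cdot> act_arr A f = act_arr B f \<cdot> \<phi> (Dom C f)"
    "W \<in> Obj C \<Longrightarrow> V \<in> Obj C \<Longrightarrow>
      \<phi> (W \<otimes>\<^sub>o V) \<cdot> act_assoc A W V = act_assoc B W V \<cdot> (\<phi> W \<ltimes> V)"
  using assms by (auto simp: module_family_def mor_iff)

lemma module_familyI:
  assumes "\<And>W. W \<in> Obj C \<Longrightarrow> \<phi> W \<in> Arr C" "\<And>W. W \<in> Obj C \<Longrightarrow> Dom C (\<phi> W) = act A W"
    "\<And>W. W \<in> Obj C \<Longrightarrow> Cod C (\<phi> W) = act B W"
    "\<And>f. f \<in> Arr C \<Longrightarrow> \<phi> (Cod C f) \<cdot> act_arr A f = act_arr B f \<cdot> \<phi> (Dom C f)"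
    "\<And>W V. W \<in> Obj C \<Longrightarrow> V \<in> Obj C \<Longrightarrow>
      \<phi> (W \<otimes>\<^sub>o V) \<cdot> act_assoc A W V = act_assoc B W V \<cdot> (\<phi> W \<ltimes> V)"
  shows "module_family A B \<phi>"
  using assms by (auto simp: module_family_def mor_iff)

lemma module_family_comp:
  assumes A: "set A \<subseteq> Obj C" and B: "set B \<subseteq> Obj C" and D: "set D \<subseteq> Obj C"
    and f: "module_family A B \<phi>" and g: "module_family B D \<psi>"
  shows "module_family A D (\<lambda>W. \<psi> W \<cdot> \<phi> W)"
proof (rule module_familyI)
  note [simp] = A B D module_familyD(1-3)[OF f] module_familyD(1-3)[OF g]
  fix h assume [simp]: "h \<in> Arr C"
  have "(\<psi> (Cod C h) \<cdot> \<phi> (Cod C h)) \<cdot> act_arr A h = \<psi> (Cod C h) \<cdot> (act_arr B h \<cdot> \<phi> (Dom C h))"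
    using module_familyD(4)[OF f, of h] by simp
  also have "\<dots> = (act_arr D h \<cdot> \<psi> (Dom C h)) \<cdot> \<phi> (Dom C h)"
    by (rule comp_cong_left[OF module_familyD(4)[OF g]]) simp_all
  finally show "(\<psi> (Cod C h) \<cdot> \<phi> (Cod C h)) \<cdot> act_arr A h = act_arr D h \<cdot> (\<psi> (Dom C h) \<cdot> \<phi> (Dom C h))"
    by simp
next
  note [simp] = A B D module_familyD(1-3)[OF f] module_familyD(1-3)[OF g]
  fix W V assume [simp]: "W \<in> Obj C" "V \<in> Obj C"
  have "(\<psi> (W \<otimes>\<^sub>o V) \<cdot> \<phi> (W \<otimes>\<^sub>o V)) \<cdot> act_assoc A W V
    = \<psi> (W \<otimes>\<^sub>o V) \<cdot> (act_assoc B W V \<cdot> (\<phi> W \<ltimes> V))"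
    using module_familyD(5)[OF f, of W V] by simp
  also have "\<dots> = (act_assoc D W V \<cdot> (\<psi> W \<ltimes> V)) \<cdot> (\<phi> W \<ltimes> V)"
    by (rule comp_cong_left[OF module_familyD(5)[OF g]]) simp_all
  finally show "(\<psi> (W \<otimes>\<^sub>o V) \<cdot> \<phi> (W \<otimes>\<^sub>o V)) \<cdot> act_assoc A W V
    = act_assoc D W V \<cdot> ((\<psi> W \<cdot> \<phi> W) \<ltimes> V)" by (simp add: whisker_comp)
qed (use A B D module_familyD(1-3)[OF f] module_familyD(1-3)[OF g] in simp_all)

text \<open>
  Whiskering: tensoring a family with an object on the left, and, in the next lemma, evaluating it
  on a longer tail.
\<close>

lemma module_family_left:
  assumes X: "X \<in> Obj C" and A: "set A \<subseteq> Obj C" and B: "set B \<subseteq> Obj C" 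
    and f: "module_family A B \<phi>"
  shows "module_family (X # A) (X # B) (\<lambda>W. X \<rtimes> \<phi> W)"
proof (rule module_familyI)
  note [simp] = X A B module_familyD(1-3)[OF f]
  fix h assume [simp]: "h \<in> Arr C"
  show "(X \<rtimes> \<phi> (Cod C h)) \<cdot> act_arr (X # A) h = act_arr (X # B) h \<cdot> (X \<rtimes> \<phi> (Dom C h))"
    using module_familyD(4)[OF f, of h] by (simp add: tensor_comp_arr)
next
  note [simp] = X A B module_familyD(1-3)[OF f]
  fix W V assume [simp]: "W \<in> Obj C" "V \<in> Obj C"
  have "(X \<rtimes> \<phi> (W \<otimes>\<^sub>o V)) \<cdot> act_assoc (X # A) W V
    = ((X \<rtimes> \<phi> (W \<otimes>\<^sub>o V)) \<cdot> (X \<rtimes> act_assoc A W V)) \<cdot> Assoc C X (act A W) V"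
    by simp
  also have "(X \<rtimes> \<phi> (W \<otimes>\<^sub>o V)) \<cdot> (X \<rtimes> act_assoc A W V)
    = (X \<rtimes> act_assoc B W V) \<cdot> (X \<rtimes> (\<phi> W \<ltimes> V))"
    using module_familyD(5)[OF f, of W V] by (simp add: tensor_comp_arr)
  also have "\<dots> \<cdot> Assoc C X (act A W) V
    = (X \<rtimes> act_assoc B W V) \<cdot> (Assoc C X (act B W) V \<cdot> (X \<rtimes> \<phi> W \<ltimes> V))"
    using assoc_nat[of "Idn C X" "\<phi> W" "Idn C V"] by simp
  finally show "(X \<rtimes> \<phi> (W \<otimes>\<^sub>o V)) \<cdot> act_assoc (X # A) W V
    = act_assoc (X # B) W V \<cdot> (X \<rtimes> \<phi> W \<ltimes> V)" by simp
qed (use X A B module_familyD(1-3)[OF f] in simp_all)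

lemma module_family_right:
  assumes P: "set P \<subseteq> Obj C" and A: "set A \<subseteq> Obj C" and B: "set B \<subseteq> Obj C" 
    and f: "module_family A B \<phi>"
  shows "module_family (A @ P) (B @ P) (\<lambda>W. \<phi> (act P W))"
proof (rule module_familyI)
  note [simp] = P A B module_familyD(1-3)[OF f]
  fix h assume [simp]: "h \<in> Arr C"
  show "\<phi> (act P (Cod C h)) \<cdot> act_arr (A @ P) h = act_arr (B @ P) h \<cdot> \<phi> (act P (Dom C h))"
    using module_familyD(4)[OF f, of "act_arr P h"] by simp
next
  note [simp] = P A B module_familyD(1-3)[OF f]
  fix W V assume [simp]: "W \<in> Obj C" "V \<in> Obj C"
  have n: "\<phi> (act P (W \<otimes>\<^sub>o V)) \<cdot> act_arr A (act_assoc P W V)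
      = act_arr B (act_assoc P W V) \<cdot> \<phi> (act P W \<otimes>\<^sub>o V)"
    using module_familyD(4)[OF f, of "act_assoc P W V"] by simp
  have "\<phi> (act P (W \<otimes>\<^sub>o V)) \<cdot> act_assoc (A @ P) W V
    = \<phi> (act P (W \<otimes>\<^sub>o V)) \<cdot> (act_arr A (act_assoc P W V) \<cdot> act_assoc A (act P W) V)"
    by (simp add: act_assoc_append)
  also have "\<dots> = (act_arr B (act_assoc P W V) \<cdot> \<phi> (act P W \<otimes>\<^sub>o V)) \<cdot> act_assoc A (act P W) V"
    by (rule comp_cong_left[OF n]) simp_all
  also have "\<dots> = act_arr B (act_assoc P W V) \<cdot> (act_assoc B (act P W) V \<cdot> (\<phi> (act P W) \<ltimes> V))"
    using module_familyD(5)[OF f, of "act P W" V] by simp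
  finally show "\<phi> (act P (W \<otimes>\<^sub>o V)) \<cdot> act_assoc (A @ P) W V
    = act_assoc (B @ P) W V \<cdot> (\<phi> (act P W) \<ltimes> V)" by (simp add: act_assoc_append)
qed (use P A B module_familyD(1-3)[OF f] in simp_all)

lemma module_family_inv:
  assumes A: "set A \<subseteq> Obj C" and B: "set B \<subseteq> Obj C" 
    and f: "module_family A B \<phi>" and iso: "\<And>W. W \<in> Obj C \<Longrightarrow> iso_arr C (\<phi> W)"
  shows "module_family B A (\<lambda>W. inv_arr C (\<phi> W))"
proof (rule module_familyI)
  note [simp] = A B module_familyD(1-3)[OF f] iso
  fix h assume [simp]: "h \<in> Arr C"
  have "\<phi> (Cod C h) \<cdot> (inv_arr C (\<phi> (Cod C h)) \<cdot> act_arr B h) = act_arr B h" by simp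
  moreover have "\<phi> (Cod C h) \<cdot> (act_arr A h \<cdot> inv_arr C (\<phi> (Dom C h))) 
      = (act_arr B h \<cdot> \<phi> (Dom C h)) \<cdot> inv_arr C (\<phi> (Dom C h))"
    by (rule comp_cong_left[OF module_familyD(4)[OF f]]) simp_all
  ultimately show "inv_arr C (\<phi> (Cod C h)) \<cdot> act_arr B h = act_arr A h \<cdot> inv_arr C (\<phi> (Dom C h))"
    by - (rule iso_cancel_left[of "\<phi> (Cod C h)"], simp_all)
next
  note [simp] = A B module_familyD(1-3)[OF f] iso
  fix W V assume [simp]: "W \<in> Obj C" "V \<in> Obj C"
  have "\<phi> (W \<otimes>\<^sub>o V) \<cdot> (inv_arr C (\<phi> (W \<otimes>\<^sub>o V)) \<cdot> act_assoc B W V) = act_assoc B W V" by simp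
  moreover have "\<phi> (W \<otimes>\<^sub>o V) \<cdot> (act_assoc A W V \<cdot> (inv_arr C (\<phi> W) \<ltimes> V)) 
      = (act_assoc B W V \<cdot> (\<phi> W \<ltimes> V)) \<cdot> (inv_arr C (\<phi> W) \<ltimes> V)"
    by (rule comp_cong_left[OF module_familyD(5)[OF f]]) simp_all
  ultimately show "inv_arr C (\<phi> (W \<otimes>\<^sub>o V)) \<cdot> act_assoc B W V
      = act_assoc A W V \<cdot> (inv_arr C (\<phi> W) \<ltimes> V)"
    by - (rule iso_cancel_left[of "\<phi> (W \<otimes>\<^sub>o V)"], simp_all add: tensor_comp_arr)
qed (use A B module_familyD(1-3)[OF f] iso in simp_all)

lemma module_family_scale:
  assumes A: "set A \<subseteq> Obj C" and B: "set B \<subseteq> Obj C" and f: "module_family A B \<phi>"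
  shows "module_family A B (\<lambda>W. r *\<^sub>a \<phi> W)"
  by (rule module_familyI)
    (use A B module_familyD(1-3)[OF f] module_familyD(4-5)[OF f] in simp_all)

text \<open>
  Right module structure determines the value at \<open>\<I> \<otimes> W\<close> from the value at \<open>\<I>\<close>, and naturality along
  the left unit constraint passes to \<open>W\<close>.  This is how Schur's lemma, a statement about single
  arrows, becomes a statement about families.
\<close>

lemma module_family_eqI:
  assumes A: "set A \<subseteq> Obj C" and B: "set B \<subseteq> Obj C" 
    and f: "module_family A B \<phi>" and g: "module_family A B \<psi>" and eq: "\<phi> \<I> = \<psi> \<I>"
    and W: "W \<in> Obj C"
  shows "\<phi> W = \<psi> W"
proof -
  note [simp] = A B module_familyD(1-3)[OF f] module_familyD(1-3)[OF g] W
  have "\<phi> (\<I> \<otimes>\<^sub>o W) \<cdot> act_assoc A \<I> W = \<psi> (\<I> \<otimes>\<^sub>o W) \<cdot> act_assoc A \<I> W"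
    using module_familyD(5)[OF f, of \<I> W] module_familyD(5)[OF g, of \<I> W] eq by simp
  then have "\<phi> (\<I> \<otimes>\<^sub>o W) = \<psi> (\<I> \<otimes>\<^sub>o W)"
    by (rule iso_cancel_right[rotated]) simp_all
  then have "\<phi> W \<cdot> act_arr A (LUnit C W) = \<psi> W \<cdot> act_arr A (LUnit C W)"
    using module_familyD(4)[OF f, of "LUnit C W"] module_familyD(4)[OF g, of "LUnit C W"] by simp
  then show ?thesis by (rule iso_cancel_right[rotated]) simp_all
qed

lemma module_family_zeroI:
  assumes A: "set A \<subseteq> Obj C" and B: "set B \<subseteq> Obj C" and f: "module_family A B \<phi>"
    and z: "\<phi> \<I> = ZeroArr C (act A \<I>) (act B \<I>)" and W: "W \<in> Obj C"
  shows "\<phi> W = ZeroArr C (act A W) (act B W)"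
proof -
  have "\<phi> W = 0 *\<^sub>a \<phi> W"
    by (rule module_family_eqI[OF A B f module_family_scale[OF A B f] _ W]) (use A B in \<open>simp add: z\<close>)
  then show ?thesis using module_familyD(1-3)[OF f W] by (simp add: scale_zero)
qed

lemma module_family_of_arrow:
  assumes "f \<in> mor C X Y"
  shows "module_family [X] [Y] (\<lambda>W. f \<ltimes> W)"
proof -
  have f: "f \<in> Arr C" "Dom C f = X" "Cod C f = Y" "X \<in> Obj C" "Y \<in> Obj C" 
    using assms mor_obj[OF assms] by (auto simp: mor_iff)
  show ?thesis
  proof (rule module_familyI)
    fix W V assume "W \<in> Obj C" "V \<in> Obj C"
    then show "(f \<ltimes> (W \<otimes>\<^sub>o V)) \<cdot> act_assoc [X] W V
      = act_assoc [Y] W V \<cdot> (f \<ltimes> W \<ltimes> V)"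
      using f assoc_nat[of f "Idn C W" "Idn C V"] by simp
  qed (use f in \<open>simp_all add: tensor_comp_arr\<close>)
qed

text \<open>
  The module compatibility of the associator is exactly the pentagon.
\<close>

lemma module_family_assoc:
  assumes "X \<in> Obj C" "Y \<in> Obj C"
  shows "module_family [X \<otimes>\<^sub>o Y] [X, Y] (\<lambda>W. Assoc C X Y W)"
proof (rule module_familyI)
  fix f assume "f \<in> Arr C"
  then show "Assoc C X Y (Cod C f) \<cdot> act_arr [X \<otimes>\<^sub>o Y] f = act_arr [X, Y] f \<cdot> Assoc C X Y (Dom C f)"
    using assms assoc_nat[of "Idn C X" "Idn C Y" f] by simp
next
  fix W V assume "W \<in> Obj C" "V \<in> Obj C"
  then show "Assoc C X Y (W \<otimes>\<^sub>o V) \<cdot> act_assoc [X \<otimes>\<^sub>o Y] W V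
      = act_assoc [X, Y] W V \<cdot> (Assoc C X Y W \<ltimes> V)"
    using assms pentagon[of X Y W V] by simp
qed (use assms in simp_all)

lemma module_family_assoc_inv:
  assumes "X \<in> Obj C" "Y \<in> Obj C"
  shows "module_family [X, Y] [X \<otimes>\<^sub>o Y] (\<lambda>W. inv_arr C (Assoc C X Y W))"
  by (rule module_family_inv[OF _ _ module_family_assoc]) (use assms in simp_all)

section \<open>Contraction, expansion and duality\<close>

lemma comp_swap:
  assumes "a \<cdot> b = c \<cdot> d" "a \<in> Arr C" "b \<in> Arr C" "c \<in> Arr C" "d \<in> Arr C" "k \<in> Arr C"
    "Cod C b = Dom C a" "Cod C d = Dom C c" "Cod C k = Dom C b" "Cod C k = Dom C d"
  shows "a \<cdot> (b \<cdot> k) = c \<cdot> (d \<cdot> k)"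
  using comp_cong_left[OF assms(1-3,6)] assms by simp

lemma pentagon_inv:
  assumes "W \<in> Obj C" "X \<in> Obj C" "Y \<in> Obj C" "Z \<in> Obj C"
  shows "(W \<rtimes> Assoc C X Y Z) \<cdot> Assoc C W (X \<otimes>\<^sub>o Y) Z
    = Assoc C W X (Y \<otimes>\<^sub>o Z) \<cdot> Assoc C (W \<otimes>\<^sub>o X) Y Z \<cdot> (inv_arr C (Assoc C W X Y) \<ltimes> Z)"
  by (rule iso_cancel_right[of "Assoc C W X Y \<ltimes> Z"])
    (use assms pentagon[OF assms] in \<open>simp_all add: tensor_comp_arr\<close>)

text \<open>
  The families given by an arrow \<open>f : X \<otimes> Y \<rightarrow> Z\<close> and an arrow \<open>i : Z \<rightarrow> X \<otimes> Y\<close>, with source and target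
  the lists \<open>[X, Y]\<close> and \<open>[Z]\<close> in the respective order.
\<close>

definition contract :: "'b \<Rightarrow> 'a \<Rightarrow> 'a \<Rightarrow> 'a \<Rightarrow> 'b" where
  "contract f X Y W = (f \<ltimes> W) \<cdot> inv_arr C (Assoc C X Y W)"

definition expand :: "'b \<Rightarrow> 'a \<Rightarrow> 'a \<Rightarrow> 'a \<Rightarrow> 'b" where
  "expand i X Y W = Assoc C X Y W \<cdot> (i \<ltimes> W)"

lemma module_family_contract:
  assumes "X \<in> Obj C" "Y \<in> Obj C" "f \<in> mor C (X \<otimes>\<^sub>o Y) Z"
  shows "module_family [X, Y] [Z] (contract f X Y)"
  unfolding contract_def
  by (rule module_family_comp[OF _ _ _ module_family_assoc_inv module_family_of_arrow])
    (use assms mor_obj[OF assms(3)] in simp_all)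

lemma module_family_expand:
  assumes "X \<in> Obj C" "Y \<in> Obj C" "i \<in> mor C Z (X \<otimes>\<^sub>o Y)"
  shows "module_family [Z] [X, Y] (expand i X Y)"
  unfolding expand_def
  by (rule module_family_comp[OF _ _ _ module_family_of_arrow module_family_assoc])
    (use assms mor_obj[OF assms(3)] in simp_all)

text \<open>
  One side of a zigzag, formed with families, is the zigzag of the underlying arrows tensored with
  \<open>W\<close>; the next lemma treats the other side.  The objects \<open>E\<close> and \<open>F\<close> stand for the unit: no unit
  constraint enters before the zigzag identities themselves.
\<close>

lemma contract_expand_left:
  assumes ev: "ev \<in> mor C (Y \<otimes>\<^sub>o X) E" and coev: "coev \<in> mor C F (X \<otimes>\<^sub>o Y)"
    and O: "X \<in> Obj C" "Y \<in> Obj C" "W \<in> Obj C"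
  shows "contract ev Y X (Y \<otimes>\<^sub>o W) \<cdot> (Y \<rtimes> expand coev X Y W)
    = Assoc C E Y W \<cdot> (((ev \<ltimes> Y) \<cdot> inv_arr C (Assoc C Y X Y) \<cdot> (Y \<rtimes> coev)) \<ltimes> W)
      \<cdot> inv_arr C (Assoc C Y F W)" (is "?L = _ \<cdot> (?z \<otimes>\<^sub>a _) \<cdot> _")
proof -
  have EF: "E \<in> Obj C" "F \<in> Obj C" using mor_obj ev coev by auto
  note [simp] = O EF ev[unfolded mor_iff] coev[unfolded mor_iff]
  have 1: "(Y \<rtimes> coev \<ltimes> W) = (Y \<rtimes> coev) \<ltimes> W" by simp
  have n1: "(Y \<rtimes> (coev \<ltimes> W)) \<cdot> Assoc C Y F W
    = Assoc C Y (X \<otimes>\<^sub>o Y) W \<cdot> (Y \<rtimes> coev \<ltimes> W)"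
    using assoc_nat[of "Idn C Y" coev "Idn C W"] by simp
  have n2: "(ev \<ltimes> (Y \<otimes>\<^sub>o W)) \<cdot> Assoc C (Y \<otimes>\<^sub>o X) Y W
    = Assoc C E Y W \<cdot> (ev \<ltimes> Y \<ltimes> W)"
    using assoc_nat[of ev "Idn C Y" "Idn C W"] by simp
  have "?L \<cdot> Assoc C Y F W = (ev \<ltimes> (Y \<otimes>\<^sub>o W)) \<cdot> (inv_arr C (Assoc C Y X (Y \<otimes>\<^sub>o W)) \<cdot>
      ((Y \<rtimes> Assoc C X Y W) \<cdot> ((Y \<rtimes> (coev \<ltimes> W)) \<cdot> Assoc C Y F W)))"
    by (simp add: contract_def expand_def whisker_comp)
  also have "\<dots> = (ev \<ltimes> (Y \<otimes>\<^sub>o W)) \<cdot> (inv_arr C (Assoc C Y X (Y \<otimes>\<^sub>o W)) \<cdot>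
      (((Y \<rtimes> Assoc C X Y W) \<cdot> Assoc C Y (X \<otimes>\<^sub>o Y) W) \<cdot> (Y \<rtimes> coev \<ltimes> W)))"
    unfolding n1 by simp
  also have "\<dots> = ((ev \<ltimes> (Y \<otimes>\<^sub>o W)) \<cdot> Assoc C (Y \<otimes>\<^sub>o X) Y W) \<cdot>
      ((inv_arr C (Assoc C Y X Y) \<ltimes> W) \<cdot> (Y \<rtimes> coev \<ltimes> W))"
    by (subst pentagon_inv) simp_all
  also have "\<dots> = Assoc C E Y W \<cdot> (?z \<ltimes> W)"
    unfolding n2 by (simp add: whisker_comp)
  finally have "?L \<cdot> Assoc C Y F W = (Assoc C E Y W \<cdot> (?z \<ltimes> W) \<cdot> inv_arr C (Assoc C Y F W)) \<cdot> Assoc C Y F W"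
    by simp
  then show ?thesis
    by (rule iso_cancel_right[rotated]) (simp_all add: contract_def expand_def)
qed

lemma contract_expand_right:
  assumes ev: "ev \<in> mor C (Y \<otimes>\<^sub>o X) E" and coev: "coev \<in> mor C F (X \<otimes>\<^sub>o Y)"
    and O: "X \<in> Obj C" "Y \<in> Obj C" "W \<in> Obj C"
  shows "(X \<rtimes> contract ev Y X W) \<cdot> expand coev X Y (X \<otimes>\<^sub>o W)
    = Assoc C X E W \<cdot> (((X \<rtimes> ev) \<cdot> Assoc C X Y X \<cdot> (coev \<ltimes> X)) \<ltimes> W)
      \<cdot> inv_arr C (Assoc C F X W)" (is "?L = _ \<cdot> (?z \<otimes>\<^sub>a _) \<cdot> _")
proof -
  have EF: "E \<in> Obj C" "F \<in> Obj C" using mor_obj ev coev by auto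
  note [simp] = O EF ev[unfolded mor_iff] coev[unfolded mor_iff]
  have n1: "(coev \<ltimes> (X \<otimes>\<^sub>o W)) \<cdot> Assoc C F X W
    = Assoc C (X \<otimes>\<^sub>o Y) X W \<cdot> (coev \<ltimes> X \<ltimes> W)"
    using assoc_nat[of coev "Idn C X" "Idn C W"] by simp
  have n2: "(X \<rtimes> (ev \<ltimes> W)) \<cdot> Assoc C X (Y \<otimes>\<^sub>o X) W
    = Assoc C X E W \<cdot> (X \<rtimes> ev \<ltimes> W)"
    using assoc_nat[of "Idn C X" ev "Idn C W"] by simp
  have n3: "(X \<rtimes> inv_arr C (Assoc C Y X W)) \<cdot> ((X \<rtimes> Assoc C Y X W) \<cdot> k) = k"
    if "k \<in> Arr C" "Cod C k = X \<otimes>\<^sub>o (Y \<otimes>\<^sub>o X \<otimes>\<^sub>o W)" for k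
    by (rule trans[OF comp_cong_left[OF whisker_comp(1)[symmetric]]]) (use that in simp_all)
  have "?L \<cdot> Assoc C F X W = (X \<rtimes> (ev \<ltimes> W)) \<cdot> ((X \<rtimes> inv_arr C (Assoc C Y X W)) \<cdot>
      (Assoc C X Y (X \<otimes>\<^sub>o W) \<cdot> ((coev \<ltimes> (X \<otimes>\<^sub>o W)) \<cdot> Assoc C F X W)))"
    by (simp add: contract_def expand_def whisker_comp)
  also have "\<dots> = (X \<rtimes> (ev \<ltimes> W)) \<cdot> ((X \<rtimes> inv_arr C (Assoc C Y X W)) \<cdot>
      ((Assoc C X Y (X \<otimes>\<^sub>o W) \<cdot> Assoc C (X \<otimes>\<^sub>o Y) X W) \<cdot> (coev \<ltimes> X \<ltimes> W)))"
    unfolding n1 by simp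
  also have "\<dots> = ((X \<rtimes> (ev \<ltimes> W)) \<cdot> Assoc C X (Y \<otimes>\<^sub>o X) W) \<cdot>
      ((Assoc C X Y X \<ltimes> W) \<cdot> (coev \<ltimes> X \<ltimes> W))"
    by (subst pentagon) (simp_all add: n3)
  also have "\<dots> = Assoc C X E W \<cdot> (?z \<ltimes> W)"
    unfolding n2 by (simp add: whisker_comp)
  finally have "?L \<cdot> Assoc C F X W = (Assoc C X E W \<cdot> (?z \<ltimes> W) \<cdot> inv_arr C (Assoc C F X W)) \<cdot> Assoc C F X W"
    by simp
  then show ?thesis
    by (rule iso_cancel_right[rotated]) (simp_all add: contract_def expand_def)
qed

text \<open>
  With the unit object kept as a list entry, the zigzags are not identities but the canonical maps
  between \<open>X \<otimes> \<I>\<close> and \<open>\<I> \<otimes> X\<close>.  Only their invertibility matters for the injectivity statements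
  below.
\<close>

lemma left_dual_families:
  assumes "left_dual C X Y"
  obtains \<epsilon> \<eta> where "module_family [Y, X] [\<I>] \<epsilon>" "module_family [\<I>] [X, Y] \<eta>"
    "\<And>W. W \<in> Obj C \<Longrightarrow> iso_arr C ((X \<rtimes> \<epsilon> W) \<cdot> \<eta> (X \<otimes>\<^sub>o W))"
    "\<And>W. W \<in> Obj C \<Longrightarrow> iso_arr C (\<epsilon> (Y \<otimes>\<^sub>o W) \<cdot> (Y \<rtimes> \<eta> W))"
proof -
  obtain ev coev where O: "X \<in> Obj C" "Y \<in> Obj C"
    and ev: "ev \<in> mor C (Y \<otimes>\<^sub>o X) \<I>" and coev: "coev \<in> mor C \<I> (X \<otimes>\<^sub>o Y)"
    and z1: "RUnit C X \<cdot> (X \<rtimes> ev) \<cdot> Assoc C X Y X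
         \<cdot> (coev \<ltimes> X) \<cdot> inv_arr C (LUnit C X) = Idn C X"
    and z2: "LUnit C Y \<cdot> (ev \<ltimes> Y) \<cdot> inv_arr C (Assoc C Y X Y)
         \<cdot> (Y \<rtimes> coev) \<cdot> inv_arr C (RUnit C Y) = Idn C Y"
    using assms unfolding left_dual_def by blast
  note [simp] = O ev[unfolded mor_iff] coev[unfolded mor_iff]
  let ?k1 = "(X \<rtimes> ev) \<cdot> Assoc C X Y X \<cdot> (coev \<ltimes> X)"
  let ?k2 = "(ev \<ltimes> Y) \<cdot> inv_arr C (Assoc C Y X Y) \<cdot> (Y \<rtimes> coev)"
  have "inv_arr C (RUnit C X) \<cdot> ((RUnit C X \<cdot> (X \<rtimes> ev) \<cdot> Assoc C X Y X
         \<cdot> (coev \<ltimes> X) \<cdot> inv_arr C (LUnit C X)) \<cdot> LUnit C X) = inv_arr C (RUnit C X) \<cdot> LUnit C X"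
    unfolding z1 by simp
  then have "?k1 = inv_arr C (RUnit C X) \<cdot> LUnit C X" by simp
  then have k1: "iso_arr C ?k1" by simp
  have "inv_arr C (LUnit C Y) \<cdot> ((LUnit C Y \<cdot> (ev \<ltimes> Y) \<cdot> inv_arr C (Assoc C Y X Y)
         \<cdot> (Y \<rtimes> coev) \<cdot> inv_arr C (RUnit C Y)) \<cdot> RUnit C Y) = inv_arr C (LUnit C Y) \<cdot> RUnit C Y"
    unfolding z2 by simp
  then have "?k2 = inv_arr C (LUnit C Y) \<cdot> RUnit C Y" by simp
  then have k2: "iso_arr C ?k2" by simp
  show thesis
  proof (rule that)
    show "module_family [Y, X] [\<I>] (contract ev Y X)" by (rule module_family_contract) (simp_all add: ev)
    show "module_family [\<I>] [X, Y] (expand coev X Y)" by (rule module_family_expand) (simp_all add: coev)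
    fix W assume W: "W \<in> Obj C"
    have "iso_arr C (?k1 \<ltimes> W)" using k1 W by (intro iso_arr_tensor) simp_all
    then show "iso_arr C ((X \<rtimes> contract ev Y X W) \<cdot> expand coev X Y (X \<otimes>\<^sub>o W))"
      unfolding contract_expand_right[OF ev coev O W]
      by (intro iso_arr_comp) (use W in simp_all)
    have "iso_arr C (?k2 \<ltimes> W)" using k2 W by (intro iso_arr_tensor) simp_all
    then show "iso_arr C (contract ev Y X (Y \<otimes>\<^sub>o W) \<cdot> (Y \<rtimes> expand coev X Y W))"
      unfolding contract_expand_left[OF ev coev O W]
      by (intro iso_arr_comp) (use W in simp_all)
  qed
qed

section \<open>Embeddings of hom spaces\<close>

text \<open>
  The existence of an injective linear map from \<open>Hom(P, Q)\<close> to \<open>Hom(P', Q')\<close>.  Injections in one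
  direction suffice where duality would give isomorphisms: they carry nonzero arrows forward and the
  bound \<open>dim \<le> 1\<close> backward.
\<close>

definition hom_embeds :: "'a \<Rightarrow> 'a \<Rightarrow> 'a \<Rightarrow> 'a \<Rightarrow> bool" where
  "hom_embeds P Q P' Q' \<longleftrightarrow> (\<exists>\<Phi>.
    (\<forall>f \<in> mor C P Q. \<Phi> f \<in> mor C P' Q') \<and>
    (\<forall>f \<in> mor C P Q. \<forall>g \<in> mor C P Q. \<Phi> (f +\<^sub>a g) = \<Phi> f +\<^sub>a \<Phi> g) \<and>
    (\<forall>f \<in> mor C P Q. \<forall>r. \<Phi> (r *\<^sub>a f) = r *\<^sub>a \<Phi> f) \<and>
    (\<forall>f \<in> mor C P Q. \<Phi> f = ZeroArr C P' Q' \<longrightarrow> f = ZeroArr C P Q))"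

lemma hom_embedsI:
  assumes "\<And>f. f \<in> mor C P Q \<Longrightarrow> \<Phi> f \<in> mor C P' Q'"
    "\<And>f g. f \<in> mor C P Q \<Longrightarrow> g \<in> mor C P Q \<Longrightarrow> \<Phi> (f +\<^sub>a g) = \<Phi> f +\<^sub>a \<Phi> g"
    "\<And>f r. f \<in> mor C P Q \<Longrightarrow> \<Phi> (r *\<^sub>a f) = r *\<^sub>a \<Phi> f"
    "\<And>f. f \<in> mor C P Q \<Longrightarrow> \<Phi> f = ZeroArr C P' Q' \<Longrightarrow> f = ZeroArr C P Q"
  shows "hom_embeds P Q P' Q'"
  unfolding hom_embeds_def using assms by (intro exI[of _ \<Phi>] conjI ballI allI impI) simp_all

lemma hom_embedsE:
  assumes "hom_embeds P Q P' Q'"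
  obtains \<Phi> where "\<And>f. f \<in> mor C P Q \<Longrightarrow> \<Phi> f \<in> mor C P' Q'"
    "\<And>f g. f \<in> mor C P Q \<Longrightarrow> g \<in> mor C P Q \<Longrightarrow> \<Phi> (f +\<^sub>a g) = \<Phi> f +\<^sub>a \<Phi> g"
    "\<And>f r. f \<in> mor C P Q \<Longrightarrow> \<Phi> (r *\<^sub>a f) = r *\<^sub>a \<Phi> f"
    "\<And>f. f \<in> mor C P Q \<Longrightarrow> \<Phi> f = ZeroArr C P' Q' \<Longrightarrow> f = ZeroArr C P Q"
  using assms[unfolded hom_embeds_def]
proof (elim exE conjE)
  fix \<Phi>
  assume h: "\<forall>f\<in>mor C P Q. \<Phi> f \<in> mor C P' Q'"
    "\<forall>f\<in>mor C P Q. \<forall>g\<in>mor C P Q. \<Phi> (f +\<^sub>a g) = \<Phi> f +\<^sub>a \<Phi> g"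
    "\<forall>f\<in>mor C P Q. \<forall>r. \<Phi> (r *\<^sub>a f) = r *\<^sub>a \<Phi> f"
    "\<forall>f\<in>mor C P Q. \<Phi> f = ZeroArr C P' Q' \<longrightarrow> f = ZeroArr C P Q"
  show thesis by (rule that[of \<Phi>]) (use h in blast)+
qed

lemma hom_embeds_trans [trans]:
  assumes "hom_embeds P Q P' Q'" "hom_embeds P' Q' P'' Q''"
  shows "hom_embeds P Q P'' Q''"
proof -
  obtain \<Phi> where \<Phi>: "\<And>f. f \<in> mor C P Q \<Longrightarrow> \<Phi> f \<in> mor C P' Q'"
    "\<And>f g. f \<in> mor C P Q \<Longrightarrow> g \<in> mor C P Q \<Longrightarrow> \<Phi> (f +\<^sub>a g) = \<Phi> f +\<^sub>a \<Phi> g"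
    "\<And>f r. f \<in> mor C P Q \<Longrightarrow> \<Phi> (r *\<^sub>a f) = r *\<^sub>a \<Phi> f"
    "\<And>f. f \<in> mor C P Q \<Longrightarrow> \<Phi> f = ZeroArr C P' Q' \<Longrightarrow> f = ZeroArr C P Q"
    by (rule hom_embedsE[OF assms(1)]) (rule that)
  obtain \<Psi> where \<Psi>: "\<And>f. f \<in> mor C P' Q' \<Longrightarrow> \<Psi> f \<in> mor C P'' Q''"
    "\<And>f g. f \<in> mor C P' Q' \<Longrightarrow> g \<in> mor C P' Q' \<Longrightarrow> \<Psi> (f +\<^sub>a g) = \<Psi> f +\<^sub>a \<Psi> g"
    "\<And>f r. f \<in> mor C P' Q' \<Longrightarrow> \<Psi> (r *\<^sub>a f) = r *\<^sub>a \<Psi> f"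
    "\<And>f. f \<in> mor C P' Q' \<Longrightarrow> \<Psi> f = ZeroArr C P'' Q'' \<Longrightarrow> f = ZeroArr C P' Q'"
    by (rule hom_embedsE[OF assms(2)]) (rule that)
  show ?thesis by (rule hom_embedsI[of _ _ "\<lambda>f. \<Psi> (\<Phi> f)"]) (simp_all add: \<Phi> \<Psi>)
qed

lemma hom_embeds_isomorphic:
  assumes "isomorphic C P P'" "isomorphic C Q Q'"
  shows "hom_embeds P Q P' Q'"
proof -
  obtain p q where p: "iso_arr C p" "p \<in> Arr C" "Dom C p = P" "Cod C p = P'"
    and q: "iso_arr C q" "q \<in> Arr C" "Dom C q = Q" "Cod C q = Q'"
    using assms by (auto simp: isomorphic_def mor_iff)
  have O: "P \<in> Obj C" "P' \<in> Obj C" "Q \<in> Obj C" "Q' \<in> Obj C" using p q by auto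
  note [simp] = p q O mor_iff
  show ?thesis
  proof (rule hom_embedsI[of _ _ "\<lambda>f. q \<cdot> (f \<cdot> inv_arr C p)"])
    fix f assume [simp]: "f \<in> mor C P Q" and z: "q \<cdot> (f \<cdot> inv_arr C p) = ZeroArr C P' Q'"
    have fa: "f \<in> Arr C" "Dom C f = P" "Cod C f = Q" using \<open>f \<in> mor C P Q\<close> by simp_all
    note [simp] = fa
    have "f = inv_arr C q \<cdot> ((q \<cdot> (f \<cdot> inv_arr C p)) \<cdot> p)" by simp
    also have "\<dots> = ZeroArr C P Q" unfolding z by simp
    finally show "f = ZeroArr C P Q" .
  qed (simp_all add: comp_add)
qed

text \<open>
  The hom space has dimension at most one.
\<close>

definition hom_le1 :: "'a \<Rightarrow> 'a \<Rightarrow> bool" where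
  "hom_le1 P Q \<longleftrightarrow> (\<forall>f \<in> mor C P Q. \<forall>g \<in> mor C P Q. f \<noteq> ZeroArr C P Q \<longrightarrow> (\<exists>r. g = r *\<^sub>a f))"

lemma hom_le1_embeds:
  assumes "hom_embeds P Q P' Q'" "hom_le1 P' Q'"
  shows "hom_le1 P Q"
  unfolding hom_le1_def
proof (intro ballI impI)
  obtain \<Phi> where \<Phi>: "\<And>f. f \<in> mor C P Q \<Longrightarrow> \<Phi> f \<in> mor C P' Q'"
    "\<And>f g. f \<in> mor C P Q \<Longrightarrow> g \<in> mor C P Q \<Longrightarrow> \<Phi> (f +\<^sub>a g) = \<Phi> f +\<^sub>a \<Phi> g"
    "\<And>f r. f \<in> mor C P Q \<Longrightarrow> \<Phi> (r *\<^sub>a f) = r *\<^sub>a \<Phi> f"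
    "\<And>f. f \<in> mor C P Q \<Longrightarrow> \<Phi> f = ZeroArr C P' Q' \<Longrightarrow> f = ZeroArr C P Q"
    by (rule hom_embedsE[OF assms(1)]) (rule that)
  fix f g assume fg: "f \<in> mor C P Q" "g \<in> mor C P Q" "f \<noteq> ZeroArr C P Q"
  then have "\<Phi> f \<noteq> ZeroArr C P' Q'" using \<Phi>(4) by blast
  then obtain r where r: "\<Phi> g = r *\<^sub>a \<Phi> f"
    using assms(2) \<Phi>(1)[OF fg(1)] \<Phi>(1)[OF fg(2)] unfolding hom_le1_def by blast
  have rf: "r *\<^sub>a f \<in> mor C P Q" "(-1) *\<^sub>a r *\<^sub>a f \<in> mor C P Q" using fg by (simp_all add: mor_iff)
  have "\<Phi> (g -\<^sub>a r *\<^sub>a f) = \<Phi> g -\<^sub>a \<Phi> g"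
    unfolding \<Phi>(2)[OF fg(2) rf(2)] \<Phi>(3)[OF rf(1)] \<Phi>(3)[OF fg(1)] r ..
  also have "\<dots> = ZeroArr C P' Q'" using \<Phi>(1)[OF fg(2)] diff_self[of "\<Phi> g"] by (simp add: mor_iff)
  finally have "g -\<^sub>a r *\<^sub>a f = ZeroArr C P Q"
    using \<Phi>(4)[of "g -\<^sub>a r *\<^sub>a f"] fg by (simp add: mor_iff)
  then have "g = r *\<^sub>a f" using diff_zero_imp_eq[of g "r *\<^sub>a f"] fg by (simp add: mor_iff)
  then show "\<exists>r. g = r *\<^sub>a f" ..
qed

lemma hom_embeds_nonzero:
  assumes "hom_embeds P Q P' Q'" "f \<in> mor C P Q" "f \<noteq> ZeroArr C P Q"
  shows "\<exists>g \<in> mor C P' Q'. g \<noteq> ZeroArr C P' Q'"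
  using assms unfolding hom_embeds_def by blast

lemma isomorphic_unit:
  assumes "X \<in> Obj C"
  shows "isomorphic C (\<I> \<otimes>\<^sub>o X) X" "isomorphic C (X \<otimes>\<^sub>o \<I>) X"
  using assms isomorphicI[of "LUnit C X" "\<I> \<otimes>\<^sub>o X" X] isomorphicI[of "RUnit C X" "X \<otimes>\<^sub>o \<I>" X]
  by (simp_all add: mor_iff)

lemma isomorphic_assoc:
  "X \<in> Obj C \<Longrightarrow> Y \<in> Obj C \<Longrightarrow> Z \<in> Obj C \<Longrightarrow> isomorphic C (X \<otimes>\<^sub>o Y \<otimes>\<^sub>o Z) (X \<otimes>\<^sub>o (Y \<otimes>\<^sub>o Z))"
  by (rule isomorphicI[of "Assoc C X Y Z"]) (auto simp: mor_iff)

lemma isomorphic_tensor: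
  assumes "isomorphic C X X'" "isomorphic C Y Y'"
  shows "isomorphic C (X \<otimes>\<^sub>o Y) (X' \<otimes>\<^sub>o Y')"
proof -
  obtain p q where "iso_arr C p" "p \<in> Arr C" "Dom C p = X" "Cod C p = X'"
    "iso_arr C q" "q \<in> Arr C" "Dom C q = Y" "Cod C q = Y'"
    using assms by (auto simp: isomorphic_def mor_iff)
  then show ?thesis by (intro isomorphicI[of "p \<otimes>\<^sub>a q"]) (simp_all add: mor_iff)
qed

lemma tensor_unit_zero:
  assumes f: "f \<in> mor C X Y"
  shows "f \<ltimes> \<I> = ZeroArr C (X \<otimes>\<^sub>o \<I>) (Y \<otimes>\<^sub>o \<I>) \<Longrightarrow> f = ZeroArr C X Y"
    and "\<I> \<rtimes> f = ZeroArr C (\<I> \<otimes>\<^sub>o X) (\<I> \<otimes>\<^sub>o Y) \<Longrightarrow> f = ZeroArr C X Y"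
proof -
  have [simp]: "f \<in> Arr C" "Dom C f = X" "Cod C f = Y" "X \<in> Obj C" "Y \<in> Obj C"
    using f mor_obj[OF f] by (auto simp: mor_iff)
  show "f = ZeroArr C X Y" if "f \<ltimes> \<I> = ZeroArr C (X \<otimes>\<^sub>o \<I>) (Y \<otimes>\<^sub>o \<I>)"
    by (rule iso_cancel_right[of "RUnit C X"]) (use runit_natural[OF f] that in simp_all)
  show "f = ZeroArr C X Y" if "\<I> \<rtimes> f = ZeroArr C (\<I> \<otimes>\<^sub>o X) (\<I> \<otimes>\<^sub>o Y)"
    by (rule iso_cancel_right[of "LUnit C X"]) (use lunit_natural[OF f] that in simp_all)
qed

lemma iso_comp_zero:
  assumes "iso_arr C e" "f \<in> Arr C"
  shows "Cod C f = Dom C e \<Longrightarrow> e \<cdot> f = ZeroArr C (Dom C f) (Cod C e) \<Longrightarrow> f = ZeroArr C (Dom C f) (Cod C f)"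
    and "Dom C f = Cod C e \<Longrightarrow> f \<cdot> e = ZeroArr C (Dom C e) (Cod C f) \<Longrightarrow> f = ZeroArr C (Dom C f) (Cod C f)"
proof -
  have e: "e \<in> Arr C" using assms iso_arr_Arr by simp
  show "f = ZeroArr C (Dom C f) (Cod C f)" if "Cod C f = Dom C e" "e \<cdot> f = ZeroArr C (Dom C f) (Cod C e)"
    by (rule iso_cancel_left[OF assms(1)]) (use assms e that in simp_all)
  show "f = ZeroArr C (Dom C f) (Cod C f)" if "Dom C f = Cod C e" "f \<cdot> e = ZeroArr C (Dom C e) (Cod C f)"
    by (rule iso_cancel_right[OF assms(1)]) (use assms e that in simp_all)
qed

lemma expand_zero:
  assumes i: "i \<in> mor C A (B \<otimes>\<^sub>o Y)" and O: "B \<in> Obj C" "Y \<in> Obj C"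
    and z: "expand i B Y \<I> = ZeroArr C (act [A] \<I>) (act [B, Y] \<I>)"
  shows "i = ZeroArr C A (B \<otimes>\<^sub>o Y)"
proof -
  have [simp]: "i \<in> Arr C" "Dom C i = A" "Cod C i = B \<otimes>\<^sub>o Y" "A \<in> Obj C" 
    using i mor_obj[OF i] by (auto simp: mor_iff)
  have "i \<ltimes> \<I> = ZeroArr C (A \<otimes>\<^sub>o \<I>) (B \<otimes>\<^sub>o Y \<otimes>\<^sub>o \<I>)"
    using iso_comp_zero(1)[of "Assoc C B Y \<I>" "i \<ltimes> \<I>"] z O by (simp add: expand_def)
  then show ?thesis using tensor_unit_zero(1)[OF i] by simp
qed

lemma contract_zero:
  assumes h: "h \<in> mor C (A \<otimes>\<^sub>o X) B" and O: "A \<in> Obj C" "X \<in> Obj C"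
    and z: "contract h A X \<I> = ZeroArr C (act [A, X] \<I>) (act [B] \<I>)"
  shows "h = ZeroArr C (A \<otimes>\<^sub>o X) B"
proof -
  have [simp]: "h \<in> Arr C" "Dom C h = A \<otimes>\<^sub>o X" "Cod C h = B" "B \<in> Obj C" 
    using h mor_obj[OF h] by (auto simp: mor_iff)
  have "h \<ltimes> \<I> = ZeroArr C (A \<otimes>\<^sub>o X \<otimes>\<^sub>o \<I>) (B \<otimes>\<^sub>o \<I>)"
    using iso_comp_zero(2)[of "inv_arr C (Assoc C A X \<I>)" "h \<ltimes> \<I>"] z O by (simp add: contract_def)
  then show ?thesis using tensor_unit_zero(1)[OF h] by simp
qed

text \<open>
  The zigzags leave a superfluous unit factor behind; naturality along the unit constraint removes
  it.
\<close>

lemma family_zero_unit_tensor: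
  assumes A: "set A \<subseteq> Obj C" and B: "set B \<subseteq> Obj C" and f: "module_family A B \<phi>"
    and z: "\<phi> (\<I> \<otimes>\<^sub>o \<I>) = ZeroArr C (act A (\<I> \<otimes>\<^sub>o \<I>)) (act B (\<I> \<otimes>\<^sub>o \<I>))"
  shows "\<phi> \<I> = ZeroArr C (act A \<I>) (act B \<I>)"
proof -
  note [simp] = A B module_familyD(1-3)[OF f]
  have "\<phi> \<I> \<cdot> act_arr A (LUnit C \<I>) = ZeroArr C (act A (\<I> \<otimes>\<^sub>o \<I>)) (act B \<I>)"
    using module_familyD(4)[OF f, of "LUnit C \<I>"] z by simp
  then show ?thesis using iso_comp_zero(2)[of "act_arr A (LUnit C \<I>)" "\<phi> \<I>"] by simp
qed

lemma expand_linear: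
  assumes "X \<in> Obj C" "Y \<in> Obj C" "W \<in> Obj C" "i \<in> mor C A (X \<otimes>\<^sub>o Y)" "j \<in> mor C A (X \<otimes>\<^sub>o Y)"
  shows "expand (i +\<^sub>a j) X Y W = expand i X Y W +\<^sub>a expand j X Y W"
    "expand (r *\<^sub>a i) X Y W = r *\<^sub>a expand i X Y W"
  using assms by (simp_all add: expand_def mor_iff tensor_add comp_add)

lemma contract_linear:
  assumes "X \<in> Obj C" "Y \<in> Obj C" "W \<in> Obj C" "i \<in> mor C (X \<otimes>\<^sub>o Y) A" "j \<in> mor C (X \<otimes>\<^sub>o Y) A"
  shows "contract (i +\<^sub>a j) X Y W = contract i X Y W +\<^sub>a contract j X Y W"
    "contract (r *\<^sub>a i) X Y W = r *\<^sub>a contract i X Y W"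
  using assms by (simp_all add: contract_def mor_iff tensor_add comp_add)

lemma expand_arr [simp]:
  assumes "X \<in> Obj C" "Y \<in> Obj C" "W \<in> Obj C" "i \<in> Arr C" "Cod C i = X \<otimes>\<^sub>o Y"
  shows "expand i X Y W \<in> Arr C" "Dom C (expand i X Y W) = Dom C i \<otimes>\<^sub>o W"
    "Cod C (expand i X Y W) = X \<otimes>\<^sub>o (Y \<otimes>\<^sub>o W)"
  using assms by (simp_all add: expand_def)

lemma contract_arr [simp]:
  assumes "X \<in> Obj C" "Y \<in> Obj C" "W \<in> Obj C" "i \<in> Arr C" "Dom C i = X \<otimes>\<^sub>o Y"
  shows "contract i X Y W \<in> Arr C" "Dom C (contract i X Y W) = X \<otimes>\<^sub>o (Y \<otimes>\<^sub>o W)"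
    "Cod C (contract i X Y W) = Cod C i \<otimes>\<^sub>o W"
  using assms by (simp_all add: contract_def)

lemma isomorphic_unit_mid:
  "A \<in> Obj C \<Longrightarrow> B \<in> Obj C \<Longrightarrow> isomorphic C (A \<otimes>\<^sub>o (B \<otimes>\<^sub>o \<I>)) (A \<otimes>\<^sub>o B)"
  "A \<in> Obj C \<Longrightarrow> isomorphic C (A \<otimes>\<^sub>o (\<I> \<otimes>\<^sub>o \<I>)) A"
  "A \<in> Obj C \<Longrightarrow> isomorphic C (\<I> \<otimes>\<^sub>o (A \<otimes>\<^sub>o \<I>)) A"
proof -
  show AB: "isomorphic C (A \<otimes>\<^sub>o (B \<otimes>\<^sub>o \<I>)) (A \<otimes>\<^sub>o B)" if "A \<in> Obj C" "B \<in> Obj C" for A B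
    by (intro isomorphic_tensor isomorphic_refl isomorphic_unit that)
  show "isomorphic C (A \<otimes>\<^sub>o (\<I> \<otimes>\<^sub>o \<I>)) A" if "A \<in> Obj C"
    by (rule isomorphic_trans[OF AB isomorphic_unit(2)]) (simp_all add: that)
  show "isomorphic C (\<I> \<otimes>\<^sub>o (A \<otimes>\<^sub>o \<I>)) A" if "A \<in> Obj C"
    by (rule isomorphic_trans[OF AB isomorphic_unit(1)]) (simp_all add: that)
qed

text \<open>
  An arrow \<open>i : A \<rightarrow> B \<otimes> Y\<close> is sent to the evaluation of its last factor against \<open>X\<close>.  Precomposing
  the result with the coevaluation of \<open>X\<close> and \<open>Y\<close> recovers \<open>i\<close> up to a zigzag, which gives
  injectivity.
\<close>

lemma hom_embeds_eval_right:
  assumes dual: "left_dual C X Y" and O: "A \<in> Obj C" "B \<in> Obj C"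
  shows "hom_embeds A (B \<otimes>\<^sub>o Y) (A \<otimes>\<^sub>o X) B"
proof -
  obtain \<epsilon> \<eta> where e: "module_family [Y, X] [\<I>] \<epsilon>" and h: "module_family [\<I>] [X, Y] \<eta>"
    and k1: "\<And>W. W \<in> Obj C \<Longrightarrow> iso_arr C ((X \<rtimes> \<epsilon> W) \<cdot> \<eta> (X \<otimes>\<^sub>o W))"
    and k2: "\<And>W. W \<in> Obj C \<Longrightarrow> iso_arr C (\<epsilon> (Y \<otimes>\<^sub>o W) \<cdot> (Y \<rtimes> \<eta> W))"
    by (rule left_dual_families[OF dual]) (rule that)
  have XY: "X \<in> Obj C" "Y \<in> Obj C" using dual by (auto simp: left_dual_def)
  note [simp] = XY O module_familyD(1-3)[OF e] module_familyD(1-3)[OF h]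
  let ?\<Phi> = "\<lambda>i W. (B \<rtimes> \<epsilon> W) \<cdot> expand i B Y (X \<otimes>\<^sub>o W)"
  have "hom_embeds A (B \<otimes>\<^sub>o Y) (A \<otimes>\<^sub>o (X \<otimes>\<^sub>o \<I>)) (B \<otimes>\<^sub>o (\<I> \<otimes>\<^sub>o \<I>))"
  proof (rule hom_embedsI[of _ _ "\<lambda>i. ?\<Phi> i \<I>"])
    fix i assume i: "i \<in> mor C A (B \<otimes>\<^sub>o Y)" 
      and z: "?\<Phi> i \<I> = ZeroArr C (A \<otimes>\<^sub>o (X \<otimes>\<^sub>o \<I>)) (B \<otimes>\<^sub>o (\<I> \<otimes>\<^sub>o \<I>))"
    note [simp] = i[unfolded mor_iff]
    have ex: "module_family [A] [B, Y] (expand i B Y)" by (rule module_family_expand) (simp_all add: i)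
    have m1: "module_family [A, X] [B, Y, X] (\<lambda>W. expand i B Y (X \<otimes>\<^sub>o W))"
      using module_family_right[OF _ _ _ ex, of "[X]"] by simp
    have m2: "module_family [B, Y, X] [B, \<I>] (\<lambda>W. B \<rtimes> \<epsilon> W)"
      by (rule module_family_left[OF _ _ _ e]) simp_all
    have fam: "module_family [A, X] [B, \<I>] (?\<Phi> i)"
      by (rule module_family_comp[OF _ _ _ m1 m2]) simp_all
    have zero: "?\<Phi> i (Y \<otimes>\<^sub>o \<I>) = ZeroArr C (act [A, X] (Y \<otimes>\<^sub>o \<I>)) (act [B, \<I>] (Y \<otimes>\<^sub>o \<I>))"
      by (rule module_family_zeroI[OF _ _ fam]) (use z in simp_all)
    have nat: "expand i B Y (X \<otimes>\<^sub>o (Y \<otimes>\<^sub>o \<I>)) \<cdot> (A \<rtimes> \<eta> \<I>)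
      = (B \<rtimes> (Y \<rtimes> \<eta> \<I>)) \<cdot> expand i B Y (\<I> \<otimes>\<^sub>o \<I>)"
      using module_familyD(4)[OF ex, of "\<eta> \<I>"] by simp
    have "(B \<rtimes> (\<epsilon> (Y \<otimes>\<^sub>o \<I>) \<cdot> (Y \<rtimes> \<eta> \<I>))) \<cdot> expand i B Y (\<I> \<otimes>\<^sub>o \<I>)
      = (B \<rtimes> \<epsilon> (Y \<otimes>\<^sub>o \<I>)) \<cdot> (expand i B Y (X \<otimes>\<^sub>o (Y \<otimes>\<^sub>o \<I>)) \<cdot> (A \<rtimes> \<eta> \<I>))"
      unfolding nat by (simp add: whisker_comp)
    also have "\<dots> = ?\<Phi> i (Y \<otimes>\<^sub>o \<I>) \<cdot> (A \<rtimes> \<eta> \<I>)" by simp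
    also have "\<dots> = ZeroArr C (A \<otimes>\<^sub>o (\<I> \<otimes>\<^sub>o \<I>)) (B \<otimes>\<^sub>o (\<I> \<otimes>\<^sub>o (Y \<otimes>\<^sub>o \<I>)))"
      unfolding zero by simp
    finally have "expand i B Y (\<I> \<otimes>\<^sub>o \<I>) = ZeroArr C (A \<otimes>\<^sub>o (\<I> \<otimes>\<^sub>o \<I>)) (B \<otimes>\<^sub>o (Y \<otimes>\<^sub>o (\<I> \<otimes>\<^sub>o \<I>)))"
      using iso_comp_zero(1)[of "B \<rtimes> (\<epsilon> (Y \<otimes>\<^sub>o \<I>) \<cdot> (Y \<rtimes> \<eta> \<I>))" "expand i B Y (\<I> \<otimes>\<^sub>o \<I>)"]
        k2[of \<I>] by simp
    then have "expand i B Y \<I> = ZeroArr C (act [A] \<I>) (act [B, Y] \<I>)"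
      by (intro family_zero_unit_tensor[OF _ _ ex]) simp_all
    then show "i = ZeroArr C A (B \<otimes>\<^sub>o Y)" by (rule expand_zero[OF i, rotated 2]) simp_all
  qed (simp_all add: mor_iff expand_linear[unfolded mor_iff] comp_add)
  also have "hom_embeds (A \<otimes>\<^sub>o (X \<otimes>\<^sub>o \<I>)) (B \<otimes>\<^sub>o (\<I> \<otimes>\<^sub>o \<I>)) (A \<otimes>\<^sub>o X) B"
    by (rule hom_embeds_isomorphic) (simp_all add: isomorphic_unit_mid)
  finally show ?thesis .
qed

text \<open>
  The mirror image, with evaluation on the left; the other zigzag recovers \<open>i\<close>.
\<close>

lemma hom_embeds_eval_left:
  assumes dual: "left_dual C X Y" and O: "A \<in> Obj C" "B \<in> Obj C"
  shows "hom_embeds A (X \<otimes>\<^sub>o B) (Y \<otimes>\<^sub>o A) B"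
proof -
  obtain \<epsilon> \<eta> where e: "module_family [Y, X] [\<I>] \<epsilon>" and h: "module_family [\<I>] [X, Y] \<eta>"
    and k1: "\<And>W. W \<in> Obj C \<Longrightarrow> iso_arr C ((X \<rtimes> \<epsilon> W) \<cdot> \<eta> (X \<otimes>\<^sub>o W))"
    and k2: "\<And>W. W \<in> Obj C \<Longrightarrow> iso_arr C (\<epsilon> (Y \<otimes>\<^sub>o W) \<cdot> (Y \<rtimes> \<eta> W))"
    by (rule left_dual_families[OF dual]) (rule that)
  have XY: "X \<in> Obj C" "Y \<in> Obj C" using dual by (auto simp: left_dual_def)
  note [simp] = XY O module_familyD(1-3)[OF e] module_familyD(1-3)[OF h]
  let ?\<Phi> = "\<lambda>i. \<epsilon> (B \<otimes>\<^sub>o \<I>) \<cdot> (Y \<rtimes> expand i X B \<I>)"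
  have "hom_embeds A (X \<otimes>\<^sub>o B) (Y \<otimes>\<^sub>o (A \<otimes>\<^sub>o \<I>)) (\<I> \<otimes>\<^sub>o (B \<otimes>\<^sub>o \<I>))"
  proof (rule hom_embedsI[of _ _ ?\<Phi>])
    fix i assume i: "i \<in> mor C A (X \<otimes>\<^sub>o B)" 
      and z: "?\<Phi> i = ZeroArr C (Y \<otimes>\<^sub>o (A \<otimes>\<^sub>o \<I>)) (\<I> \<otimes>\<^sub>o (B \<otimes>\<^sub>o \<I>))"
    note [simp] = i[unfolded mor_iff]
    let ?e = "expand i X B \<I>"
    have nat: "\<eta> (X \<otimes>\<^sub>o (B \<otimes>\<^sub>o \<I>)) \<cdot> (\<I> \<rtimes> ?e) = (X \<rtimes> (Y \<rtimes> ?e)) \<cdot> \<eta> (A \<otimes>\<^sub>o \<I>)"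
      using module_familyD(4)[OF h, of ?e] by simp
    have "((X \<rtimes> \<epsilon> (B \<otimes>\<^sub>o \<I>)) \<cdot> \<eta> (X \<otimes>\<^sub>o (B \<otimes>\<^sub>o \<I>))) \<cdot> (\<I> \<rtimes> ?e)
      = (X \<rtimes> \<epsilon> (B \<otimes>\<^sub>o \<I>)) \<cdot> ((X \<rtimes> (Y \<rtimes> ?e)) \<cdot> \<eta> (A \<otimes>\<^sub>o \<I>))"
      using nat by simp
    also have "\<dots> = (X \<rtimes> ?\<Phi> i) \<cdot> \<eta> (A \<otimes>\<^sub>o \<I>)" by (simp add: whisker_comp)
    also have "\<dots> = ZeroArr C (\<I> \<otimes>\<^sub>o (A \<otimes>\<^sub>o \<I>)) (X \<otimes>\<^sub>o (\<I> \<otimes>\<^sub>o (B \<otimes>\<^sub>o \<I>)))"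
      unfolding z by simp
    finally have "\<I> \<rtimes> ?e = ZeroArr C (\<I> \<otimes>\<^sub>o (A \<otimes>\<^sub>o \<I>)) (\<I> \<otimes>\<^sub>o (X \<otimes>\<^sub>o (B \<otimes>\<^sub>o \<I>)))"
      using iso_comp_zero(1)[OF k1[of "B \<otimes>\<^sub>o \<I>"], of "\<I> \<rtimes> ?e"] by simp
    then have "?e = ZeroArr C (A \<otimes>\<^sub>o \<I>) (X \<otimes>\<^sub>o (B \<otimes>\<^sub>o \<I>))"
      by (rule tensor_unit_zero(2)[rotated]) (simp_all add: mor_iff)
    then have "?e = ZeroArr C (act [A] \<I>) (act [X, B] \<I>)" by simp
    then show "i = ZeroArr C A (X \<otimes>\<^sub>o B)" by (rule expand_zero[OF i, rotated 2]) simp_all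
  qed (simp_all add: mor_iff expand_linear[unfolded mor_iff] comp_add tensor_add)
  also have "hom_embeds (Y \<otimes>\<^sub>o (A \<otimes>\<^sub>o \<I>)) (\<I> \<otimes>\<^sub>o (B \<otimes>\<^sub>o \<I>)) (Y \<otimes>\<^sub>o A) B"
    by (rule hom_embeds_isomorphic) (simp_all add: isomorphic_unit_mid)
  finally show ?thesis .
qed

text \<open>
  Here an arrow \<open>A \<otimes> X \<rightarrow> B\<close> is precomposed with the coevaluation and recovered by the evaluation.
\<close>

lemma hom_embeds_coeval_right:
  assumes dual: "left_dual C X Y" and O: "A \<in> Obj C" "B \<in> Obj C"
  shows "hom_embeds (A \<otimes>\<^sub>o X) B A (B \<otimes>\<^sub>o Y)"
proof -
  obtain \<epsilon> \<eta> where e: "module_family [Y, X] [\<I>] \<epsilon>" and h: "module_family [\<I>] [X, Y] \<eta>"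
    and k1: "\<And>W. W \<in> Obj C \<Longrightarrow> iso_arr C ((X \<rtimes> \<epsilon> W) \<cdot> \<eta> (X \<otimes>\<^sub>o W))"
    and k2: "\<And>W. W \<in> Obj C \<Longrightarrow> iso_arr C (\<epsilon> (Y \<otimes>\<^sub>o W) \<cdot> (Y \<rtimes> \<eta> W))"
    by (rule left_dual_families[OF dual]) (rule that)
  have XY: "X \<in> Obj C" "Y \<in> Obj C" using dual by (auto simp: left_dual_def)
  note [simp] = XY O module_familyD(1-3)[OF e] module_familyD(1-3)[OF h]
  let ?\<Phi> = "\<lambda>f W. contract f A X (Y \<otimes>\<^sub>o W) \<cdot> (A \<rtimes> \<eta> W)"
  have "hom_embeds (A \<otimes>\<^sub>o X) B (A \<otimes>\<^sub>o (\<I> \<otimes>\<^sub>o \<I>)) (B \<otimes>\<^sub>o (Y \<otimes>\<^sub>o \<I>))"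
  proof (rule hom_embedsI[of _ _ "\<lambda>f. ?\<Phi> f \<I>"])
    fix f assume f: "f \<in> mor C (A \<otimes>\<^sub>o X) B" 
      and z: "?\<Phi> f \<I> = ZeroArr C (A \<otimes>\<^sub>o (\<I> \<otimes>\<^sub>o \<I>)) (B \<otimes>\<^sub>o (Y \<otimes>\<^sub>o \<I>))"
    note [simp] = f[unfolded mor_iff]
    have ex: "module_family [A, X] [B] (contract f A X)" by (rule module_family_contract) (simp_all add: f)
    have m1: "module_family [A, X, Y] [B, Y] (\<lambda>W. contract f A X (Y \<otimes>\<^sub>o W))"
      using module_family_right[OF _ _ _ ex, of "[Y]"] by simp
    have m2: "module_family [A, \<I>] [A, X, Y] (\<lambda>W. A \<rtimes> \<eta> W)"
      by (rule module_family_left[OF _ _ _ h]) simp_all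
    have fam: "module_family [A, \<I>] [B, Y] (?\<Phi> f)"
      by (rule module_family_comp[OF _ _ _ m2 m1]) simp_all
    have zero: "?\<Phi> f (X \<otimes>\<^sub>o \<I>) = ZeroArr C (act [A, \<I>] (X \<otimes>\<^sub>o \<I>)) (act [B, Y] (X \<otimes>\<^sub>o \<I>))"
      by (rule module_family_zeroI[OF _ _ fam]) (use z in simp_all)
    have nat: "contract f A X (\<I> \<otimes>\<^sub>o \<I>) \<cdot> (A \<rtimes> (X \<rtimes> \<epsilon> \<I>))
      = (B \<rtimes> \<epsilon> \<I>) \<cdot> contract f A X (Y \<otimes>\<^sub>o (X \<otimes>\<^sub>o \<I>))"
      using module_familyD(4)[OF ex, of "\<epsilon> \<I>"] by simp
    have "contract f A X (\<I> \<otimes>\<^sub>o \<I>) \<cdot> (A \<rtimes> ((X \<rtimes> \<epsilon> \<I>) \<cdot> \<eta> (X \<otimes>\<^sub>o \<I>)))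
      = (contract f A X (\<I> \<otimes>\<^sub>o \<I>) \<cdot> (A \<rtimes> (X \<rtimes> \<epsilon> \<I>))) \<cdot> (A \<rtimes> \<eta> (X \<otimes>\<^sub>o \<I>))"
      by (simp add: whisker_comp)
    also have "\<dots> = (B \<rtimes> \<epsilon> \<I>) \<cdot> ?\<Phi> f (X \<otimes>\<^sub>o \<I>)" unfolding nat by simp
    also have "\<dots> = ZeroArr C (A \<otimes>\<^sub>o (\<I> \<otimes>\<^sub>o (X \<otimes>\<^sub>o \<I>))) (B \<otimes>\<^sub>o (\<I> \<otimes>\<^sub>o \<I>))"
      unfolding zero by simp
    finally have "contract f A X (\<I> \<otimes>\<^sub>o \<I>) = ZeroArr C (A \<otimes>\<^sub>o (X \<otimes>\<^sub>o (\<I> \<otimes>\<^sub>o \<I>))) (B \<otimes>\<^sub>o (\<I> \<otimes>\<^sub>o \<I>))"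
      using iso_comp_zero(2)[of "A \<rtimes> ((X \<rtimes> \<epsilon> \<I>) \<cdot> \<eta> (X \<otimes>\<^sub>o \<I>))" "contract f A X (\<I> \<otimes>\<^sub>o \<I>)"]
        k1[of \<I>] by simp
    then have "contract f A X \<I> = ZeroArr C (act [A, X] \<I>) (act [B] \<I>)"
      by (intro family_zero_unit_tensor[OF _ _ ex]) simp_all
    then show "f = ZeroArr C (A \<otimes>\<^sub>o X) B" by (rule contract_zero[OF f, rotated 2]) simp_all
  qed (simp_all add: mor_iff contract_linear[unfolded mor_iff] comp_add)
  also have "hom_embeds (A \<otimes>\<^sub>o (\<I> \<otimes>\<^sub>o \<I>)) (B \<otimes>\<^sub>o (Y \<otimes>\<^sub>o \<I>)) A (B \<otimes>\<^sub>o Y)"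
    by (rule hom_embeds_isomorphic) (simp_all add: isomorphic_unit_mid)
  finally show ?thesis .
qed

text \<open>
  Tensoring with \<open>g\<close> on the left undoes tensoring with \<open>h\<close>.
\<close>

lemma whisker_faithful:
  assumes gh: "isomorphic C (g \<otimes>\<^sub>o h) \<I>" and O: "g \<in> Obj C" "h \<in> Obj C" and f: "f \<in> mor C P Q"
    and z: "h \<rtimes> f = ZeroArr C (h \<otimes>\<^sub>o P) (h \<otimes>\<^sub>o Q)"
  shows "f = ZeroArr C P Q"
proof -
  obtain j where j: "iso_arr C j" "j \<in> Arr C" "Dom C j = g \<otimes>\<^sub>o h" "Cod C j = \<I>"
    using gh by (auto simp: isomorphic_def mor_iff)
  have PQ: "P \<in> Obj C" "Q \<in> Obj C" using f mor_obj by auto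
  note [simp] = O j PQ f[unfolded mor_iff]
  have "Assoc C g h Q \<cdot> ((g \<otimes>\<^sub>o h) \<rtimes> f) = ZeroArr C (g \<otimes>\<^sub>o h \<otimes>\<^sub>o P) (g \<otimes>\<^sub>o (h \<otimes>\<^sub>o Q))"
    using assoc_nat[of "Idn C g" "Idn C h" f] z by simp
  then have 1: "(g \<otimes>\<^sub>o h) \<rtimes> f = ZeroArr C (g \<otimes>\<^sub>o h \<otimes>\<^sub>o P) (g \<otimes>\<^sub>o h \<otimes>\<^sub>o Q)"
    using iso_comp_zero(1)[of "Assoc C g h Q" "(g \<otimes>\<^sub>o h) \<rtimes> f"] by simp
  have "(\<I> \<rtimes> f) \<cdot> (j \<ltimes> P) = (j \<ltimes> Q) \<cdot> ((g \<otimes>\<^sub>o h) \<rtimes> f)"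
    by (rule interchange[symmetric]) simp_all
  also have "\<dots> = ZeroArr C (g \<otimes>\<^sub>o h \<otimes>\<^sub>o P) (\<I> \<otimes>\<^sub>o Q)" unfolding 1 by simp
  finally have "\<I> \<rtimes> f = ZeroArr C (\<I> \<otimes>\<^sub>o P) (\<I> \<otimes>\<^sub>o Q)"
    using iso_comp_zero(2)[of "j \<ltimes> P" "\<I> \<rtimes> f"] by simp
  then show ?thesis by (rule tensor_unit_zero(2)[OF f])
qed

end

context fusion_category
begin

lemma simple_imp_hom_le1: "simple_obj C S \<Longrightarrow> simple_obj C X \<Longrightarrow> hom_le1 S X"
  unfolding hom_le1_def using simple_hom_scalar by blast

text \<open>
  By duality \<open>End(Y)\<close> embeds into \<open>Hom(X \<otimes> Y, \<I>)\<close> and then into \<open>End(X)\<close>, which is one-dimensional.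
  The object \<open>Y\<close> is nonzero since \<open>End(X)\<close> embeds into \<open>Hom(X \<otimes> Y, \<I>)\<close>.
\<close>

lemma dual_simple:
  assumes dual: "left_dual C Y X" and X: "simple_obj C X"
  shows "simple_obj C Y"
proof -
  have O: "X \<in> Obj C" "Y \<in> Obj C" using dual by (auto simp: left_dual_def)
  have "hom_embeds Y Y Y (Y \<otimes>\<^sub>o \<I>)"
    by (rule hom_embeds_isomorphic) (simp_all add: isomorphic_refl isomorphic_unit isomorphic_unit[THEN isomorphic_sym] O)
  also have "hom_embeds Y (Y \<otimes>\<^sub>o \<I>) (X \<otimes>\<^sub>o Y) \<I>" by (rule hom_embeds_eval_left[OF dual]) (simp_all add: O)
  also have "hom_embeds (X \<otimes>\<^sub>o Y) \<I> X (\<I> \<otimes>\<^sub>o X)" by (rule hom_embeds_coeval_right[OF dual]) (simp_all add: O)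
  also have "hom_embeds X (\<I> \<otimes>\<^sub>o X) X X"
    by (rule hom_embeds_isomorphic) (simp_all add: isomorphic_refl isomorphic_unit isomorphic_unit[THEN isomorphic_sym] O)
  finally have le1: "hom_le1 Y Y" using hom_le1_embeds simple_imp_hom_le1[OF X X] by blast
  have nz: "Idn C Y \<noteq> ZeroArr C Y Y"
  proof
    assume z: "Idn C Y = ZeroArr C Y Y"
    have "hom_embeds X X X (\<I> \<otimes>\<^sub>o X)"
      by (rule hom_embeds_isomorphic) (simp_all add: isomorphic_refl isomorphic_unit isomorphic_unit[THEN isomorphic_sym] O)
    also have "hom_embeds X (\<I> \<otimes>\<^sub>o X) (X \<otimes>\<^sub>o Y) \<I>" by (rule hom_embeds_eval_right[OF dual]) (simp_all add: O)
    finally obtain g where g: "g \<in> mor C (X \<otimes>\<^sub>o Y) \<I>" "g \<noteq> ZeroArr C (X \<otimes>\<^sub>o Y) \<I>"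
      using hom_embeds_nonzero[of X X _ _ "Idn C X"] simple_objD[OF X] id_mor by blast
    have "Idn C (X \<otimes>\<^sub>o Y) = ZeroArr C (X \<otimes>\<^sub>o Y) (X \<otimes>\<^sub>o Y)"
      using tensor_id[OF O] O unfolding z by simp
    then have "g = g \<cdot> ZeroArr C (X \<otimes>\<^sub>o Y) (X \<otimes>\<^sub>o Y)" using g O comp_id(2)[of g "X \<otimes>\<^sub>o Y"] by (simp add: mor_iff)
    then show False using g O by (simp add: mor_iff)
  qed
  show ?thesis
    by (rule scalar_end_imp_simple[OF O(2) nz]) (use le1 nz O id_mor in \<open>unfold hom_le1_def, blast\<close>)
qed

text \<open>
  Tensoring with \<open>h\<close> embeds \<open>End(g \<otimes> S)\<close> into \<open>End(h \<otimes> (g \<otimes> S))\<close>, and \<open>h \<otimes> (g \<otimes> S) \<cong> S\<close>.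
\<close>

lemma invertible_tensor_simple:
  assumes gh: "isomorphic C (g \<otimes>\<^sub>o h) \<I>" "isomorphic C (h \<otimes>\<^sub>o g) \<I>" and O: "g \<in> Obj C" "h \<in> Obj C"
    and S: "simple_obj C S"
  shows "simple_obj C (g \<otimes>\<^sub>o S)"
proof -
  have SO: "S \<in> Obj C" using simple_objD[OF S] by simp
  note [simp] = O SO
  have "isomorphic C (h \<otimes>\<^sub>o (g \<otimes>\<^sub>o S)) (h \<otimes>\<^sub>o g \<otimes>\<^sub>o S)" by (rule isomorphic_sym[OF isomorphic_assoc[OF O(2,1) SO]])
  also have "isomorphic C (h \<otimes>\<^sub>o g \<otimes>\<^sub>o S) (\<I> \<otimes>\<^sub>o S)" by (rule isomorphic_tensor[OF gh(2) isomorphic_refl[OF SO]])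
  also have "isomorphic C (\<I> \<otimes>\<^sub>o S) S" by (rule isomorphic_unit[OF SO])
  finally have T: "simple_obj C (h \<otimes>\<^sub>o (g \<otimes>\<^sub>o S))" using simple_obj_isomorphic[OF S] by blast
  show ?thesis
  proof (rule scalar_end_imp_simple)
    show "Idn C (g \<otimes>\<^sub>o S) \<noteq> ZeroArr C (g \<otimes>\<^sub>o S) (g \<otimes>\<^sub>o S)"
    proof
      assume z: "Idn C (g \<otimes>\<^sub>o S) = ZeroArr C (g \<otimes>\<^sub>o S) (g \<otimes>\<^sub>o S)"
      show False using simple_objD(2)[OF T] tensor_id[of h "g \<otimes>\<^sub>o S"] unfolding z by simp
    qed
    fix f assume f: "f \<in> mor C (g \<otimes>\<^sub>o S) (g \<otimes>\<^sub>o S)"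
    then have "h \<rtimes> f \<in> mor C (h \<otimes>\<^sub>o (g \<otimes>\<^sub>o S)) (h \<otimes>\<^sub>o (g \<otimes>\<^sub>o S))" by (simp add: mor_iff)
    then obtain r where r: "h \<rtimes> f = r *\<^sub>a Idn C (h \<otimes>\<^sub>o (g \<otimes>\<^sub>o S))"
      using simple_end_scalar[OF T] by blast
    have "h \<rtimes> (f -\<^sub>a r *\<^sub>a Idn C (g \<otimes>\<^sub>o S))
      = r *\<^sub>a Idn C (h \<otimes>\<^sub>o (g \<otimes>\<^sub>o S)) -\<^sub>a r *\<^sub>a Idn C (h \<otimes>\<^sub>o (g \<otimes>\<^sub>o S))"
      using f r by (simp add: mor_iff tensor_add)
    also have "\<dots> = ZeroArr C (h \<otimes>\<^sub>o (g \<otimes>\<^sub>o S)) (h \<otimes>\<^sub>o (g \<otimes>\<^sub>o S))"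
      using diff_self[of "r *\<^sub>a Idn C (h \<otimes>\<^sub>o (g \<otimes>\<^sub>o S))"] by simp
    finally have "f -\<^sub>a r *\<^sub>a Idn C (g \<otimes>\<^sub>o S) = ZeroArr C (g \<otimes>\<^sub>o S) (g \<otimes>\<^sub>o S)"
      by (rule whisker_faithful[OF gh(1) O, rotated]) (use f in \<open>simp add: mor_iff\<close>)
    then have "f = r *\<^sub>a Idn C (g \<otimes>\<^sub>o S)"
      using f diff_zero_imp_eq[of f "r *\<^sub>a Idn C (g \<otimes>\<^sub>o S)"] by (simp add: mor_iff)
    then show "\<exists>r. f = r *\<^sub>a Idn C (g \<otimes>\<^sub>o S)" ..
  qed simp
qed

lemma invertible_imp_simple:
  assumes "isomorphic C (g \<otimes>\<^sub>o h) \<I>" "isomorphic C (h \<otimes>\<^sub>o g) \<I>" "g \<in> Obj C" "h \<in> Obj C"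
  shows "simple_obj C g"
  using simple_obj_isomorphic[OF invertible_tensor_simple[OF assms unit_simple]]
    isomorphic_sym[OF isomorphic_unit(2)[OF assms(3)]] by blast

end

section \<open>The braiding as a natural family\<close>

locale braided_fusion_category = fusion_category C + braiding C c
  for C :: "('o, 'm) moncat" (structure) and c :: "'o \<Rightarrow> 'o \<Rightarrow> 'm"
begin

lemma braid_arr [simp]:
  assumes "X \<in> Obj C" "Y \<in> Obj C"
  shows "c X Y \<in> Arr C" "Dom C (c X Y) = X \<otimes>\<^sub>o Y" "Cod C (c X Y) = Y \<otimes>\<^sub>o X" "iso_arr C (c X Y)"
  using braid_mor[OF assms] braid_iso[OF assms] by (auto simp: mor_iff)

lemma isomorphic_braid: "X \<in> Obj C \<Longrightarrow> Y \<in> Obj C \<Longrightarrow> isomorphic C (X \<otimes>\<^sub>o Y) (Y \<otimes>\<^sub>o X)"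
  by (rule isomorphicI[of "c X Y"]) (simp_all add: mor_iff)

text \<open>
  The braiding \<open>X \<otimes> Y \<rightarrow> Y \<otimes> X\<close> as a family from \<open>[X, Y]\<close> to \<open>[Y, X]\<close>.
\<close>

definition swap :: "'o \<Rightarrow> 'o \<Rightarrow> 'o \<Rightarrow> 'm" where
  "swap X Y W = Assoc C Y X W \<cdot> (c X Y \<ltimes> W) \<cdot> inv_arr C (Assoc C X Y W)"

lemma swap_arr [simp]:
  assumes "X \<in> Obj C" "Y \<in> Obj C" "W \<in> Obj C"
  shows "swap X Y W \<in> Arr C" "Dom C (swap X Y W) = X \<otimes>\<^sub>o (Y \<otimes>\<^sub>o W)"
    "Cod C (swap X Y W) = Y \<otimes>\<^sub>o (X \<otimes>\<^sub>o W)" "iso_arr C (swap X Y W)"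
  using assms by (simp_all add: swap_def)

lemma swap_family:
  assumes "X \<in> Obj C" "Y \<in> Obj C"
  shows "module_family [X, Y] [Y, X] (swap X Y)"
proof -
  have 1: "module_family [X, Y] [Y \<otimes>\<^sub>o X] (\<lambda>W. (c X Y \<ltimes> W) \<cdot> inv_arr C (Assoc C X Y W))"
    by (rule module_family_comp[OF _ _ _ module_family_assoc_inv module_family_of_arrow])
      (use assms in \<open>simp_all add: mor_iff\<close>)
  have "module_family [X, Y] [Y, X] (\<lambda>W. Assoc C Y X W \<cdot> ((c X Y \<ltimes> W) \<cdot> inv_arr C (Assoc C X Y W)))"
    by (rule module_family_comp[OF _ _ _ 1 module_family_assoc]) (use assms in simp_all)
  then show ?thesis by (simp add: swap_def[abs_def])
qed

lemma swap_assoc: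
  assumes "X \<in> Obj C" "Y \<in> Obj C" "W \<in> Obj C"
  shows "swap X Y W \<cdot> Assoc C X Y W = Assoc C Y X W \<cdot> (c X Y \<ltimes> W)"
  using assms by (simp add: swap_def)

lemma braid_nat_left:
  assumes "f \<in> mor C X X'" "Y \<in> Obj C"
  shows "c X' Y \<cdot> (f \<ltimes> Y) = (Y \<rtimes> f) \<cdot> c X Y"
  using braid_natural[OF assms(1) id_mor[OF assms(2)]] .

lemma braid_nat_right:
  assumes "f \<in> mor C X X'" "Y \<in> Obj C"
  shows "c Y X' \<cdot> (Y \<rtimes> f) = (f \<ltimes> Y) \<cdot> c Y X"
  using braid_natural[OF id_mor[OF assms(2)] assms(1)] .

lemma swap_nat_left:
  assumes "f \<in> mor C X X'" "Y \<in> Obj C" "W \<in> Obj C"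
  shows "swap X' Y W \<cdot> (f \<ltimes> (Y \<otimes>\<^sub>o W)) = (Y \<rtimes> (f \<ltimes> W)) \<cdot> swap X Y W"
proof -
  have XX: "X \<in> Obj C" "X' \<in> Obj C" using assms mor_obj by auto
  note [simp] = assms(2,3) XX assms(1)[unfolded mor_iff]
  have n1: "(f \<ltimes> (Y \<otimes>\<^sub>o W)) \<cdot> Assoc C X Y W = Assoc C X' Y W \<cdot> (f \<ltimes> Y \<ltimes> W)"
    using assoc_nat[of f "Idn C Y" "Idn C W"] by simp
  have n2: "Assoc C Y X' W \<cdot> (Y \<rtimes> f \<ltimes> W)
    = (Y \<rtimes> (f \<ltimes> W)) \<cdot> Assoc C Y X W"
    using assoc_nat[of "Idn C Y" f "Idn C W"] by simp
  have n3: "(c X' Y \<ltimes> W) \<cdot> (f \<ltimes> Y \<ltimes> W)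
    = (Y \<rtimes> f \<ltimes> W) \<cdot> (c X Y \<ltimes> W)"
    using braid_nat_left[OF assms(1,2)] by (simp add: tensor_comp_arr)
  have "(swap X' Y W \<cdot> (f \<ltimes> (Y \<otimes>\<^sub>o W))) \<cdot> Assoc C X Y W
    = swap X' Y W \<cdot> (Assoc C X' Y W \<cdot> (f \<ltimes> Y \<ltimes> W))" using n1 by simp
  also have "\<dots> = (Assoc C Y X' W \<cdot> (c X' Y \<ltimes> W)) \<cdot> (f \<ltimes> Y \<ltimes> W)"
    by (rule comp_cong_left[OF swap_assoc]) simp_all
  also have "\<dots> = Assoc C Y X' W \<cdot> ((Y \<rtimes> f \<ltimes> W) \<cdot> (c X Y \<ltimes> W))"
    using n3 by simp
  also have "\<dots> = (Y \<rtimes> (f \<ltimes> W)) \<cdot> (Assoc C Y X W \<cdot> (c X Y \<ltimes> W))"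
    by (rule comp_swap[OF n2]) simp_all
  also have "\<dots> = ((Y \<rtimes> (f \<ltimes> W)) \<cdot> swap X Y W) \<cdot> Assoc C X Y W"
    using swap_assoc[of X Y W] by simp
  finally show ?thesis by (rule iso_cancel_right[rotated]) simp_all
qed

lemma swap_nat_right:
  assumes "f \<in> mor C X X'" "Y \<in> Obj C" "W \<in> Obj C"
  shows "swap Y X' W \<cdot> (Y \<rtimes> (f \<ltimes> W)) = (f \<ltimes> (Y \<otimes>\<^sub>o W)) \<cdot> swap Y X W"
proof -
  have XX: "X \<in> Obj C" "X' \<in> Obj C" using assms mor_obj by auto
  note [simp] = assms(2,3) XX assms(1)[unfolded mor_iff]
  have n1: "Assoc C X' Y W \<cdot> (f \<ltimes> Y \<ltimes> W) = (f \<ltimes> (Y \<otimes>\<^sub>o W)) \<cdot> Assoc C X Y W"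
    using assoc_nat[of f "Idn C Y" "Idn C W"] by simp
  have n2: "(Y \<rtimes> (f \<ltimes> W)) \<cdot> Assoc C Y X W
    = Assoc C Y X' W \<cdot> (Y \<rtimes> f \<ltimes> W)"
    using assoc_nat[of "Idn C Y" f "Idn C W"] by simp
  have n3: "(c Y X' \<ltimes> W) \<cdot> (Y \<rtimes> f \<ltimes> W)
    = (f \<ltimes> Y \<ltimes> W) \<cdot> (c Y X \<ltimes> W)"
    using braid_nat_right[OF assms(1,2)] by (simp add: tensor_comp_arr)
  have "(swap Y X' W \<cdot> (Y \<rtimes> (f \<ltimes> W))) \<cdot> Assoc C Y X W
    = swap Y X' W \<cdot> (Assoc C Y X' W \<cdot> (Y \<rtimes> f \<ltimes> W))" using n2 by simp
  also have "\<dots> = (Assoc C X' Y W \<cdot> (c Y X' \<ltimes> W)) \<cdot> (Y \<rtimes> f \<ltimes> W)"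
    by (rule comp_cong_left[OF swap_assoc]) simp_all
  also have "\<dots> = Assoc C X' Y W \<cdot> ((f \<ltimes> Y \<ltimes> W) \<cdot> (c Y X \<ltimes> W))"
    using n3 by simp
  also have "\<dots> = (f \<ltimes> (Y \<otimes>\<^sub>o W)) \<cdot> (Assoc C X Y W \<cdot> (c Y X \<ltimes> W))"
    by (rule comp_swap[OF n1]) simp_all
  also have "\<dots> = ((f \<ltimes> (Y \<otimes>\<^sub>o W)) \<cdot> swap Y X W) \<cdot> Assoc C Y X W"
    using swap_assoc[of Y X W] by simp
  finally show ?thesis by (rule iso_cancel_right[rotated]) simp_all
qed

text \<open>
  The hexagons for families: up to regrouping \<open>Y \<otimes> Z\<close> into the list \<open>[Y, Z]\<close>, moving past a tensor
  product is moving past its factors one after the other.  Each is the tensor product of a hexagon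
  with \<open>W\<close>; the pentagons redistribute the brackets.
\<close>

lemma swap_hexagon1:
  assumes O: "X \<in> Obj C" "Y \<in> Obj C" "Z \<in> Obj C" "W \<in> Obj C"
  shows "Assoc C Y Z (X \<otimes>\<^sub>o W) \<cdot> swap X (Y \<otimes>\<^sub>o Z) W
    = (Y \<rtimes> swap X Z W) \<cdot> swap X Y (Z \<otimes>\<^sub>o W) \<cdot> (X \<rtimes> Assoc C Y Z W)" (is "?L = ?R")
proof -
  note [simp] = O
  let ?P = "Assoc C X (Y \<otimes>\<^sub>o Z) W \<cdot> (Assoc C X Y Z \<ltimes> W)"
  let ?m = "(Y \<rtimes> Assoc C Z X W) \<cdot> (Assoc C Y (Z \<otimes>\<^sub>o X) W \<cdot>
      (((Y \<rtimes> c X Z) \<cdot> Assoc C Y X Z \<cdot> (c X Y \<ltimes> Z)) \<ltimes> W))"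
  have "?L \<cdot> ?P = Assoc C Y Z (X \<otimes>\<^sub>o W) \<cdot> ((swap X (Y \<otimes>\<^sub>o Z) W \<cdot> Assoc C X (Y \<otimes>\<^sub>o Z) W) \<cdot> (Assoc C X Y Z \<ltimes> W))"
    by simp
  also have "\<dots> = (Assoc C Y Z (X \<otimes>\<^sub>o W) \<cdot> Assoc C (Y \<otimes>\<^sub>o Z) X W) \<cdot>
      ((c X (Y \<otimes>\<^sub>o Z) \<ltimes> W) \<cdot> (Assoc C X Y Z \<ltimes> W))"
    by (subst swap_assoc) simp_all
  also have "\<dots> = (Y \<rtimes> Assoc C Z X W) \<cdot> (Assoc C Y (Z \<otimes>\<^sub>o X) W \<cdot>
      ((Assoc C Y Z X \<cdot> c X (Y \<otimes>\<^sub>o Z) \<cdot> Assoc C X Y Z) \<ltimes> W))"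
    by (subst pentagon) (simp_all add: whisker_comp)
  also have "\<dots> = ?m" by (subst hexagon1) simp_all
  finally have L: "?L \<cdot> ?P = ?m" .
  have n1: "Assoc C Y (Z \<otimes>\<^sub>o X) W \<cdot> (Y \<rtimes> c X Z \<ltimes> W)
    = (Y \<rtimes> (c X Z \<ltimes> W)) \<cdot> Assoc C Y (X \<otimes>\<^sub>o Z) W"
    using assoc_nat[of "Idn C Y" "c X Z" "Idn C W"] by simp
  have n2: "(c X Y \<ltimes> (Z \<otimes>\<^sub>o W)) \<cdot> Assoc C (X \<otimes>\<^sub>o Y) Z W
    = Assoc C (Y \<otimes>\<^sub>o X) Z W \<cdot> (c X Y \<ltimes> Z \<ltimes> W)"
    using assoc_nat[of "c X Y" "Idn C Z" "Idn C W"] by simp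
  have n3: "(Y \<rtimes> swap X Z W) \<cdot> (Y \<rtimes> Assoc C X Z W)
    = (Y \<rtimes> Assoc C Z X W) \<cdot> (Y \<rtimes> (c X Z \<ltimes> W))"
    using swap_assoc[of X Z W] by (simp add: tensor_comp_arr)
  have "?R \<cdot> ?P = (Y \<rtimes> swap X Z W) \<cdot> (swap X Y (Z \<otimes>\<^sub>o W) \<cdot>
      ((X \<rtimes> Assoc C Y Z W) \<cdot> Assoc C X (Y \<otimes>\<^sub>o Z) W \<cdot> (Assoc C X Y Z \<ltimes> W)))"
    by simp
  also have "\<dots> = (Y \<rtimes> swap X Z W) \<cdot> (swap X Y (Z \<otimes>\<^sub>o W) \<cdot>
      (Assoc C X Y (Z \<otimes>\<^sub>o W) \<cdot> Assoc C (X \<otimes>\<^sub>o Y) Z W))"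
    by (subst pentagon) simp_all
  also have "\<dots> = (Y \<rtimes> swap X Z W) \<cdot> ((swap X Y (Z \<otimes>\<^sub>o W) \<cdot>
      Assoc C X Y (Z \<otimes>\<^sub>o W)) \<cdot> Assoc C (X \<otimes>\<^sub>o Y) Z W)"
    by simp
  also have "\<dots> = (Y \<rtimes> swap X Z W) \<cdot> (Assoc C Y X (Z \<otimes>\<^sub>o W) \<cdot>
      ((c X Y \<ltimes> (Z \<otimes>\<^sub>o W)) \<cdot> Assoc C (X \<otimes>\<^sub>o Y) Z W))"
    by (subst swap_assoc) simp_all
  also have "\<dots> = (Y \<rtimes> swap X Z W) \<cdot> ((Assoc C Y X (Z \<otimes>\<^sub>o W) \<cdot>
      Assoc C (Y \<otimes>\<^sub>o X) Z W) \<cdot> (c X Y \<ltimes> Z \<ltimes> W))"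
    unfolding n2 by simp
  also have "\<dots> = ((Y \<rtimes> swap X Z W) \<cdot> (Y \<rtimes> Assoc C X Z W)) \<cdot> (Assoc C Y (X \<otimes>\<^sub>o Z) W \<cdot>
      ((Assoc C Y X Z \<ltimes> W) \<cdot> (c X Y \<ltimes> Z \<ltimes> W)))"
    by (subst pentagon) simp_all
  also have "\<dots> = (Y \<rtimes> Assoc C Z X W) \<cdot> (((Y \<rtimes> (c X Z \<ltimes> W)) \<cdot> Assoc C Y (X \<otimes>\<^sub>o Z) W) \<cdot>
      ((Assoc C Y X Z \<ltimes> W) \<cdot> (c X Y \<ltimes> Z \<ltimes> W)))"
    unfolding n3 by simp
  also have "\<dots> = ?m" unfolding n1[symmetric] by (simp add: whisker_comp)
  finally have "?L \<cdot> ?P = ?R \<cdot> ?P" using L by simp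
  then show ?thesis by (rule iso_cancel_right[rotated]) simp_all
qed

lemma swap_hexagon2:
  assumes O: "X \<in> Obj C" "Y \<in> Obj C" "Z \<in> Obj C" "W \<in> Obj C"
  shows "(Z \<rtimes> Assoc C X Y W) \<cdot> swap (X \<otimes>\<^sub>o Y) Z W
    = swap X Z (Y \<otimes>\<^sub>o W) \<cdot> (X \<rtimes> swap Y Z W) \<cdot> Assoc C X Y (Z \<otimes>\<^sub>o W)" (is "?L = ?R")
proof -
  note [simp] = O
  let ?i = "inv_arr C (Assoc C X Y Z) \<ltimes> W"
  let ?P = "Assoc C (X \<otimes>\<^sub>o Y) Z W \<cdot> ?i"
  let ?m = "Assoc C Z X (Y \<otimes>\<^sub>o W) \<cdot> (Assoc C (Z \<otimes>\<^sub>o X) Y W \<cdot>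
     (((c X Z \<ltimes> Y) \<cdot> inv_arr C (Assoc C X Z Y) \<cdot> (X \<rtimes> c Y Z)) \<ltimes> W))"
  have "?L \<cdot> ?P = (Z \<rtimes> Assoc C X Y W) \<cdot> ((swap (X \<otimes>\<^sub>o Y) Z W \<cdot> Assoc C (X \<otimes>\<^sub>o Y) Z W) \<cdot> ?i)"
    by simp
  also have "\<dots> = ((Z \<rtimes> Assoc C X Y W) \<cdot> Assoc C Z (X \<otimes>\<^sub>o Y) W) \<cdot> ((c (X \<otimes>\<^sub>o Y) Z \<ltimes> W) \<cdot> ?i)"
    by (subst swap_assoc) simp_all
  also have "\<dots> = Assoc C Z X (Y \<otimes>\<^sub>o W) \<cdot> (Assoc C (Z \<otimes>\<^sub>o X) Y W \<cdot>
      ((inv_arr C (Assoc C Z X Y) \<cdot> c (X \<otimes>\<^sub>o Y) Z \<cdot> inv_arr C (Assoc C X Y Z)) \<ltimes> W))"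
    by (subst pentagon_inv) (simp_all add: whisker_comp)
  also have "\<dots> = ?m" by (subst hexagon2) simp_all
  finally have L: "?L \<cdot> ?P = ?m" .
  have n1: "Assoc C X (Z \<otimes>\<^sub>o Y) W \<cdot> (X \<rtimes> c Y Z \<ltimes> W)
    = (X \<rtimes> (c Y Z \<ltimes> W)) \<cdot> Assoc C X (Y \<otimes>\<^sub>o Z) W"
    using assoc_nat[of "Idn C X" "c Y Z" "Idn C W"] by simp
  have n2: "(c X Z \<ltimes> (Y \<otimes>\<^sub>o W)) \<cdot> Assoc C (X \<otimes>\<^sub>o Z) Y W
    = Assoc C (Z \<otimes>\<^sub>o X) Y W \<cdot> (c X Z \<ltimes> Y \<ltimes> W)"
    using assoc_nat[of "c X Z" "Idn C Y" "Idn C W"] by simp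
  have n3: "(X \<rtimes> swap Y Z W) \<cdot> (X \<rtimes> Assoc C Y Z W)
    = (X \<rtimes> Assoc C Z Y W) \<cdot> (X \<rtimes> (c Y Z \<ltimes> W))"
    using swap_assoc[of Y Z W] by (simp add: tensor_comp_arr)
  have "?R \<cdot> ?P = swap X Z (Y \<otimes>\<^sub>o W) \<cdot> ((X \<rtimes> swap Y Z W) \<cdot>
      (Assoc C X Y (Z \<otimes>\<^sub>o W) \<cdot> Assoc C (X \<otimes>\<^sub>o Y) Z W \<cdot> ?i))"
    by simp
  also have "\<dots> = swap X Z (Y \<otimes>\<^sub>o W) \<cdot> (((X \<rtimes> swap Y Z W) \<cdot>
      (X \<rtimes> Assoc C Y Z W)) \<cdot> Assoc C X (Y \<otimes>\<^sub>o Z) W)"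
    by (subst pentagon_inv[symmetric]) simp_all
  also have "\<dots> = swap X Z (Y \<otimes>\<^sub>o W) \<cdot> ((X \<rtimes> Assoc C Z Y W) \<cdot>
      ((X \<rtimes> (c Y Z \<ltimes> W)) \<cdot> Assoc C X (Y \<otimes>\<^sub>o Z) W))"
    unfolding n3 by simp
  also have "\<dots> = swap X Z (Y \<otimes>\<^sub>o W) \<cdot> (((X \<rtimes> Assoc C Z Y W) \<cdot>
      Assoc C X (Z \<otimes>\<^sub>o Y) W) \<cdot> (X \<rtimes> c Y Z \<ltimes> W))"
    unfolding n1[symmetric] by simp
  also have "\<dots> = (swap X Z (Y \<otimes>\<^sub>o W) \<cdot> Assoc C X Z (Y \<otimes>\<^sub>o W)) \<cdot> (Assoc C (X \<otimes>\<^sub>o Z) Y W \<cdot>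
      ((inv_arr C (Assoc C X Z Y) \<ltimes> W) \<cdot> (X \<rtimes> c Y Z \<ltimes> W)))"
    by (subst pentagon_inv) simp_all
  also have "\<dots> = Assoc C Z X (Y \<otimes>\<^sub>o W) \<cdot> (((c X Z \<ltimes> (Y \<otimes>\<^sub>o W)) \<cdot> Assoc C (X \<otimes>\<^sub>o Z) Y W) \<cdot>
      ((inv_arr C (Assoc C X Z Y) \<ltimes> W) \<cdot> (X \<rtimes> c Y Z \<ltimes> W)))"
    by (subst swap_assoc) simp_all
  also have "\<dots> = ?m" unfolding n2 by (simp add: whisker_comp)
  finally have "?L \<cdot> ?P = ?R \<cdot> ?P" using L by simp
  then show ?thesis by (rule iso_cancel_right[rotated]) simp_all
qed

text \<open>
  Sliding an arrow \<open>f : g \<otimes> X \<rightarrow> Z\<close> through a strand \<open>T\<close>: naturality moves \<open>f\<close> across the braiding of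
  \<open>T\<close> with \<open>g \<otimes> X\<close>, and a hexagon splits that braiding into the braidings with \<open>g\<close> and \<open>X\<close>.
\<close>

lemma slide_right:
  assumes f: "f \<in> mor C (g \<otimes>\<^sub>o X) Z" and O: "g \<in> Obj C" "X \<in> Obj C" "T \<in> Obj C" "W \<in> Obj C"
  shows "swap T Z W \<cdot> (T \<rtimes> contract f g X W)
    = contract f g X (T \<otimes>\<^sub>o W) \<cdot> (g \<rtimes> swap T X W) \<cdot> swap T g (X \<otimes>\<^sub>o W)"
proof -
  have ZO: "Z \<in> Obj C" using f mor_obj by auto
  note [simp] = O ZO f[unfolded mor_iff]
  have "swap T Z W \<cdot> (T \<rtimes> contract f g X W)
    = (swap T Z W \<cdot> (T \<rtimes> (f \<ltimes> W))) \<cdot> (T \<rtimes> inv_arr C (Assoc C g X W))"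
    by (simp add: contract_def whisker_comp)
  also have "\<dots> = ((f \<ltimes> (T \<otimes>\<^sub>o W)) \<cdot> swap T (g \<otimes>\<^sub>o X) W) \<cdot> (T \<rtimes> inv_arr C (Assoc C g X W))"
    by (subst swap_nat_right[OF f]) simp_all
  also have "\<dots> = contract f g X (T \<otimes>\<^sub>o W) \<cdot> ((Assoc C g X (T \<otimes>\<^sub>o W) \<cdot> swap T (g \<otimes>\<^sub>o X) W) \<cdot> (T \<rtimes> inv_arr C (Assoc C g X W)))"
    by (simp add: contract_def)
  also have "\<dots> = contract f g X (T \<otimes>\<^sub>o W) \<cdot> ((g \<rtimes> swap T X W) \<cdot> (swap T g (X \<otimes>\<^sub>o W) \<cdot>
     ((T \<rtimes> Assoc C g X W) \<cdot> (T \<rtimes> inv_arr C (Assoc C g X W)))))"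
    by (subst swap_hexagon1) simp_all
  also have "\<dots> = contract f g X (T \<otimes>\<^sub>o W) \<cdot> (g \<rtimes> swap T X W) \<cdot> swap T g (X \<otimes>\<^sub>o W)"
    by (simp add: tensor_comp_arr)
  finally show ?thesis .
qed

lemma slide_left:
  assumes f: "f \<in> mor C (g \<otimes>\<^sub>o X) Z" and O: "g \<in> Obj C" "X \<in> Obj C" "T \<in> Obj C" "W \<in> Obj C"
  shows "swap Z T W \<cdot> contract f g X (T \<otimes>\<^sub>o W)
    = (T \<rtimes> contract f g X W) \<cdot> swap g T (X \<otimes>\<^sub>o W) \<cdot> (g \<rtimes> swap X T W)"
proof -
  have ZO: "Z \<in> Obj C" using f mor_obj by auto
  note [simp] = O ZO f[unfolded mor_iff]
  have "swap Z T W \<cdot> contract f g X (T \<otimes>\<^sub>o W)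
    = (swap Z T W \<cdot> (f \<ltimes> (T \<otimes>\<^sub>o W))) \<cdot> inv_arr C (Assoc C g X (T \<otimes>\<^sub>o W))"
    by (simp add: contract_def)
  also have "\<dots> = (T \<rtimes> (f \<ltimes> W)) \<cdot> (swap (g \<otimes>\<^sub>o X) T W \<cdot> inv_arr C (Assoc C g X (T \<otimes>\<^sub>o W)))"
    by (subst swap_nat_left[OF f]) simp_all
  also have "\<dots> = (T \<rtimes> (f \<ltimes> W)) \<cdot> (((T \<rtimes> inv_arr C (Assoc C g X W)) \<cdot> (T \<rtimes> Assoc C g X W)) \<cdot>
      (swap (g \<otimes>\<^sub>o X) T W \<cdot> inv_arr C (Assoc C g X (T \<otimes>\<^sub>o W))))"
    by (simp only: whisker_comp(1)[symmetric] tensor_arr assoc_arr inv_arr O tensor_obj) simp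
  also have "\<dots> = (T \<rtimes> contract f g X W) \<cdot> (((T \<rtimes> Assoc C g X W) \<cdot>
      swap (g \<otimes>\<^sub>o X) T W) \<cdot> inv_arr C (Assoc C g X (T \<otimes>\<^sub>o W)))"
    by (simp add: contract_def whisker_comp)
  also have "\<dots> = (T \<rtimes> contract f g X W) \<cdot> swap g T (X \<otimes>\<^sub>o W) \<cdot> (g \<rtimes> swap X T W)"
    by (subst swap_hexagon2) simp_all
  finally show ?thesis .
qed

end

context fusion_category
begin

lemma module_family_simple_scalar:
  assumes X: "simple_obj C X" and f: "module_family [X] [X] \<phi>"
  shows "\<exists>r. \<forall>W \<in> Obj C. \<phi> W = r *\<^sub>a Idn C (X \<otimes>\<^sub>o W)"
proof -
  have XO [simp]: "X \<in> Obj C" using simple_objD[OF X] by simp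
  have id: "module_family [X] [X] (\<lambda>W. Idn C (X \<otimes>\<^sub>o W))" by (rule module_familyI) simp_all
  have "simple_obj C (X \<otimes>\<^sub>o \<I>)" by (rule simple_obj_isomorphic[OF X isomorphic_unit(2)[OF XO]])
  moreover have "\<phi> \<I> \<in> mor C (X \<otimes>\<^sub>o \<I>) (X \<otimes>\<^sub>o \<I>)" using module_familyD(1-3)[OF f, of \<I>] by (simp add: mor_iff)
  ultimately obtain r where r: "\<phi> \<I> = r *\<^sub>a Idn C (X \<otimes>\<^sub>o \<I>)" using simple_end_scalar by blast
  have "\<phi> W = r *\<^sub>a Idn C (X \<otimes>\<^sub>o W)" if "W \<in> Obj C" for W
    by (rule module_family_eqI[OF _ _ f module_family_scale[OF _ _ id] r that]) simp_all
  then show ?thesis by blast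
qed

lemma module_family_commute:
  assumes O: "X \<in> Obj C" "Y \<in> Obj C"
    and comm: "\<And>p q. p \<in> mor C (X \<otimes>\<^sub>o Y) (X \<otimes>\<^sub>o Y) \<Longrightarrow> q \<in> mor C (X \<otimes>\<^sub>o Y) (X \<otimes>\<^sub>o Y) \<Longrightarrow> p \<cdot> q = q \<cdot> p"
    and f: "module_family [X, Y] [X, Y] \<phi>" and g: "module_family [X, Y] [X, Y] \<psi>" and W: "W \<in> Obj C"
  shows "\<phi> W \<cdot> \<psi> W = \<psi> W \<cdot> \<phi> W"
proof (rule module_family_eqI[OF _ _ module_family_comp[OF _ _ _ g f] module_family_comp[OF _ _ _ f g] _ W])
  note [simp] = O module_familyD(1-3)[OF f] module_familyD(1-3)[OF g]
  obtain j where j [simp]: "iso_arr C j" "j \<in> Arr C" "Dom C j = X \<otimes>\<^sub>o (Y \<otimes>\<^sub>o \<I>)" "Cod C j = X \<otimes>\<^sub>o Y"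
    using isomorphic_unit_mid(1)[OF O] by (auto simp: isomorphic_def mor_iff)
  let ?p = "j \<cdot> (\<phi> \<I> \<cdot> inv_arr C j)" and ?q = "j \<cdot> (\<psi> \<I> \<cdot> inv_arr C j)"
  have "inv_arr C j \<cdot> ((?p \<cdot> ?q) \<cdot> j) = inv_arr C j \<cdot> ((?q \<cdot> ?p) \<cdot> j)"
    by (subst comm[of ?p ?q]) (simp_all add: mor_iff)
  then show "\<phi> \<I> \<cdot> \<psi> \<I> = \<psi> \<I> \<cdot> \<phi> \<I>" by simp
qed (use O in simp_all)

text \<open>
  A nonzero pairing of \<open>Y\<close> with \<open>X\<close> exists by duality, and it splits because \<open>\<I>\<close> is simple.  The
  section makes it possible to cancel a strand \<open>X\<close>; it is not the coevaluation, so no dimension of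
  \<open>X\<close> appears.
\<close>

lemma dual_section:
  assumes X: "simple_obj C X" and dual: "left_dual C X Y"
  obtains ev t where "ev \<in> mor C (Y \<otimes>\<^sub>o X) \<I>" "t \<in> mor C \<I> (Y \<otimes>\<^sub>o X)" "ev \<cdot> t = Idn C \<I>"
proof -
  have O: "X \<in> Obj C" "Y \<in> Obj C" using dual by (auto simp: left_dual_def)
  have "hom_embeds X X X (X \<otimes>\<^sub>o \<I>)"
    by (rule hom_embeds_isomorphic) (simp_all add: isomorphic_refl isomorphic_unit[THEN isomorphic_sym] O)
  also have "hom_embeds X (X \<otimes>\<^sub>o \<I>) (Y \<otimes>\<^sub>o X) \<I>" by (rule hom_embeds_eval_left[OF dual]) (simp_all add: O)
  finally obtain ev where ev: "ev \<in> mor C (Y \<otimes>\<^sub>o X) \<I>" "ev \<noteq> ZeroArr C (Y \<otimes>\<^sub>o X) \<I>"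
    using hom_embeds_nonzero[of X X _ _ "Idn C X"] simple_objD[OF X] id_mor by blast
  then obtain t where "t \<in> mor C \<I> (Y \<otimes>\<^sub>o X)" "ev \<cdot> t = Idn C \<I>"
    using nonzero_to_simple_split[OF unit_simple] by blast
  then show thesis using that ev by blast
qed

end

section \<open>Objects fixing a simple object by tensoring have order two\<close>

context braided_fusion_category
begin

context
  fixes g X f
  assumes g: "g \<in> Obj C" and X: "simple_obj C X"
    and f: "f \<in> mor C (g \<otimes>\<^sub>o X) X" and f_iso: "iso_arr C f"
begin

text \<open>
  In terms of functors, \<open>absorb_first\<close> and \<open>absorb_second\<close> are the two ways in which \<open>X \<otimes> X\<close> absorbs
  \<open>g\<close>: \<open>g\<close> is either applied directly to the first factor, or braided past it and applied to the second.
\<close>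

abbreviation "absorb \<equiv> contract f g X"
abbreviation "absorb_first W \<equiv> absorb (X \<otimes>\<^sub>o W)"
abbreviation "absorb_second W \<equiv> (X \<rtimes> absorb W) \<cdot> swap g X (X \<otimes>\<^sub>o W)"
abbreviation "absorb_twice W \<equiv> absorb W \<cdot> (g \<rtimes> absorb W)"

lemma fixed_obj: "X \<in> Obj C" using simple_objD[OF X] by simp

lemma fixed_simps:
  "g \<in> Obj C" "X \<in> Obj C" "f \<in> Arr C" "Dom C f = g \<otimes>\<^sub>o X" "Cod C f = X" "iso_arr C f"
  "W \<in> Obj C \<Longrightarrow> iso_arr C (absorb W)"
  using f f_iso g fixed_obj by (simp_all add: mor_iff contract_def)

lemma absorb_family: "module_family [g, X] [X] absorb"
  by (rule module_family_contract) (simp_all add: f g fixed_obj)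

lemma absorb_natural:
  assumes "h \<in> Arr C" "Dom C h = V" "Cod C h = V'"
  shows "absorb V' \<cdot> (g \<rtimes> (X \<rtimes> h)) = (X \<rtimes> h) \<cdot> absorb V"
  using module_familyD(4)[OF absorb_family, of h] assms by simp

lemma absorb_twice_family: "module_family [g, g, X] [X] absorb_twice"
  by (rule module_family_comp[OF _ _ _ module_family_left[OF _ _ _ absorb_family] absorb_family])
    (simp_all add: g fixed_obj)

text \<open>
  Conjugating the double braiding of \<open>g\<close> with \<open>X\<close> by \<open>f\<close> gives an endomorphism of the simple object \<open>X\<close>.
\<close>

lemma monodromy_scalar:
  "\<exists>\<chi>. \<forall>W \<in> Obj C. swap X g W \<cdot> swap g X W = \<chi> *\<^sub>a Idn C (g \<otimes>\<^sub>o (X \<otimes>\<^sub>o W))"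
proof -
  note [simp] = fixed_simps
  have m1: "module_family [X] [g, X] (\<lambda>W. inv_arr C (absorb W))"
    by (rule module_family_inv[OF _ _ absorb_family]) simp_all
  have m2: "module_family [X] [X, g] (\<lambda>W. swap g X W \<cdot> inv_arr C (absorb W))"
    by (rule module_family_comp[OF _ _ _ m1 swap_family]) simp_all
  have m3: "module_family [X] [g, X] (\<lambda>W. swap X g W \<cdot> (swap g X W \<cdot> inv_arr C (absorb W)))"
    by (rule module_family_comp[OF _ _ _ m2 swap_family]) simp_all
  have "module_family [X] [X] (\<lambda>W. absorb W \<cdot> (swap X g W \<cdot> (swap g X W \<cdot> inv_arr C (absorb W))))"
    by (rule module_family_comp[OF _ _ _ m3 absorb_family]) simp_all
  then obtain \<chi> where \<chi>: "\<And>W. W \<in> Obj C \<Longrightarrow>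
      absorb W \<cdot> (swap X g W \<cdot> (swap g X W \<cdot> inv_arr C (absorb W))) = \<chi> *\<^sub>a Idn C (X \<otimes>\<^sub>o W)"
    using module_family_simple_scalar[OF X] by blast
  have "swap X g W \<cdot> swap g X W = \<chi> *\<^sub>a Idn C (g \<otimes>\<^sub>o (X \<otimes>\<^sub>o W))" if [simp]: "W \<in> Obj C" for W
  proof -
    have "swap X g W \<cdot> swap g X W
      = inv_arr C (absorb W) \<cdot> ((absorb W \<cdot> (swap X g W \<cdot> (swap g X W \<cdot> inv_arr C (absorb W)))) \<cdot> absorb W)" by simp
    also have "\<dots> = \<chi> *\<^sub>a Idn C (g \<otimes>\<^sub>o (X \<otimes>\<^sub>o W))" unfolding \<chi>[OF that] by simp
    finally show ?thesis .
  qed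
  then show ?thesis by blast
qed

text \<open>
  The braiding of \<open>g\<close> with itself acts on \<open>g \<otimes> g \<otimes> X\<close>, which is isomorphic to the simple object \<open>X\<close>.
  The scalar is attached to the inverse so that it never has to be divided by.
\<close>

lemma self_braiding_scalar:
  "\<exists>k. \<forall>W \<in> Obj C. inv_arr C (swap g g (X \<otimes>\<^sub>o W)) = k *\<^sub>a Idn C (g \<otimes>\<^sub>o (g \<otimes>\<^sub>o (X \<otimes>\<^sub>o W)))"
proof -
  note [simp] = fixed_simps
  have m0: "module_family [g, g, X] [g, g, X] (\<lambda>W. swap g g (X \<otimes>\<^sub>o W))"
    using module_family_right[OF _ _ _ swap_family[of g g], of "[X]"] by simp
  have m1: "module_family [g, g, X] [g, g, X] (\<lambda>W. inv_arr C (swap g g (X \<otimes>\<^sub>o W)))"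
    by (rule module_family_inv[OF _ _ m0]) simp_all
  have m2: "module_family [X] [g, g, X] (\<lambda>W. inv_arr C (absorb_twice W))"
    by (rule module_family_inv[OF _ _ absorb_twice_family]) simp_all
  have m3: "module_family [X] [g, g, X] (\<lambda>W. inv_arr C (swap g g (X \<otimes>\<^sub>o W)) \<cdot> inv_arr C (absorb_twice W))"
    by (rule module_family_comp[OF _ _ _ m2 m1]) simp_all
  have "module_family [X] [X] (\<lambda>W. absorb_twice W \<cdot> (inv_arr C (swap g g (X \<otimes>\<^sub>o W)) \<cdot> inv_arr C (absorb_twice W)))"
    by (rule module_family_comp[OF _ _ _ m3 absorb_twice_family]) simp_all
  then obtain k where k: "\<And>W. W \<in> Obj C \<Longrightarrow>
      absorb_twice W \<cdot> (inv_arr C (swap g g (X \<otimes>\<^sub>o W)) \<cdot> inv_arr C (absorb_twice W)) = k *\<^sub>a Idn C (X \<otimes>\<^sub>o W)"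
    using module_family_simple_scalar[OF X] by blast
  have "inv_arr C (swap g g (X \<otimes>\<^sub>o W)) = k *\<^sub>a Idn C (g \<otimes>\<^sub>o (g \<otimes>\<^sub>o (X \<otimes>\<^sub>o W)))" if [simp]: "W \<in> Obj C" for W
  proof -
    let ?Q = "absorb_twice W"
    have absorb_twice: "?Q \<in> Arr C" "Dom C ?Q = g \<otimes>\<^sub>o (g \<otimes>\<^sub>o (X \<otimes>\<^sub>o W))" "Cod C ?Q = X \<otimes>\<^sub>o W" "iso_arr C ?Q" by simp_all
    have "inv_arr C (swap g g (X \<otimes>\<^sub>o W))
      = inv_arr C q \<cdot> ((q \<cdot> (inv_arr C (swap g g (X \<otimes>\<^sub>o W)) \<cdot> inv_arr C q)) \<cdot> q)" if "q = ?Q" for q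
      using absorb_twice unfolding that[symmetric] by simp
    then have "inv_arr C (swap g g (X \<otimes>\<^sub>o W))
      = inv_arr C ?Q \<cdot> ((?Q \<cdot> (inv_arr C (swap g g (X \<otimes>\<^sub>o W)) \<cdot> inv_arr C ?Q)) \<cdot> ?Q)" by blast
    also have "\<dots> = inv_arr C ?Q \<cdot> ((k *\<^sub>a Idn C (X \<otimes>\<^sub>o W)) \<cdot> ?Q)" by (simp only: k[OF that])
    also have "\<dots> = k *\<^sub>a (inv_arr C ?Q \<cdot> ?Q)" using absorb_twice(4) by simp
    also have "\<dots> = k *\<^sub>a Idn C (g \<otimes>\<^sub>o (g \<otimes>\<^sub>o (X \<otimes>\<^sub>o W)))" by (simp only: inv_arr(4)[OF absorb_twice(4)] absorb_twice(2))
    finally show ?thesis .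
  qed
  then show ?thesis by blast
qed

text \<open>
  Braiding the two copies of \<open>X\<close> exchanges the two ways of absorbing \<open>g\<close>, here literally, and in the
  next lemma up to a double braiding of \<open>g\<close> with \<open>X\<close>.
\<close>

lemma braid_absorb_first:
  assumes "W \<in> Obj C"
  shows "swap X X W \<cdot> absorb_first W = absorb_second W \<cdot> (g \<rtimes> swap X X W)"
  using slide_left[OF f g fixed_obj fixed_obj assms] assms fixed_simps by simp

lemma braid_absorb_second:
  assumes W: "W \<in> Obj C" and \<chi>: "\<And>W. W \<in> Obj C \<Longrightarrow> swap X g W \<cdot> swap g X W = \<chi> *\<^sub>a Idn C (g \<otimes>\<^sub>o (X \<otimes>\<^sub>o W))"
  shows "swap X X W \<cdot> absorb_second W = \<chi> *\<^sub>a (absorb_first W \<cdot> (g \<rtimes> swap X X W))"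
proof -
  note [simp] = fixed_simps W
  have "swap X X W \<cdot> absorb_second W = (swap X X W \<cdot> (X \<rtimes> absorb W)) \<cdot> swap g X (X \<otimes>\<^sub>o W)" by simp
  also have "\<dots> = absorb_first W \<cdot> ((g \<rtimes> swap X X W) \<cdot> (swap X g (X \<otimes>\<^sub>o W) \<cdot> swap g X (X \<otimes>\<^sub>o W)))"
    by (subst slide_right[OF f]) simp_all
  also have "\<dots> = \<chi> *\<^sub>a (absorb_first W \<cdot> (g \<rtimes> swap X X W))" by (subst \<chi>) simp_all
  finally show ?thesis .
qed

text \<open>
  Absorbing one \<open>g\<close> in each factor: the two orders differ by the braiding of \<open>g\<close> with itself.
\<close>

lemma absorb_exchange:
  assumes W: "W \<in> Obj C"
    and k: "\<And>W. W \<in> Obj C \<Longrightarrow> inv_arr C (swap g g (X \<otimes>\<^sub>o W)) = k *\<^sub>a Idn C (g \<otimes>\<^sub>o (g \<otimes>\<^sub>o (X \<otimes>\<^sub>o W)))"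
  shows "absorb_first W \<cdot> (g \<rtimes> absorb_second W) = k *\<^sub>a (absorb_second W \<cdot> (g \<rtimes> absorb_first W))"
proof -
  note [simp] = fixed_simps W
  let ?s = "swap g g (X \<otimes>\<^sub>o (X \<otimes>\<^sub>o W))"
  have "absorb_second W \<cdot> (g \<rtimes> absorb_first W)
    = (X \<rtimes> absorb W) \<cdot> (swap g X (X \<otimes>\<^sub>o W) \<cdot> (g \<rtimes> absorb_first W))" by simp
  also have "\<dots> = ((X \<rtimes> absorb W) \<cdot> absorb (g \<otimes>\<^sub>o (X \<otimes>\<^sub>o W))) \<cdot> ((g \<rtimes> swap g X (X \<otimes>\<^sub>o W)) \<cdot> ?s)"
    by (subst slide_right[OF f]) simp_all
  also have "\<dots> = absorb_first W \<cdot> ((g \<rtimes> absorb_second W) \<cdot> ?s)"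
    using absorb_natural[of "absorb W" "g \<otimes>\<^sub>o (X \<otimes>\<^sub>o W)" "X \<otimes>\<^sub>o W", symmetric] by (simp add: whisker_comp)
  finally have "(absorb_second W \<cdot> (g \<rtimes> absorb_first W)) \<cdot> inv_arr C ?s = absorb_first W \<cdot> (g \<rtimes> absorb_second W)" by simp
  then show ?thesis by (subst (asm) k) simp_all
qed

text \<open>
  Write \<open>S = E T\<close>.  The exchange of \<open>S\<close> and \<open>T\<close> under the braiding \<open>b\<close> gives \<open>E b E = \<chi> b\<close>, so \<open>E\<^sup>2 = \<chi>\<close>
  when \<open>E\<close> and \<open>b\<close> commute.  Then \<open>S (g \<otimes> S) = E T (g \<otimes> S) = k E S (g \<otimes> T) = k E\<^sup>2 T (g \<otimes> T)\<close>,
  where \<open>k\<close> is the scalar by which the exchange of \<open>S\<close> and \<open>T\<close> fails.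
\<close>

lemma absorb_second_twice:
  assumes comm: "\<And>p q. p \<in> mor C (X \<otimes>\<^sub>o X) (X \<otimes>\<^sub>o X) \<Longrightarrow> q \<in> mor C (X \<otimes>\<^sub>o X) (X \<otimes>\<^sub>o X) \<Longrightarrow> p \<cdot> q = q \<cdot> p"
  shows "\<exists>K. \<forall>W \<in> Obj C. absorb_second W \<cdot> (g \<rtimes> absorb_second W) = K *\<^sub>a (absorb_first W \<cdot> (g \<rtimes> absorb_first W))"
proof -
  note [simp] = fixed_simps
  obtain \<chi> where \<chi>: "\<And>W. W \<in> Obj C \<Longrightarrow> swap X g W \<cdot> swap g X W = \<chi> *\<^sub>a Idn C (g \<otimes>\<^sub>o (X \<otimes>\<^sub>o W))"
    using monodromy_scalar by blast
  obtain k where k: "\<And>W. W \<in> Obj C \<Longrightarrow> inv_arr C (swap g g (X \<otimes>\<^sub>o W)) = k *\<^sub>a Idn C (g \<otimes>\<^sub>o (g \<otimes>\<^sub>o (X \<otimes>\<^sub>o W)))"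
    using self_braiding_scalar by blast
  have absorb_first_family: "module_family [g, X, X] [X, X] absorb_first"
    using module_family_right[OF _ _ _ absorb_family, of "[X]"] by simp
  have m1: "module_family [X, X] [g, X, X] (\<lambda>W. inv_arr C (absorb_first W))"
    by (rule module_family_inv[OF _ _ absorb_first_family]) simp_all
  have m2: "module_family [g, X, X] [X, g, X] (\<lambda>W. swap g X (X \<otimes>\<^sub>o W))"
    using module_family_right[OF _ _ _ swap_family[of g X], of "[X]"] by simp
  have m3: "module_family [X, g, X] [X, X] (\<lambda>W. X \<rtimes> absorb W)"
    by (rule module_family_left[OF _ _ _ absorb_family]) simp_all
  have m4: "module_family [g, X, X] [X, X] absorb_second" by (rule module_family_comp[OF _ _ _ m2 m3]) simp_all
  have E_family: "module_family [X, X] [X, X] (\<lambda>W. absorb_second W \<cdot> inv_arr C (absorb_first W))"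
    by (rule module_family_comp[OF _ _ _ m1 m4]) simp_all
  have "absorb_second W \<cdot> (g \<rtimes> absorb_second W) = (k * \<chi>) *\<^sub>a (absorb_first W \<cdot> (g \<rtimes> absorb_first W))" if W [simp]: "W \<in> Obj C" for W
  proof -
    define t s b E where "t = absorb_first W" and "s = absorb_second W" and "b = swap X X W" and "E = s \<cdot> inv_arr C t"
    have arr [simp]: "t \<in> Arr C" "Dom C t = g \<otimes>\<^sub>o (X \<otimes>\<^sub>o (X \<otimes>\<^sub>o W))" "Cod C t = X \<otimes>\<^sub>o (X \<otimes>\<^sub>o W)" "iso_arr C t"
      "s \<in> Arr C" "Dom C s = g \<otimes>\<^sub>o (X \<otimes>\<^sub>o (X \<otimes>\<^sub>o W))" "Cod C s = X \<otimes>\<^sub>o (X \<otimes>\<^sub>o W)"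
      "b \<in> Arr C" "Dom C b = X \<otimes>\<^sub>o (X \<otimes>\<^sub>o W)" "Cod C b = X \<otimes>\<^sub>o (X \<otimes>\<^sub>o W)" "iso_arr C b"
      by (simp_all add: t_def s_def b_def)
    have Ea [simp]: "E \<in> Arr C" "Dom C E = X \<otimes>\<^sub>o (X \<otimes>\<^sub>o W)" "Cod C E = X \<otimes>\<^sub>o (X \<otimes>\<^sub>o W)"
      by (simp_all add: E_def)
    have s: "s = E \<cdot> t" by (simp add: E_def)
    have bt: "b \<cdot> t = s \<cdot> (g \<rtimes> b)" unfolding t_def s_def b_def by (rule braid_absorb_first[OF W])
    have bs: "b \<cdot> s = \<chi> *\<^sub>a (t \<cdot> (g \<rtimes> b))" unfolding t_def s_def b_def by (rule braid_absorb_second[OF W \<chi>])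
    have ts: "t \<cdot> (g \<rtimes> s) = k *\<^sub>a (s \<cdot> (g \<rtimes> t))"
      unfolding t_def s_def by (rule absorb_exchange[OF W k])
    have Eb: "E \<cdot> b = b \<cdot> E" unfolding E_def s_def t_def b_def
      by (rule module_family_commute[OF _ _ comm E_family swap_family]) simp_all
    have "(b \<cdot> (E \<cdot> E)) \<cdot> t = E \<cdot> (b \<cdot> (E \<cdot> t))" using comp_swap[OF Eb, of "E \<cdot> t"] by simp
    also have "\<dots> = \<chi> *\<^sub>a (E \<cdot> (t \<cdot> (g \<rtimes> b)))" unfolding s[symmetric] bs by simp
    also have "\<dots> = \<chi> *\<^sub>a (s \<cdot> (g \<rtimes> b))" unfolding s by simp
    also have "\<dots> = (\<chi> *\<^sub>a b) \<cdot> t" unfolding bt[symmetric] by simp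
    finally have "b \<cdot> (E \<cdot> E) = \<chi> *\<^sub>a b" by (rule iso_cancel_right[rotated]) simp_all
    then have "b \<cdot> (E \<cdot> E) = b \<cdot> (\<chi> *\<^sub>a Idn C (X \<otimes>\<^sub>o (X \<otimes>\<^sub>o W)))" by simp
    then have EE: "E \<cdot> E = \<chi> *\<^sub>a Idn C (X \<otimes>\<^sub>o (X \<otimes>\<^sub>o W))" by (rule iso_cancel_left[rotated]) simp_all
    have "s \<cdot> (g \<rtimes> s) = E \<cdot> (t \<cdot> (g \<rtimes> s))" by (simp add: s)
    also have "\<dots> = k *\<^sub>a ((E \<cdot> E) \<cdot> (t \<cdot> (g \<rtimes> t)))" unfolding ts by (simp add: s)
    also have "\<dots> = (k * \<chi>) *\<^sub>a (t \<cdot> (g \<rtimes> t))" unfolding EE by simp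
    finally show ?thesis unfolding s_def t_def .
  qed
  then show ?thesis by blast
qed

text \<open>
  Interchange rewrites \<open>S (g \<otimes> S)\<close> as the arrow \<open>X \<otimes> q\<close>, where \<open>q\<close> absorbs \<open>g\<close> twice into one copy of \<open>X\<close>,
  preceded by the braiding of the two strands \<open>g\<close> past \<open>X\<close>.  By the previous lemma it is a multiple of
  \<open>q\<close> applied to the first copy of \<open>X\<close>, so \<open>X \<otimes> q\<close> has the form \<open>w \<otimes> X\<close>.  Closing the first strand by a
  pairing with a section turns this into \<open>q = s \<otimes> X\<close> with \<open>s : g \<otimes> g \<rightarrow> \<I>\<close>.
\<close>

lemma fixing_object_order_two:
  assumes comm: "\<And>p q. p \<in> mor C (X \<otimes>\<^sub>o X) (X \<otimes>\<^sub>o X) \<Longrightarrow> q \<in> mor C (X \<otimes>\<^sub>o X) (X \<otimes>\<^sub>o X) \<Longrightarrow> p \<cdot> q = q \<cdot> p"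
  shows "isomorphic C (g \<otimes>\<^sub>o g) \<I>"
proof -
  note [simp] = fixed_simps
  obtain K where K: "\<And>W. W \<in> Obj C \<Longrightarrow> absorb_second W \<cdot> (g \<rtimes> absorb_second W) = K *\<^sub>a (absorb_first W \<cdot> (g \<rtimes> absorb_first W))"
    using absorb_second_twice[OF comm] by blast
  \<comment> \<open>the braiding of both strands \<open>g\<close> past \<open>X\<close>, from \<open>[g, g, X]\<close> to \<open>[X, g, g]\<close>\<close>
  define D where "D W = swap g X (g \<otimes>\<^sub>o W) \<cdot> (g \<rtimes> swap g X W)" for W
  define w where "w W = K *\<^sub>a (absorb_twice W \<cdot> inv_arr C (D W))" for W
  define q where "q W = absorb_twice W" for W
  have q_arr [simp]: "q W \<in> Arr C" "Dom C (q W) = g \<otimes>\<^sub>o (g \<otimes>\<^sub>o (X \<otimes>\<^sub>o W))" "Cod C (q W) = X \<otimes>\<^sub>o W"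
    "iso_arr C (q W)" if "W \<in> Obj C" for W using that by (simp_all add: q_def)
  have D_arr [simp]: "D W \<in> Arr C" "Dom C (D W) = g \<otimes>\<^sub>o (g \<otimes>\<^sub>o (X \<otimes>\<^sub>o W))"
    "Cod C (D W) = X \<otimes>\<^sub>o (g \<otimes>\<^sub>o (g \<otimes>\<^sub>o W))" "iso_arr C (D W)" if "W \<in> Obj C" for W
    using that by (simp_all add: D_def)
  have D1: "module_family [g, g, X] [g, X, g] (\<lambda>W. g \<rtimes> swap g X W)"
    by (rule module_family_left[OF _ _ _ swap_family]) simp_all
  have D2: "module_family [g, X, g] [X, g, g] (\<lambda>W. swap g X (g \<otimes>\<^sub>o W))"
    using module_family_right[OF _ _ _ swap_family[of g X], of "[g]"] by simp
  have D_family: "module_family [g, g, X] [X, g, g] D"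
    unfolding D_def by (rule module_family_comp[OF _ _ _ D1 D2]) simp_all
  have Di: "module_family [X, g, g] [g, g, X] (\<lambda>W. inv_arr C (D W))"
    by (rule module_family_inv[OF _ _ D_family]) simp_all
  have w_family: "module_family [X, g, g] [X] w"
    unfolding w_def
    by (rule module_family_scale[OF _ _ module_family_comp[OF _ _ _ Di absorb_twice_family]]) simp_all
  note w_arr [simp] = module_familyD(1-3)[OF w_family]
  have Qw: "X \<rtimes> q W = w (X \<otimes>\<^sub>o W)" if [simp]: "W \<in> Obj C" for W
  proof -
    have nat: "swap g X (X \<otimes>\<^sub>o W) \<cdot> (g \<rtimes> (X \<rtimes> absorb W))
      = (X \<rtimes> (g \<rtimes> absorb W)) \<cdot> swap g X (g \<otimes>\<^sub>o (X \<otimes>\<^sub>o W))"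
      using module_familyD(4)[OF swap_family[of g X], of "absorb W"] by simp
    have "(X \<rtimes> q W) \<cdot> D (X \<otimes>\<^sub>o W)
      = (X \<rtimes> absorb W) \<cdot> (((X \<rtimes> (g \<rtimes> absorb W)) \<cdot> swap g X (g \<otimes>\<^sub>o (X \<otimes>\<^sub>o W)))
        \<cdot> (g \<rtimes> swap g X (X \<otimes>\<^sub>o W)))"
      by (simp add: q_def D_def whisker_comp)
    also have "\<dots> = absorb_second W \<cdot> (g \<rtimes> absorb_second W)" unfolding nat[symmetric] by (simp add: whisker_comp)
    also have "\<dots> = w (X \<otimes>\<^sub>o W) \<cdot> D (X \<otimes>\<^sub>o W)" unfolding K[OF that] by (simp add: w_def)
    finally show ?thesis by (rule iso_cancel_right[rotated]) simp_all
  qed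
  obtain Y where dual: "left_dual C X Y" using left_duals fixed_obj by blast
  have Y [simp]: "Y \<in> Obj C" using dual by (simp add: left_dual_def)
  obtain ev t where ev: "ev \<in> mor C (Y \<otimes>\<^sub>o X) \<I>" and t: "t \<in> mor C \<I> (Y \<otimes>\<^sub>o X)" and et: "ev \<cdot> t = Idn C \<I>"
    by (rule dual_section[OF X dual]) (rule that)
  note [simp] = ev[unfolded mor_iff] t[unfolded mor_iff]
  \<comment> \<open>natural maps \<open>Y \<otimes> X \<otimes> W \<rightarrow> W\<close> and back with \<open>e \<cdot> h = 1\<close>, which close up a strand \<open>X\<close>\<close>
  define e where "e W = LUnit C W \<cdot> contract ev Y X W" for W
  define h where "h W = expand t Y X W \<cdot> inv_arr C (LUnit C W)" for W
  have e_arr [simp]: "e W \<in> Arr C" "Dom C (e W) = Y \<otimes>\<^sub>o (X \<otimes>\<^sub>o W)" "Cod C (e W) = W" if "W \<in> Obj C" for W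
    using that by (simp_all add: e_def)
  have h_arr [simp]: "h W \<in> Arr C" "Dom C (h W) = W" "Cod C (h W) = Y \<otimes>\<^sub>o (X \<otimes>\<^sub>o W)" if "W \<in> Obj C" for W
    using that by (simp_all add: h_def)
  have lnat: "LUnit C (Cod C p) \<cdot> (\<I> \<rtimes> p) = p \<cdot> LUnit C (Dom C p)" if "p \<in> Arr C" for p
    by (rule lunit_natural) (simp add: mor_iff that)
  have e_nat: "e (Cod C p) \<cdot> (Y \<rtimes> (X \<rtimes> p)) = p \<cdot> e (Dom C p)" if [simp]: "p \<in> Arr C" for p
  proof -
    have fam: "module_family [Y, X] [\<I>] (contract ev Y X)" by (rule module_family_contract) (simp_all add: ev)
    have "e (Cod C p) \<cdot> (Y \<rtimes> (X \<rtimes> p))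
      = LUnit C (Cod C p) \<cdot> ((\<I> \<rtimes> p) \<cdot> contract ev Y X (Dom C p))"
      using module_familyD(4)[OF fam that] by (simp add: e_def)
    also have "\<dots> = p \<cdot> (LUnit C (Dom C p) \<cdot> contract ev Y X (Dom C p))"
      by (rule comp_swap[OF lnat]) simp_all
    finally show ?thesis by (simp add: e_def)
  qed
  have h_nat: "h (Cod C p) \<cdot> p = (Y \<rtimes> (X \<rtimes> p)) \<cdot> h (Dom C p)" if [simp]: "p \<in> Arr C" for p
  proof -
    have fam: "module_family [\<I>] [Y, X] (expand t Y X)" by (rule module_family_expand) (simp_all add: t)
    have "h (Cod C p) \<cdot> p = expand t Y X (Cod C p) \<cdot> (inv_arr C (LUnit C (Cod C p)) \<cdot> ((p \<cdot> LUnit C (Dom C p)) \<cdot> inv_arr C (LUnit C (Dom C p))))"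
      by (simp add: h_def)
    also have "\<dots> = (expand t Y X (Cod C p) \<cdot> (\<I> \<rtimes> p)) \<cdot> inv_arr C (LUnit C (Dom C p))"
      unfolding lnat[OF that, symmetric] by simp
    also have "\<dots> = (Y \<rtimes> (X \<rtimes> p)) \<cdot> h (Dom C p)"
      using module_familyD(4)[OF fam that] by (simp add: h_def)
    finally show ?thesis .
  qed
  have eh: "e W \<cdot> h W = Idn C W" if [simp]: "W \<in> Obj C" for W
  proof -
    have "(ev \<ltimes> W) \<cdot> (t \<ltimes> W) = Idn C (\<I> \<otimes>\<^sub>o W)" using et by (simp add: tensor_comp_arr)
    from comp_cong_left[OF this, of "inv_arr C (LUnit C W)"]
    show ?thesis by (simp add: e_def h_def contract_def expand_def)
  qed
  \<comment> \<open>the partial closure of \<open>w\<close>; it is natural in \<open>W\<close> and agrees with \<open>q\<close> on tails starting with \<open>X\<close>\<close>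
  define s where "s W = e W \<cdot> ((Y \<rtimes> w W) \<cdot> h (g \<otimes>\<^sub>o (g \<otimes>\<^sub>o W)))" for W
  have s_arr [simp]: "s W \<in> Arr C" "Dom C (s W) = g \<otimes>\<^sub>o (g \<otimes>\<^sub>o W)" "Cod C (s W) = W" if "W \<in> Obj C" for W
    using that by (simp_all add: s_def)
  have sq: "s (X \<otimes>\<^sub>o W) = q W" if [simp]: "W \<in> Obj C" for W
  proof -
    have "s (X \<otimes>\<^sub>o W) = e (X \<otimes>\<^sub>o W) \<cdot> ((Y \<rtimes> (X \<rtimes> q W)) \<cdot> h (Dom C (q W)))"
      unfolding Qw[OF that] by (simp add: s_def)
    also have "\<dots> = e (X \<otimes>\<^sub>o W) \<cdot> (h (X \<otimes>\<^sub>o W) \<cdot> q W)" unfolding h_nat[OF q_arr(1)[OF that], symmetric] by simp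
    also have "\<dots> = Idn C (X \<otimes>\<^sub>o W) \<cdot> q W" by (rule comp_cong_left[OF eh]) simp_all
    finally show ?thesis by simp
  qed
  have s_nat: "s (Cod C p) \<cdot> (g \<rtimes> (g \<rtimes> p)) = p \<cdot> s (Dom C p)" if [simp]: "p \<in> Arr C" for p
  proof -
    let ?ggp = "g \<rtimes> (g \<rtimes> p)"
    have 1: "(Y \<rtimes> w (Cod C p)) \<cdot> (Y \<rtimes> (X \<rtimes> ?ggp))
      = (Y \<rtimes> (X \<rtimes> p)) \<cdot> (Y \<rtimes> w (Dom C p))"
      using module_familyD(4)[OF w_family that] by (simp add: tensor_comp_arr)
    have "s (Cod C p) \<cdot> ?ggp = e (Cod C p) \<cdot> ((Y \<rtimes> w (Cod C p)) \<cdot>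
        ((Y \<rtimes> (X \<rtimes> ?ggp)) \<cdot> h (g \<otimes>\<^sub>o (g \<otimes>\<^sub>o Dom C p))))"
      using h_nat[of ?ggp] by (simp add: s_def)
    also have "(Y \<rtimes> w (Cod C p)) \<cdot> ((Y \<rtimes> (X \<rtimes> ?ggp)) \<cdot> h (g \<otimes>\<^sub>o (g \<otimes>\<^sub>o Dom C p)))
      = (Y \<rtimes> (X \<rtimes> p)) \<cdot> ((Y \<rtimes> w (Dom C p)) \<cdot> h (g \<otimes>\<^sub>o (g \<otimes>\<^sub>o Dom C p)))"
      by (rule comp_swap[OF 1]) simp_all
    also have "e (Cod C p) \<cdot> \<dots> = p \<cdot> (e (Dom C p) \<cdot> ((Y \<rtimes> w (Dom C p)) \<cdot> h (g \<otimes>\<^sub>o (g \<otimes>\<^sub>o Dom C p))))"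
      by (rule comp_swap[OF e_nat]) simp_all
    finally show ?thesis by (simp add: s_def)
  qed
  \<comment> \<open>\<open>bb\<close> and \<open>a\<close> exhibit \<open>\<I>\<close> as a retract of \<open>X \<otimes> Y\<close>, where \<open>s\<close> is invertible\<close>
  define bb where "bb = ev \<cdot> c X Y"
  define a where "a = inv_arr C (c X Y) \<cdot> t"
  have [simp]: "bb \<in> Arr C" "Dom C bb = X \<otimes>\<^sub>o Y" "Cod C bb = \<I>" "a \<in> Arr C" "Dom C a = \<I>" "Cod C a = X \<otimes>\<^sub>o Y"
    by (simp_all add: bb_def a_def)
  have ba: "bb \<cdot> a = Idn C \<I>" by (simp add: bb_def a_def et)
  let ?r = "(g \<rtimes> (g \<rtimes> bb)) \<cdot> (inv_arr C (q Y) \<cdot> a)"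
  have "iso_arr C (s \<I>)"
  proof (rule iso_arrI[of _ ?r])
    have "s \<I> \<cdot> ?r = bb \<cdot> (s (X \<otimes>\<^sub>o Y) \<cdot> (inv_arr C (q Y) \<cdot> a))"
      using comp_swap[OF s_nat[of bb], of "inv_arr C (q Y) \<cdot> a"] by simp
    then show "s \<I> \<cdot> ?r = Idn C (Cod C (s \<I>))" unfolding sq[OF Y] by (simp add: ba)
    have "?r \<cdot> s \<I> = (g \<rtimes> (g \<rtimes> bb)) \<cdot> (inv_arr C (q Y) \<cdot> (a \<cdot> s \<I>))" by simp
    also have "a \<cdot> s \<I> = q Y \<cdot> (g \<rtimes> (g \<rtimes> a))" using s_nat[of a] by (simp add: sq)
    also have "(g \<rtimes> (g \<rtimes> bb)) \<cdot> (inv_arr C (q Y) \<cdot> \<dots>) = Idn C (g \<otimes>\<^sub>o (g \<otimes>\<^sub>o \<I>))"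
      by (simp add: tensor_comp_arr ba)
    finally show "?r \<cdot> s \<I> = Idn C (Dom C (s \<I>))" by simp
  qed simp_all
  then have "isomorphic C (g \<otimes>\<^sub>o (g \<otimes>\<^sub>o \<I>)) \<I>" by (rule isomorphicI) (simp add: mor_iff)
  then show ?thesis
    using isomorphic_trans[OF isomorphic_sym[OF isomorphic_unit_mid(1)[of g g]]] by simp
qed

end

end

section \<open>Homogeneous components\<close>

context fusion_category
begin

text \<open>
  Multiplicity one: every endomorphism acts on each arrow from a simple object to \<open>M\<close> by a scalar, and
  such arrows are jointly epimorphic.
\<close>

lemma endomorphisms_commute:
  assumes le1: "\<And>u. simple_obj C u \<Longrightarrow> hom_le1 u M"
    and p: "p \<in> mor C M M" and q: "q \<in> mor C M M"
  shows "p \<cdot> q = q \<cdot> p"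
proof (rule ccontr)
  assume neq: "p \<cdot> q \<noteq> q \<cdot> p"
  have M: "M \<in> Obj C" using p mor_obj by blast
  note [simp] = M p[unfolded mor_iff] q[unfolded mor_iff]
  let ?d = "p \<cdot> q -\<^sub>a q \<cdot> p"
  have nz: "?d \<noteq> ZeroArr C M M" using neq diff_zero_imp_eq[of "p \<cdot> q" "q \<cdot> p"] by auto
  obtain n S where S: "\<forall>k<n. simple_obj C (S k)" "is_direct_sum C n S M" using semisimple M by blast
  obtain k \<iota> where k: "k < n" "\<iota> \<in> mor C (S k) M" "?d \<cdot> \<iota> \<noteq> ZeroArr C (S k) M"
    using direct_sum_nonzero_out[OF S(2), of ?d] nz by auto
  note [simp] = k(2)[unfolded mor_iff]
  have Sk: "S k \<in> Obj C" "hom_le1 (S k) M" using k S le1 mor_obj by auto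
  have "\<iota> \<noteq> ZeroArr C (S k) M" using k(3) Sk by auto
  moreover have "p \<cdot> \<iota> \<in> mor C (S k) M" "q \<cdot> \<iota> \<in> mor C (S k) M" by (simp_all add: mor_iff)
  ultimately obtain r r' where r: "p \<cdot> \<iota> = r *\<^sub>a \<iota>" "q \<cdot> \<iota> = r' *\<^sub>a \<iota>"
    using Sk(2) k(2) unfolding hom_le1_def by metis
  have "?d \<cdot> \<iota> = p \<cdot> (q \<cdot> \<iota>) -\<^sub>a q \<cdot> (p \<cdot> \<iota>)" by (simp add: comp_add_l)
  also have "\<dots> = (r' * r) *\<^sub>a \<iota> -\<^sub>a (r' * r) *\<^sub>a \<iota>" by (simp add: r mult.commute)
  also have "\<dots> = ZeroArr C (S k) M" using diff_self[of "(r' * r) *\<^sub>a \<iota>"] by simp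
  finally show False using k(3) by simp
qed

lemma zero_identity_imp_zero:
  assumes "Idn C T = ZeroArr C T T" "f \<in> mor C W T"
  shows "f = ZeroArr C W T"
proof -
  have f: "f \<in> Arr C" "Dom C f = W" "Cod C f = T" "T \<in> Obj C" "W \<in> Obj C" using assms(2) mor_obj by (auto simp: mor_iff)
  then have "f = Idn C T \<cdot> f" by simp
  also have "\<dots> = ZeroArr C W T" unfolding assms(1) using f by simp
  finally show ?thesis .
qed

context
  fixes G
  assumes grading: "C2_grading C G"
begin

interpretation C2_grading C G by (rule grading)

text \<open>
  The homogeneous summand of a simple object that is not zero is the whole object.
\<close>

lemma simple_homogeneous:
  assumes u: "simple_obj C u"
  obtains i where "i < 2" "u \<in> G i"
proof -
  have uO: "u \<in> Obj C" using simple_objD[OF u] by simp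
  obtain S where S: "\<forall>i<2. S i \<in> G i" "is_direct_sum C 2 S u" using component_decomposition[OF uO] by blast
  obtain k \<pi> \<iota> where k: "k < 2" "\<pi> \<in> mor C u (S k)" "\<iota> \<in> mor C (S k) u" "\<pi> \<cdot> \<iota> = Idn C (S k)"
      "\<pi> \<cdot> Idn C u \<noteq> ZeroArr C u (S k)"
    using direct_sum_nonzero_in[OF S(2), of "Idn C u"] simple_objD[OF u] by auto
  have "\<pi> \<noteq> ZeroArr C u (S k)" using k uO by (auto simp: mor_iff)
  then have nz: "Idn C (S k) \<noteq> ZeroArr C (S k) (S k)" using zero_identity_imp_zero k(2) by blast
  have "iso_arr C \<pi>" by (rule scalar_end_retract_iso[OF uO simple_end_scalar[OF u] k(2-4) nz])
  then have "isomorphic C u (S k)" using isomorphicI k(2) by blast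
  then have "u \<in> G k" using component_replete[OF k(1)] S(1) k(1) isomorphic_sym by blast
  then show thesis using that k(1) by blast
qed

lemma nonzero_same_component:
  assumes "f \<in> mor C A B" "f \<noteq> ZeroArr C A B" "A \<in> G i" "B \<in> G j" "i < 2" "j < 2"
  shows "i = j"
  using assms component_orthogonal by blast

text \<open>
  \<open>\<I> \<cong> \<I> \<otimes> \<I>\<close> has even degree.
\<close>

lemma unit_component: "\<I> \<in> G 0"
proof -
  obtain i where i: "i < 2" "\<I> \<in> G i" by (rule simple_homogeneous[OF unit_simple])
  then have "\<I> \<otimes>\<^sub>o \<I> \<in> G ((i + i) mod 2)" using component_tensor by blast
  moreover have "(i + i) mod 2 = 0" by presburger
  ultimately show ?thesis using component_replete[of 0 "\<I> \<otimes>\<^sub>o \<I>" \<I>] isomorphic_unit(1) unit_obj by simp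
qed

lemma constituent_square_component:
  assumes X: "simple_obj C X" and u: "simple_obj C u"
    and i: "i \<in> mor C u (X \<otimes>\<^sub>o X)" "i \<noteq> ZeroArr C u (X \<otimes>\<^sub>o X)"
  shows "u \<in> G 0"
proof -
  obtain k where k: "k < 2" "X \<in> G k" by (rule simple_homogeneous[OF X])
  then have "X \<otimes>\<^sub>o X \<in> G ((k + k) mod 2)" using component_tensor by blast
  then have XX: "X \<otimes>\<^sub>o X \<in> G 0" by (simp add: mult_2[symmetric])
  obtain j where j: "j < 2" "u \<in> G j" by (rule simple_homogeneous[OF u])
  have "j = 0" by (rule nonzero_same_component[OF i j(2) XX j(1)]) simp
  then show ?thesis using j by simp
qed

text \<open>
  The degree of \<open>u \<otimes> X\<close> equals that of \<open>X\<close>, as there is a nonzero arrow between them.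
\<close>

lemma stabilizer_component:
  assumes X: "simple_obj C X" and u: "simple_obj C u"
    and i: "i \<in> mor C (u \<otimes>\<^sub>o X) X" "i \<noteq> ZeroArr C (u \<otimes>\<^sub>o X) X"
  shows "u \<in> G 0"
proof -
  obtain k where k: "k < 2" "X \<in> G k" by (rule simple_homogeneous[OF X])
  obtain j where j: "j < 2" "u \<in> G j" by (rule simple_homogeneous[OF u])
  have "u \<otimes>\<^sub>o X \<in> G ((j + k) mod 2)" using component_tensor j k by blast
  then have "(j + k) mod 2 = k" by (rule nonzero_same_component[OF i _ k(2) _ k(1)]) simp
  then have "j = 0" using j k by presburger
  then show ?thesis using j by simp
qed

end

end

section \<open>Transport of invertibility along the equivalence\<close>

lemma (in plain_category) mor_full_subcat:
  "mor (full_subcat C S) X Y = {f \<in> mor C X Y. X \<in> S \<and> Y \<in> S}"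
  by (auto simp: mor_def full_subcat_def)

lemma full_subcat_simps [simp]:
  "Obj (full_subcat C S) = Obj C \<inter> S" "Dom (full_subcat C S) = Dom C" "Cod (full_subcat C S) = Cod C"
  "Idn (full_subcat C S) = Idn C" "Cmp (full_subcat C S) = Cmp C" "ZeroArr (full_subcat C S) = ZeroArr C"
  "AddArr (full_subcat C S) = AddArr C" "ScaleArr (full_subcat C S) = ScaleArr C"
  "UnitObj (full_subcat C S) = UnitObj C" "TenObj (full_subcat C S) = TenObj C"
  "TenArr (full_subcat C S) = TenArr C" "Assoc (full_subcat C S) = Assoc C"
  "LUnit (full_subcat C S) = LUnit C" "RUnit (full_subcat C S) = RUnit C"
  by (simp_all add: full_subcat_def)

text \<open>
  The image of \<open>u\<close> has scalar endomorphisms because the functor is full, so it is simple and has an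
  inverse \<open>P\<close> in \<open>D\<close>.  A preimage \<open>v\<close> of \<open>P\<close> up to isomorphism satisfies \<open>F(u \<otimes> v) \<cong> F \<I>\<close>, and a fully
  faithful functor reflects isomorphism.
\<close>

lemma (in fusion_category) simple_invertible_transport:
  assumes D: "pointed_fusion_category D" and eq: "monoidally_equivalent (full_subcat C S) D"
    and S: "S \<subseteq> Obj C" "\<I> \<in> S" "\<And>X Y. X \<in> S \<Longrightarrow> Y \<in> S \<Longrightarrow> X \<otimes>\<^sub>o Y \<in> S"
    and u: "simple_obj C u" "u \<in> S"
  shows "\<exists>v \<in> Obj C. isomorphic C (u \<otimes>\<^sub>o v) \<I>"
proof -
  interpret D: pointed_fusion_category D by (rule D)
  let ?K = "full_subcat C S"
  obtain Fo Fa J e where "monoidal_equivalence ?K D Fo Fa J e" using eq unfolding monoidally_equivalent_def by blast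
  then interpret F: monoidal_equivalence ?K D Fo Fa J e .
  have SO: "X \<in> Obj C" if "X \<in> S" for X using S(1) that by blast
  have FO: "Fo X \<in> Obj D" if "X \<in> S" for X using F.map_obj[of X] SO[OF that] that by simp
  have mK: "mor ?K X Y = mor C X Y" if "X \<in> S" "Y \<in> S" for X Y using that by (simp add: mor_full_subcat)
  have bij: "bij_betw Fa (mor C X Y) (mor D (Fo X) (Fo Y))" if "X \<in> S" "Y \<in> S" for X Y
    using F.fully_faithful[of X Y] that SO mK by simp
  have FaId: "Fa (Idn C X) = Idn D (Fo X)" if "X \<in> S" for X using F.map_id[of X] SO that by simp
  have FaScale: "Fa (ScaleArr C r f) = ScaleArr D r (Fa f)" if "f \<in> mor C X Y" "X \<in> S" "Y \<in> S" for r f X Y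
    using F.map_scale[of f X Y r] that mK by simp
  have FaCmp: "Fa (g \<cdot> f) = Cmp D (Fa g) (Fa f)" if "f \<in> mor C X Y" "g \<in> mor C Y Z" "X \<in> S" "Y \<in> S" "Z \<in> S" for f g X Y Z
    using F.map_comp[of f X Y g Z] that mK by simp
  have idm: "Idn C X \<in> mor C X X" if "X \<in> S" for X using id_mor SO that by blast
  have "simple_obj D (Fo u)"
  proof (rule D.scalar_end_imp_simple)
    show "Fo u \<in> Obj D" using FO u by blast
    show "Idn D (Fo u) \<noteq> ZeroArr D (Fo u) (Fo u)"
    proof
      assume z: "Idn D (Fo u) = ZeroArr D (Fo u) (Fo u)"
      have "Fa (ScaleArr C 0 (Idn C u)) = ScaleArr D 0 (Idn D (Fo u))"
        using FaScale[OF idm[OF u(2)] u(2) u(2)] FaId[OF u(2)] by simp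
      also have "\<dots> = Fa (Idn C u)" using D.scale_zero[of "Idn D (Fo u)"] FO[OF u(2)] FaId[OF u(2)] z by simp
      finally have "ScaleArr C 0 (Idn C u) = Idn C u"
        using bij_betw_imp_inj_on[OF bij[OF u(2) u(2)]] idm[OF u(2)] 
        by (auto dest!: inj_onD simp: mor_iff SO[OF u(2)])
      then show False using simple_objD[OF u(1)] scale_zero[of "Idn C u"] by simp
    qed
    fix \<psi> assume "\<psi> \<in> mor D (Fo u) (Fo u)"
    then obtain \<phi> where \<phi>: "\<phi> \<in> mor C u u" "\<psi> = Fa \<phi>"
      using bij_betw_imp_surj_on[OF bij[OF u(2) u(2)]] by blast
    obtain r where "\<phi> = ScaleArr C r (Idn C u)" using simple_end_scalar[OF u(1) \<phi>(1)] by blast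
    then show "\<exists>r. \<psi> = ScaleArr D r (Idn D (Fo u))"
      using \<phi>(2) FaScale[OF idm[OF u(2)] u(2) u(2)] FaId[OF u(2)] by auto
  qed
  then have "invertible_obj D (Fo u)" by (rule D.simple_invertible)
  then obtain P where P: "left_dual D (Fo u) P" "isomorphic D (TenObj D (Fo u) P) (UnitObj D)"
    unfolding invertible_obj_def by blast
  then have PO: "P \<in> Obj D" by (simp add: left_dual_def)
  obtain v where v: "v \<in> S" "isomorphic D (Fo v) P" using F.essentially_surjective[OF PO] by auto
  have uv: "u \<otimes>\<^sub>o v \<in> S" using S(3) u v by blast
  have "isomorphic D (TenObj D (Fo u) (Fo v)) (Fo (u \<otimes>\<^sub>o v))"
    using D.isomorphicI[of "J u v"] F.map_tensor_mor[of u v] F.map_tensor_iso[of u v] u v SO by simp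
  from D.isomorphic_sym[OF this] have "isomorphic D (Fo (u \<otimes>\<^sub>o v)) (TenObj D (Fo u) (Fo v))" .
  also have "isomorphic D (TenObj D (Fo u) (Fo v)) (TenObj D (Fo u) P)"
    by (rule D.isomorphic_tensor[OF D.isomorphic_refl v(2)]) (use FO u in blast)
  also note P(2)
  also have "isomorphic D (UnitObj D) (Fo \<I>)"
    using D.isomorphicI[OF F.map_unit_iso] F.map_unit_mor by simp
  finally obtain j where j: "j \<in> mor D (Fo (u \<otimes>\<^sub>o v)) (Fo \<I>)" "iso_arr D j" unfolding isomorphic_def by blast
  have ji: "inv_arr D j \<in> mor D (Fo \<I>) (Fo (u \<otimes>\<^sub>o v))" using j D.inv_arr[OF j(2)] by (simp add: mor_iff)
  have "j \<in> Fa ` mor C (u \<otimes>\<^sub>o v) \<I>"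
    unfolding bij_betw_imp_surj_on[OF bij[OF uv S(2)]] by (rule j(1))
  then obtain f where f: "f \<in> mor C (u \<otimes>\<^sub>o v) \<I>" "Fa f = j" by auto
  have "inv_arr D j \<in> Fa ` mor C \<I> (u \<otimes>\<^sub>o v)"
    unfolding bij_betw_imp_surj_on[OF bij[OF S(2) uv]] by (rule ji)
  then obtain h where h: "h \<in> mor C \<I> (u \<otimes>\<^sub>o v)" "Fa h = inv_arr D j" by auto
  have "Fa (h \<cdot> f) = Fa (Idn C (u \<otimes>\<^sub>o v))"
    using FaCmp[OF f(1) h(1) uv S(2) uv] FaId[OF uv] f h j D.inv_arr(4)[OF j(2)] by (simp add: mor_iff)
  then have hf: "h \<cdot> f = Idn C (u \<otimes>\<^sub>o v)"
    by (rule inj_onD[OF bij_betw_imp_inj_on[OF bij[OF uv uv]] _ comp_mor[OF f(1) h(1)] idm[OF uv]])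
  have "Fa (f \<cdot> h) = Fa (Idn C \<I>)"
    using FaCmp[OF h(1) f(1) S(2) uv S(2)] FaId[OF S(2)] f h j D.inv_arr(5)[OF j(2)] by (simp add: mor_iff)
  then have fh: "f \<cdot> h = Idn C \<I>"
    by (rule inj_onD[OF bij_betw_imp_inj_on[OF bij[OF S(2) S(2)]] _ comp_mor[OF h(1) f(1)] idm[OF S(2)]])
  have "iso_arr C f" using f h hf fh by (intro iso_arrI[of _ h]) (auto simp: mor_iff)
  then have "isomorphic C (u \<otimes>\<^sub>o v) \<I>" using isomorphicI f by blast
  then show ?thesis using SO[OF v(1)] by blast
qed

section \<open>Finite groups of exponent two\<close>

context group
begin

text \<open>
  The product of the \<open>x k\<close> over the positions \<open>k < n\<close> at which the 0-1 vector \<open>a\<close> is nonzero.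
\<close>

primrec subset_product :: "(nat \<Rightarrow> 'a) \<Rightarrow> nat \<Rightarrow> (nat \<Rightarrow> int) \<Rightarrow> 'a" where
  "subset_product x 0 a = \<one>"
| "subset_product x (Suc n) a = subset_product x n a \<otimes> (if a n = 0 then \<one> else x n)"

lemma subset_product_closed:
  "(\<And>k. k < n \<Longrightarrow> x k \<in> carrier G) \<Longrightarrow> subset_product x n a \<in> carrier G"
  by (induction n) auto

lemma subset_product_cong:
  "(\<And>k. k < n \<Longrightarrow> x k = y k) \<Longrightarrow> (\<And>k. k < n \<Longrightarrow> a k = b k) \<Longrightarrow>
    subset_product x n a = subset_product y n b"
  by (induction n) auto

lemma exponent_two_imp_comm:
  assumes sq: "\<And>x. x \<in> carrier G \<Longrightarrow> x \<otimes> x = \<one>"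
    and x: "x \<in> carrier G" and y: "y \<in> carrier G"
  shows "x \<otimes> y = y \<otimes> x"
proof -
  have inv: "inv z = z" if "z \<in> carrier G" for z using sq that by (metis inv_equality)
  have "x \<otimes> y = inv (x \<otimes> y)" by (rule inv[OF m_closed[OF x y], symmetric])
  also have "\<dots> = y \<otimes> x" using inv_mult_group[OF x y] inv[OF x] inv[OF y] by simp
  finally show ?thesis .
qed

lemma subset_product_add:
  assumes sq: "\<And>x. x \<in> carrier G \<Longrightarrow> x \<otimes> x = \<one>"
    and x: "\<And>k. k < n \<Longrightarrow> x k \<in> carrier G"
    and ab: "\<And>k. k < n \<Longrightarrow> a k \<in> {0..<2}" "\<And>k. k < n \<Longrightarrow> b k \<in> {0..<2}"
  shows "subset_product x n (\<lambda>k. (a k + b k) mod 2) = subset_product x n a \<otimes> subset_product x n b"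
  using x ab
proof (induction n)
  case 0
  then show ?case by simp
next
  case (Suc n)
  let ?A = "subset_product x n a" and ?B = "subset_product x n b"
  let ?p = "if a n = 0 then \<one> else x n" and ?q = "if b n = 0 then \<one> else x n"
  have cl: "?A \<in> carrier G" "?B \<in> carrier G" "?p \<in> carrier G" "?q \<in> carrier G"
    using Suc.prems by (auto intro!: subset_product_closed)
  have "a n = 0 \<or> a n = 1" "b n = 0 \<or> b n = 1" using Suc.prems(2,3)[of n] by auto
  then have pq: "(if (a n + b n) mod 2 = 0 then \<one> else x n) = ?p \<otimes> ?q"
    using sq[of "x n"] Suc.prems(1)[of n] by auto
  have "subset_product x (Suc n) (\<lambda>k. (a k + b k) mod 2) = (?A \<otimes> ?B) \<otimes> (?p \<otimes> ?q)"
    using Suc pq by simp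
  also have "\<dots> = ?A \<otimes> ((?B \<otimes> ?p) \<otimes> ?q)" using cl by (simp add: m_assoc)
  also have "?B \<otimes> ?p = ?p \<otimes> ?B" by (rule exponent_two_imp_comm[OF sq cl(2,3)])
  also have "?A \<otimes> ((?p \<otimes> ?B) \<otimes> ?q) = (?A \<otimes> ?p) \<otimes> (?B \<otimes> ?q)" using cl by (simp add: m_assoc)
  finally show ?case by simp
qed

text \<open>
  An element outside the image can be added to an independent family: if its presence in two equal
  products differed, it would itself be a product of the old family.
\<close>

lemma subset_product_extend:
  assumes sq: "\<And>x. x \<in> carrier G \<Longrightarrow> x \<otimes> x = \<one>"
    and x: "\<And>k. k < n \<Longrightarrow> x k \<in> carrier G"
    and inj: "inj_on (subset_product x n) (Pi\<^sub>E {..<n} (\<lambda>_. {0..<2}))"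
    and y: "y \<in> carrier G" "y \<notin> subset_product x n ` (Pi\<^sub>E {..<n} (\<lambda>_. {0..<2}))"
  shows "inj_on (subset_product (x(n := y)) (Suc n)) (Pi\<^sub>E {..<Suc n} (\<lambda>_. {0..<2}))"
proof (rule inj_onI)
  let ?V = "\<lambda>n. Pi\<^sub>E {..<n} (\<lambda>_. {0..<2::int})"
  fix a b
  assume a: "a \<in> ?V (Suc n)" and b: "b \<in> ?V (Suc n)"
    and eq: "subset_product (x(n := y)) (Suc n) a = subset_product (x(n := y)) (Suc n) b"
  let ?a = "restrict a {..<n}" and ?b = "restrict b {..<n}"
  have ra: "?a \<in> ?V n" "?b \<in> ?V n" using a b by (auto simp: PiE_iff)
  let ?A = "subset_product x n ?a" and ?B = "subset_product x n ?b"
  have cl: "?A \<in> carrier G" "?B \<in> carrier G" using x by (auto intro!: subset_product_closed)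
  have red: "subset_product (x(n := y)) n a = ?A" "subset_product (x(n := y)) n b = ?B"
    by (auto intro!: subset_product_cong)
  have an: "a n = 0 \<or> a n = 1" "b n = 0 \<or> b n = 1" using PiE_mem[OF a, of n] PiE_mem[OF b, of n] by auto
  have eq': "?A \<otimes> (if a n = 0 then \<one> else y) = ?B \<otimes> (if b n = 0 then \<one> else y)"
    using eq by (simp only: subset_product.simps fun_upd_same red)
  have V_add: "\<exists>d \<in> ?V n. subset_product x n d = ?A \<otimes> ?B"
  proof (intro bexI)
    let ?d = "restrict (\<lambda>k. (?a k + ?b k) mod 2) {..<n}"
    show "?d \<in> ?V n" by auto
    have "subset_product x n ?d = subset_product x n (\<lambda>k. (?a k + ?b k) mod 2)"
      by (rule subset_product_cong) auto
    also have "\<dots> = ?A \<otimes> ?B"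
      using ra by (intro subset_product_add sq x) (auto simp: PiE_iff)
    finally show "subset_product x n ?d = ?A \<otimes> ?B" .
  qed
  have "a n = b n"
  proof (rule ccontr)
    assume "a n \<noteq> b n"
    then have "y = ?A \<otimes> ?B"
    proof (cases "a n = 0")
      case True
      then have "?A = ?B \<otimes> y" using eq' an \<open>a n \<noteq> b n\<close> cl by auto
      then have "?A \<otimes> ?B = y \<otimes> (?B \<otimes> ?B)" using cl y exponent_two_imp_comm[OF sq, of ?B y] by (simp add: m_assoc)
      then show ?thesis using sq cl y by simp
    next
      case False
      then have "?B = ?A \<otimes> y" using eq' an \<open>a n \<noteq> b n\<close> cl by auto
      then have "?A \<otimes> ?B = (?A \<otimes> ?A) \<otimes> y" using cl y by (simp add: m_assoc)
      then show ?thesis using sq cl y by simp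
    qed
    then show False using y(2) V_add by (metis image_eqI)
  qed
  moreover have "?A = ?B" using eq' cl y \<open>a n = b n\<close> by (auto split: if_splits)
  then have "?a = ?b" by (rule inj_onD[OF inj _ ra])
  then have "a k = b k" if "k < n" for k using that by (metis lessThan_iff restrict_apply')
  ultimately have "a k = b k" if "k < Suc n" for k using that less_Suc_eq by auto
  then show "a = b" using a b by (intro PiE_ext) auto
qed

text \<open>
  An independent family of maximal length generates the group, by the previous lemma.  Its length
  \<open>n\<close> is bounded because its \<open>2 ^ n\<close> products are distinct.
\<close>

lemma exponent_two_imp_elementary:
  assumes fin: "finite (carrier G)" and sq: "\<And>x. x \<in> carrier G \<Longrightarrow> x \<otimes> x = \<one>"
  shows "elementary_abelian_2_group G"
proof -
  let ?V = "\<lambda>n. Pi\<^sub>E {..<n} (\<lambda>_. {0..<2::int})"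
  let ?P = "\<lambda>n. \<exists>x. (\<forall>k<n. x k \<in> carrier G) \<and> inj_on (subset_product x n) (?V n)"
  have bound: "n \<le> card (carrier G)" if "?P n" for n
  proof -
    obtain x where x: "\<forall>k<n. x k \<in> carrier G" "inj_on (subset_product x n) (?V n)" using \<open>?P n\<close> by blast
    have "subset_product x n ` ?V n \<subseteq> carrier G" using x(1) by (auto intro!: subset_product_closed)
    then have "card (?V n) \<le> card (carrier G)" using card_inj_on_le[OF x(2)] fin by blast
    then have "2 ^ n \<le> card (carrier G)" by (simp add: card_PiE)
    then show ?thesis using less_exp[of n] by linarith
  qed
  have "?P 0" by (intro exI[of _ "\<lambda>_. \<one>"]) auto
  then obtain n where n: "?P n" "\<And>m. ?P m \<Longrightarrow> m \<le> n"
    using ex_has_greatest_nat[of ?P 0 "\<lambda>n. n" "Suc (card (carrier G))"] bound by (auto simp: less_Suc_eq_le)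
  then obtain x where x: "\<And>k. k < n \<Longrightarrow> x k \<in> carrier G" "inj_on (subset_product x n) (?V n)" by blast
  have sub: "subset_product x n ` ?V n \<subseteq> carrier G" using x(1) by (auto intro!: subset_product_closed)
  have surj: "subset_product x n ` ?V n = carrier G"
  proof (rule ccontr)
    assume "subset_product x n ` ?V n \<noteq> carrier G"
    then obtain y where y: "y \<in> carrier G" "y \<notin> subset_product x n ` ?V n" using sub by blast
    have "inj_on (subset_product (x(n := y)) (Suc n)) (?V (Suc n))"
      by (rule subset_product_extend[OF sq x y]) 
    moreover have "\<forall>k<Suc n. (x(n := y)) k \<in> carrier G" using x(1) y(1) by (auto simp: less_Suc_eq)
    ultimately have "?P (Suc n)" by blast
    then show False using n(2)[of "Suc n"] by simp
  qed
  let ?Z = "product_group {..<n} (\<lambda>_. integer_mod_group 2)"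
  have cZ: "carrier ?Z = ?V n" by (simp add: carrier_product_group carrier_integer_mod_group)
  have "subset_product x n \<in> iso ?Z G"
  proof (rule isoI)
    show "subset_product x n \<in> hom ?Z G"
    proof (rule homI)
      fix a b assume ab: "a \<in> carrier ?Z" "b \<in> carrier ?Z"
      have "subset_product x n (a \<otimes>\<^bsub>?Z\<^esub> b) = subset_product x n (\<lambda>k. (a k + b k) mod 2)"
        by (rule subset_product_cong) (auto simp: mult_integer_mod_group)
      also have "\<dots> = subset_product x n a \<otimes> subset_product x n b"
        using ab[unfolded cZ] by (intro subset_product_add sq x(1)) (auto simp: PiE_iff)
      finally show "subset_product x n (a \<otimes>\<^bsub>?Z\<^esub> b) = subset_product x n a \<otimes> subset_product x n b" .
    qed (use sub cZ in auto)
    show "bij_betw (subset_product x n) (carrier ?Z) (carrier G)"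
      unfolding cZ bij_betw_def using x(2) surj by blast
  qed
  moreover have "group ?Z" by (simp add: group_integer_mod_group)
  ultimately have "G \<cong> ?Z" using group.iso_sym is_isoI by blast
  then show ?thesis unfolding elementary_abelian_2_group_def using group_axioms by blast
qed

end

section \<open>Objects whose constituents have order two\<close>

lemma (in linear_monoidal_category) direct_sum_tensor_nonzero_left:
  assumes X: "is_direct_sum C n S X" and Y: "Y \<in> Obj C"
    and i: "i \<in> mor C A (X \<otimes>\<^sub>o Y)" "i \<noteq> ZeroArr C A (X \<otimes>\<^sub>o Y)"
  shows "\<exists>k<n. \<exists>\<pi> \<in> mor C X (S k). \<exists>\<iota> \<in> mor C (S k) X. \<pi> \<cdot> \<iota> = Idn C (S k) \<and>
    (\<pi> \<ltimes> Y) \<cdot> i \<noteq> ZeroArr C A (S k \<otimes>\<^sub>o Y)"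
proof -
  have XO: "X \<in> Obj C" using X by (simp add: is_direct_sum_def)
  have AO: "A \<in> Obj C" using i mor_obj by blast
  note [simp] = XO Y AO i(1)[unfolded mor_iff]
  obtain k \<iota> \<pi> where k: "k < n" "\<iota> \<in> mor C (S k) X" "\<pi> \<in> mor C X (S k)" "\<pi> \<cdot> \<iota> = Idn C (S k)"
    "((\<iota> \<cdot> \<pi>) \<ltimes> Y) \<cdot> i \<noteq> ZeroArr C A (X \<otimes>\<^sub>o Y)"
    by (rule direct_sum_test[OF X, where F = "\<lambda>h. (h \<ltimes> Y) \<cdot> i" and A = A and B = "X \<otimes>\<^sub>o Y"])
      (use i in \<open>auto simp: mor_iff comp_add_l tensor_add\<close>)
  have Sk: "S k \<in> Obj C" using k mor_obj by blast
  have "((\<iota> \<cdot> \<pi>) \<ltimes> Y) \<cdot> i = (\<iota> \<ltimes> Y) \<cdot> ((\<pi> \<ltimes> Y) \<cdot> i)"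
    using k by (simp add: mor_iff whisker_comp)
  then have "(\<pi> \<ltimes> Y) \<cdot> i \<noteq> ZeroArr C A (S k \<otimes>\<^sub>o Y)" using k Sk by (auto simp: mor_iff)
  then show ?thesis using k by blast
qed

lemma (in linear_monoidal_category) direct_sum_tensor_nonzero_right:
  assumes X: "is_direct_sum C n S X" and Y: "Y \<in> Obj C"
    and i: "i \<in> mor C A (Y \<otimes>\<^sub>o X)" "i \<noteq> ZeroArr C A (Y \<otimes>\<^sub>o X)"
  shows "\<exists>k<n. \<exists>\<pi> \<in> mor C X (S k). \<exists>\<iota> \<in> mor C (S k) X. \<pi> \<cdot> \<iota> = Idn C (S k) \<and>
    (Y \<rtimes> \<pi>) \<cdot> i \<noteq> ZeroArr C A (Y \<otimes>\<^sub>o S k)"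
proof -
  have XO: "X \<in> Obj C" using X by (simp add: is_direct_sum_def)
  have AO: "A \<in> Obj C" using i mor_obj by blast
  note [simp] = XO Y AO i(1)[unfolded mor_iff]
  obtain k \<iota> \<pi> where k: "k < n" "\<iota> \<in> mor C (S k) X" "\<pi> \<in> mor C X (S k)" "\<pi> \<cdot> \<iota> = Idn C (S k)"
    "(Y \<rtimes> (\<iota> \<cdot> \<pi>)) \<cdot> i \<noteq> ZeroArr C A (Y \<otimes>\<^sub>o X)"
    by (rule direct_sum_test[OF X, where F = "\<lambda>h. (Y \<rtimes> h) \<cdot> i" and A = A and B = "Y \<otimes>\<^sub>o X"])
      (use i in \<open>auto simp: mor_iff comp_add_l tensor_add\<close>)
  have Sk: "S k \<in> Obj C" using k mor_obj by blast
  have "(Y \<rtimes> (\<iota> \<cdot> \<pi>)) \<cdot> i = (Y \<rtimes> \<iota>) \<cdot> ((Y \<rtimes> \<pi>) \<cdot> i)"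
    using k by (simp add: mor_iff whisker_comp)
  then have "(Y \<rtimes> \<pi>) \<cdot> i \<noteq> ZeroArr C A (Y \<otimes>\<^sub>o S k)" using k Sk by (auto simp: mor_iff)
  then show ?thesis using k by blast
qed

context braided_fusion_category
begin

definition order_two_objects :: "'o set" where
  "order_two_objects = {W \<in> Obj C. \<forall>u. simple_obj C u \<longrightarrow>
    (\<exists>i \<in> mor C u W. i \<noteq> ZeroArr C u W) \<longrightarrow> isomorphic C (u \<otimes>\<^sub>o u) \<I>}"

lemma order_two_objectsI:
  assumes "W \<in> Obj C"
    "\<And>u i. simple_obj C u \<Longrightarrow> i \<in> mor C u W \<Longrightarrow> i \<noteq> ZeroArr C u W \<Longrightarrow> isomorphic C (u \<otimes>\<^sub>o u) \<I>"
  shows "W \<in> order_two_objects"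
  using assms unfolding order_two_objects_def by blast

lemma order_two_objectsD:
  assumes "W \<in> order_two_objects"
  shows "W \<in> Obj C"
    "simple_obj C u \<Longrightarrow> i \<in> mor C u W \<Longrightarrow> i \<noteq> ZeroArr C u W \<Longrightarrow> isomorphic C (u \<otimes>\<^sub>o u) \<I>"
  using assms unfolding order_two_objects_def by blast+

lemma order_two_summand:
  assumes "W \<in> order_two_objects" "simple_obj C S" "\<pi> \<in> mor C W S" "\<iota> \<in> mor C S W" "\<pi> \<cdot> \<iota> = Idn C S"
  shows "isomorphic C (S \<otimes>\<^sub>o S) \<I>"
proof -
  have "\<iota> \<noteq> ZeroArr C S W"
  proof
    assume "\<iota> = ZeroArr C S W"
    then have "Idn C S = ZeroArr C S S" using assms simple_objD(1)[OF assms(2)] by (auto simp: mor_iff)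
    then show False using simple_objD[OF assms(2)] by simp
  qed
  then show ?thesis using order_two_objectsD(2)[OF assms(1,2,4)] by blast
qed

lemma order_two_isomorphic:
  assumes "isomorphic C u S" "isomorphic C (S \<otimes>\<^sub>o S) \<I>"
  shows "isomorphic C (u \<otimes>\<^sub>o u) \<I>"
  using isomorphic_trans[OF isomorphic_tensor[OF assms(1,1)] assms(2)] .

lemma order_two_tensor:
  assumes O: "X \<in> Obj C" "Y \<in> Obj C" and X: "isomorphic C (X \<otimes>\<^sub>o X) \<I>" and Y: "isomorphic C (Y \<otimes>\<^sub>o Y) \<I>"
  shows "isomorphic C (X \<otimes>\<^sub>o Y \<otimes>\<^sub>o (X \<otimes>\<^sub>o Y)) \<I>"
proof -
  note [simp] = O
  note r = isomorphic_refl
  have "isomorphic C (X \<otimes>\<^sub>o Y \<otimes>\<^sub>o (X \<otimes>\<^sub>o Y)) (X \<otimes>\<^sub>o (Y \<otimes>\<^sub>o (X \<otimes>\<^sub>o Y)))" by (rule isomorphic_assoc) simp_all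
  also have "isomorphic C (X \<otimes>\<^sub>o (Y \<otimes>\<^sub>o (X \<otimes>\<^sub>o Y))) (X \<otimes>\<^sub>o (X \<otimes>\<^sub>o Y \<otimes>\<^sub>o Y))"
    by (intro isomorphic_tensor r isomorphic_braid) simp_all
  also have "isomorphic C (X \<otimes>\<^sub>o (X \<otimes>\<^sub>o Y \<otimes>\<^sub>o Y)) (X \<otimes>\<^sub>o (X \<otimes>\<^sub>o (Y \<otimes>\<^sub>o Y)))"
    by (intro isomorphic_tensor r isomorphic_assoc) simp_all
  also have "isomorphic C (X \<otimes>\<^sub>o (X \<otimes>\<^sub>o (Y \<otimes>\<^sub>o Y))) (X \<otimes>\<^sub>o (X \<otimes>\<^sub>o \<I>))"
    by (intro isomorphic_tensor r Y) simp_all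
  also have "isomorphic C (X \<otimes>\<^sub>o (X \<otimes>\<^sub>o \<I>)) (X \<otimes>\<^sub>o X)"
    by (intro isomorphic_tensor r isomorphic_unit) simp_all
  also note X
  finally show ?thesis .
qed

lemma order_two_simple:
  assumes "X \<in> Obj C" "isomorphic C (X \<otimes>\<^sub>o X) \<I>"
  shows "simple_obj C X"
  by (rule invertible_imp_simple[OF assms(2,2) assms(1,1)])

text \<open>
  A nonzero pairing of \<open>u\<close> with \<open>X\<close> pairs \<open>u\<close> with some simple constituent \<open>s\<close> of \<open>X\<close>.  As \<open>s\<close> is its own
  inverse, \<open>u \<cong> s\<close>.
\<close>

lemma order_two_pairing:
  assumes X: "X \<in> order_two_objects" and u: "simple_obj C u"
    and j: "j \<in> mor C (u \<otimes>\<^sub>o X) \<I>" "j \<noteq> ZeroArr C (u \<otimes>\<^sub>o X) \<I>"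
  shows "isomorphic C (u \<otimes>\<^sub>o u) \<I>"
proof -
  have XO: "X \<in> Obj C" and uO: "u \<in> Obj C" using order_two_objectsD[OF X] simple_objD[OF u] by auto
  obtain t where t: "t \<in> mor C \<I> (u \<otimes>\<^sub>o X)" "j \<cdot> t = Idn C \<I>" using nonzero_to_simple_split[OF unit_simple j] by blast
  have tnz: "t \<noteq> ZeroArr C \<I> (u \<otimes>\<^sub>o X)"
  proof
    assume z: "t = ZeroArr C \<I> (u \<otimes>\<^sub>o X)"
    have "j \<cdot> t = ZeroArr C \<I> \<I>" unfolding z using j by (simp add: mor_iff)
    then show False using t(2) simple_objD[OF unit_simple] by simp
  qed
  obtain n S where S: "\<forall>k<n. simple_obj C (S k)" "is_direct_sum C n S X" using semisimple XO by blast
  obtain k \<pi> \<iota> where k: "k < n" "\<pi> \<in> mor C X (S k)" "\<iota> \<in> mor C (S k) X" "\<pi> \<cdot> \<iota> = Idn C (S k)"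
    "(u \<rtimes> \<pi>) \<cdot> t \<noteq> ZeroArr C \<I> (u \<otimes>\<^sub>o S k)"
    using direct_sum_tensor_nonzero_right[OF S(2) uO t(1) tnz] by blast
  define s where "s = S k"
  have s: "simple_obj C s" "s \<in> Obj C" using S k simple_objD by (auto simp: s_def)
  have ss: "isomorphic C (s \<otimes>\<^sub>o s) \<I>" unfolding s_def by (rule order_two_summand[OF X _ k(2-4)]) (use S k in simp)
  have us: "simple_obj C (u \<otimes>\<^sub>o s)"
    using simple_obj_isomorphic[OF invertible_tensor_simple[OF ss ss s(2) s(2) u]] isomorphic_braid uO s by blast
  have "(u \<rtimes> \<pi>) \<cdot> t \<in> mor C \<I> (u \<otimes>\<^sub>o s)" using k t uO by (simp add: mor_iff s_def)
  then have I: "isomorphic C \<I> (u \<otimes>\<^sub>o s)"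
    using isomorphicI nonzero_between_simples_iso[OF unit_simple us] k(5) unfolding s_def by blast
  have "isomorphic C u (u \<otimes>\<^sub>o \<I>)" by (rule isomorphic_sym[OF isomorphic_unit(2)[OF uO]])
  also have "isomorphic C (u \<otimes>\<^sub>o \<I>) (u \<otimes>\<^sub>o (s \<otimes>\<^sub>o s))" by (rule isomorphic_tensor[OF isomorphic_refl[OF uO] isomorphic_sym[OF ss]])
  also have "isomorphic C (u \<otimes>\<^sub>o (s \<otimes>\<^sub>o s)) (u \<otimes>\<^sub>o s \<otimes>\<^sub>o s)" by (rule isomorphic_sym[OF isomorphic_assoc[OF uO s(2,2)]])
  also have "isomorphic C (u \<otimes>\<^sub>o s \<otimes>\<^sub>o s) (\<I> \<otimes>\<^sub>o s)" by (rule isomorphic_tensor[OF isomorphic_sym[OF I] isomorphic_refl[OF s(2)]])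
  also have "isomorphic C (\<I> \<otimes>\<^sub>o s) s" by (rule isomorphic_unit(1)[OF s(2)])
  finally show ?thesis by (rule order_two_isomorphic[OF _ ss])
qed

text \<open>
  The braiding is what makes this set closed under tensor products: the product of two objects of
  order two then has order two again.  For duals, a constituent \<open>u\<close> of a dual of \<open>X\<close> pairs nontrivially
  with \<open>X\<close>.
\<close>

lemma order_two_fusion_subcategory: "fusion_subcategory C order_two_objects"
proof
  show "order_two_objects \<subseteq> Obj C" using order_two_objectsD(1) by blast
  show "\<I> \<in> order_two_objects"
  proof (rule order_two_objectsI)
    fix u i assume u: "simple_obj C u" "i \<in> mor C u \<I>" "i \<noteq> ZeroArr C u \<I>"
    then have "isomorphic C u \<I>" using nonzero_between_simples_iso[OF u(1) unit_simple u(2,3)] isomorphicI by blast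
    then show "isomorphic C (u \<otimes>\<^sub>o u) \<I>" by (rule order_two_isomorphic) (simp add: isomorphic_unit)
  qed simp
next
  fix X Y assume X: "X \<in> order_two_objects" and Y: "Y \<in> order_two_objects"
  have O: "X \<in> Obj C" "Y \<in> Obj C" using X Y order_two_objectsD(1) by auto
  show "X \<otimes>\<^sub>o Y \<in> order_two_objects"
  proof (rule order_two_objectsI)
    fix u i assume u: "simple_obj C u" "i \<in> mor C u (X \<otimes>\<^sub>o Y)" "i \<noteq> ZeroArr C u (X \<otimes>\<^sub>o Y)"
    obtain n S where S: "\<forall>k<n. simple_obj C (S k)" "is_direct_sum C n S X" using semisimple O by blast
    obtain m R where R: "\<forall>k<m. simple_obj C (R k)" "is_direct_sum C m R Y" using semisimple O by blast
    obtain k \<pi> \<iota> where k: "k < n" "\<pi> \<in> mor C X (S k)" "\<iota> \<in> mor C (S k) X" "\<pi> \<cdot> \<iota> = Idn C (S k)"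
      "(\<pi> \<ltimes> Y) \<cdot> i \<noteq> ZeroArr C u (S k \<otimes>\<^sub>o Y)"
      using direct_sum_tensor_nonzero_left[OF S(2) O(2) u(2,3)] by blast
    have sk: "simple_obj C (S k)" "S k \<in> Obj C" using S k simple_objD by auto
    define i' where "i' = (\<pi> \<ltimes> Y) \<cdot> i"
    have i': "i' \<in> mor C u (S k \<otimes>\<^sub>o Y)" "i' \<noteq> ZeroArr C u (S k \<otimes>\<^sub>o Y)"
      using k u O by (auto simp: i'_def mor_iff)
    obtain l \<pi>' \<iota>' where l: "l < m" "\<pi>' \<in> mor C Y (R l)" "\<iota>' \<in> mor C (R l) Y" "\<pi>' \<cdot> \<iota>' = Idn C (R l)"
      "((S k) \<rtimes> \<pi>') \<cdot> i' \<noteq> ZeroArr C u (S k \<otimes>\<^sub>o R l)"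
      using direct_sum_tensor_nonzero_right[OF R(2) sk(2) i'] by blast
    have rl: "simple_obj C (R l)" "R l \<in> Obj C" using R l simple_objD by auto
    have P: "isomorphic C (S k \<otimes>\<^sub>o R l \<otimes>\<^sub>o (S k \<otimes>\<^sub>o R l)) \<I>"
      by (rule order_two_tensor[OF sk(2) rl(2) order_two_summand[OF X sk(1) k(2-4)] order_two_summand[OF Y rl(1) l(2-4)]])
    have Ps: "simple_obj C (S k \<otimes>\<^sub>o R l)" by (rule order_two_simple[OF _ P]) (simp add: sk rl)
    have m: "((S k) \<rtimes> \<pi>') \<cdot> i' \<in> mor C u (S k \<otimes>\<^sub>o R l)" using i' l sk by (simp add: mor_iff)
    have "isomorphic C u (S k \<otimes>\<^sub>o R l)"
      by (rule isomorphicI[OF nonzero_between_simples_iso[OF u(1) Ps m l(5)] m])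
    then show "isomorphic C (u \<otimes>\<^sub>o u) \<I>" by (rule order_two_isomorphic[OF _ P])
  qed (simp add: O)
next
  fix X Y assume X: "X \<in> order_two_objects" and dual: "left_dual C X Y"
  have O: "X \<in> Obj C" "Y \<in> Obj C" using dual by (auto simp: left_dual_def)
  show "Y \<in> order_two_objects"
  proof (rule order_two_objectsI[OF O(2)])
    fix u i assume u: "simple_obj C u" "i \<in> mor C u Y" "i \<noteq> ZeroArr C u Y"
    have uO: "u \<in> Obj C" using simple_objD[OF u(1)] by simp
    have "hom_embeds u Y u (\<I> \<otimes>\<^sub>o Y)"
      by (rule hom_embeds_isomorphic) (simp_all add: isomorphic_refl isomorphic_unit[THEN isomorphic_sym] O uO)
    also have "hom_embeds u (\<I> \<otimes>\<^sub>o Y) (u \<otimes>\<^sub>o X) \<I>" by (rule hom_embeds_eval_right[OF dual]) (simp_all add: uO)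
    finally obtain j where "j \<in> mor C (u \<otimes>\<^sub>o X) \<I>" "j \<noteq> ZeroArr C (u \<otimes>\<^sub>o X) \<I>"
      using hom_embeds_nonzero[OF _ u(2,3)] by blast
    then show "isomorphic C (u \<otimes>\<^sub>o u) \<I>" by (rule order_two_pairing[OF X u(1)])
  qed
next
  fix X Y assume X: "X \<in> order_two_objects" and dual: "left_dual C Y X"
  have O: "X \<in> Obj C" "Y \<in> Obj C" using dual by (auto simp: left_dual_def)
  show "Y \<in> order_two_objects"
  proof (rule order_two_objectsI[OF O(2)])
    fix u i assume u: "simple_obj C u" "i \<in> mor C u Y" "i \<noteq> ZeroArr C u Y"
    have uO: "u \<in> Obj C" using simple_objD[OF u(1)] by simp
    have "hom_embeds u Y u (Y \<otimes>\<^sub>o \<I>)"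
      by (rule hom_embeds_isomorphic) (simp_all add: isomorphic_refl isomorphic_unit[THEN isomorphic_sym] O uO)
    also have "hom_embeds u (Y \<otimes>\<^sub>o \<I>) (X \<otimes>\<^sub>o u) \<I>" by (rule hom_embeds_eval_left[OF dual]) (simp_all add: uO)
    also have "hom_embeds (X \<otimes>\<^sub>o u) \<I> (u \<otimes>\<^sub>o X) \<I>"
      by (rule hom_embeds_isomorphic[OF isomorphic_braid]) (simp_all add: isomorphic_refl O uO)
    finally obtain j where "j \<in> mor C (u \<otimes>\<^sub>o X) \<I>" "j \<noteq> ZeroArr C (u \<otimes>\<^sub>o X) \<I>"
      using hom_embeds_nonzero[OF _ u(2,3)] by blast
    then show "isomorphic C (u \<otimes>\<^sub>o u) \<I>" by (rule order_two_pairing[OF X u(1)])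
  qed
next
  fix n :: nat and R W assume R: "\<And>k. k < n \<Longrightarrow> R k \<in> order_two_objects" and W: "is_direct_sum C n R W"
  show "W \<in> order_two_objects"
  proof (rule order_two_objectsI)
    show "W \<in> Obj C" using W by (simp add: is_direct_sum_def)
    fix u i assume u: "simple_obj C u" "i \<in> mor C u W" "i \<noteq> ZeroArr C u W"
    obtain k \<pi> where k: "k < n" "\<pi> \<in> mor C W (R k)" "\<pi> \<cdot> i \<noteq> ZeroArr C u (R k)"
      using direct_sum_nonzero_in[OF W, of i] u by (auto simp: mor_iff)
    have "\<pi> \<cdot> i \<in> mor C u (R k)" using k u by (simp add: mor_iff)
    then show "isomorphic C (u \<otimes>\<^sub>o u) \<I>" using order_two_objectsD(2)[OF R[OF k(1)] u(1)] k(3) by blast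
  qed
next
  fix X Y f assume X: "X \<in> order_two_objects" and f: "f \<in> mor C Y X" "mono_arr C f"
  show "Y \<in> order_two_objects"
  proof (rule order_two_objectsI)
    show "Y \<in> Obj C" using f mor_obj by blast
    fix u i assume u: "simple_obj C u" "i \<in> mor C u Y" "i \<noteq> ZeroArr C u Y"
    have "f \<cdot> i \<in> mor C u X" "f \<cdot> i \<noteq> ZeroArr C u X" using f u mono_zero[OF f(2), of i] by (auto simp: mor_iff)
    then show "isomorphic C (u \<otimes>\<^sub>o u) \<I>" using order_two_objectsD(2)[OF X u(1)] by blast
  qed
next
  fix X Y f assume X: "X \<in> order_two_objects" and f: "f \<in> mor C X Y" "epi_arr C f"
  show "Y \<in> order_two_objects"
  proof (rule order_two_objectsI)
    show "Y \<in> Obj C" using f mor_obj by blast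
    fix u i assume u: "simple_obj C u" "i \<in> mor C u Y" "i \<noteq> ZeroArr C u Y"
    have uO: "u \<in> Obj C" using simple_objD[OF u(1)] by simp
    obtain p where p: "p \<in> mor C Y u" "p \<cdot> i = Idn C u" using nonzero_from_simple_split[OF u] by blast
    have "p \<noteq> ZeroArr C Y u"
    proof
      assume "p = ZeroArr C Y u"
      then have "Idn C u = ZeroArr C u u" using p u uO by (auto simp: mor_iff)
      then show False using simple_objD[OF u(1)] by simp
    qed
    then have "p \<cdot> f \<in> mor C X u" "p \<cdot> f \<noteq> ZeroArr C X u" using f p epi_zero[OF f(2), of p] by (auto simp: mor_iff)
    then obtain t where t: "t \<in> mor C u X" "(p \<cdot> f) \<cdot> t = Idn C u" using nonzero_to_simple_split[OF u(1)] by blast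
    show "isomorphic C (u \<otimes>\<^sub>o u) \<I>" by (rule order_two_summand[OF X u(1) _ t]) (rule \<open>p \<cdot> f \<in> mor C X u\<close>)
  qed
qed

text \<open>
  Let \<open>u\<close> be a constituent of \<open>X \<otimes> Y\<close>.  Duality gives a nonzero arrow \<open>u \<otimes> X \<rightarrow> X\<close>, so \<open>u\<close> has degree
  zero, is invertible and fixes \<open>X\<close>.  For the multiplicities in \<open>X \<otimes> X\<close>, let \<open>Z\<close> have \<open>X\<close> as its dual: the
  arrows from \<open>u\<close> to \<open>X \<otimes> X\<close> embed into those from \<open>u \<otimes> Z\<close> to \<open>X\<close>, and \<open>u \<otimes> Z\<close> is simple when \<open>u\<close> is
  invertible.
\<close>

lemma dual_product_order_two:
  assumes grading: "C2_grading C G"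
    and inv: "\<And>u. simple_obj C u \<Longrightarrow> u \<in> G 0 \<Longrightarrow> \<exists>v \<in> Obj C. isomorphic C (u \<otimes>\<^sub>o v) \<I>"
    and X: "simple_obj C X" and dual: "left_dual C X Y"
  shows "X \<otimes>\<^sub>o Y \<in> order_two_objects"
proof (rule order_two_objectsI)
  have O: "X \<in> Obj C" "Y \<in> Obj C" using dual by (auto simp: left_dual_def)
  then show "X \<otimes>\<^sub>o Y \<in> Obj C" by simp
  have tensor_simple: "simple_obj C (u \<otimes>\<^sub>o S)" if uS: "simple_obj C u" "u \<in> G 0" "simple_obj C S" for u S
  proof -
    obtain v where v: "v \<in> Obj C" "isomorphic C (u \<otimes>\<^sub>o v) \<I>" using inv[OF uS(1,2)] by blast
    have uO: "u \<in> Obj C" using simple_objD[OF uS(1)] by simp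
    show ?thesis
      by (rule invertible_tensor_simple[OF v(2) isomorphic_trans[OF isomorphic_braid v(2)] uO v(1) uS(3)])
        (rule v(1), rule uO)
  qed
  obtain Z where Z: "left_dual C Z X" using right_duals O by blast
  have ZO: "Z \<in> Obj C" using Z by (simp add: left_dual_def)
  have Zs: "simple_obj C Z" by (rule dual_simple[OF Z X])
  have le1: "hom_le1 u (X \<otimes>\<^sub>o X)" if u: "simple_obj C u" for u
  proof (cases "\<exists>i \<in> mor C u (X \<otimes>\<^sub>o X). i \<noteq> ZeroArr C u (X \<otimes>\<^sub>o X)")
    case True
    then have "u \<in> G 0" using constituent_square_component[OF grading X u] by blast
    then have "simple_obj C (u \<otimes>\<^sub>o Z)" using tensor_simple u Zs by blast
    moreover have "hom_embeds u (X \<otimes>\<^sub>o X) (u \<otimes>\<^sub>o Z) X"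
      by (rule hom_embeds_eval_right[OF Z]) (simp_all add: O simple_objD[OF u])
    ultimately show ?thesis using hom_le1_embeds simple_imp_hom_le1 X by blast
  next
    case False
    then show ?thesis unfolding hom_le1_def by blast
  qed
  fix u i assume u: "simple_obj C u" "i \<in> mor C u (X \<otimes>\<^sub>o Y)" "i \<noteq> ZeroArr C u (X \<otimes>\<^sub>o Y)"
  have uO: "u \<in> Obj C" using simple_objD[OF u(1)] by simp
  obtain f where f: "f \<in> mor C (u \<otimes>\<^sub>o X) X" "f \<noteq> ZeroArr C (u \<otimes>\<^sub>o X) X"
    using hom_embeds_nonzero[OF hom_embeds_eval_right[OF dual uO O(1)] u(2,3)] by blast
  have "u \<in> G 0" by (rule stabilizer_component[OF grading X u(1) f])
  then have "simple_obj C (u \<otimes>\<^sub>o X)" using tensor_simple u(1) X by blast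
  then have f_iso: "iso_arr C f" using nonzero_between_simples_iso X f by blast
  show "isomorphic C (u \<otimes>\<^sub>o u) \<I>"
    by (rule fixing_object_order_two[OF uO X f(1) f_iso]) (rule endomorphisms_commute[OF le1])
qed

end

section \<open>The group of simple objects\<close>

context fusion_category
begin

text \<open>
  The closure properties of a fusion subcategory under which its simple objects, isomorphism classes
  and products agree with those of the ambient category.
\<close>

context
  fixes A
  assumes A_obj: "A \<subseteq> Obj C"
    and A_unit: "\<I> \<in> A"
    and A_tensor: "\<And>X Y. X \<in> A \<Longrightarrow> Y \<in> A \<Longrightarrow> X \<otimes>\<^sub>o Y \<in> A"
    and A_sub: "\<And>X Y f. X \<in> A \<Longrightarrow> f \<in> mor C Y X \<Longrightarrow> mono_arr C f \<Longrightarrow> Y \<in> A"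
begin

lemma full_subcat_iso_arr:
  assumes "f \<in> mor C X Y" "X \<in> A" "Y \<in> A"
  shows "iso_arr (full_subcat C A) f \<longleftrightarrow> iso_arr C f"
  using assms unfolding iso_arr_def inverse_arrows_def mor_full_subcat
  by (auto simp: mor_iff full_subcat_def)

lemma replete: "X \<in> A \<Longrightarrow> isomorphic C Y X \<Longrightarrow> Y \<in> A"
  using A_sub iso_mono unfolding isomorphic_def by blast

lemma full_subcat_isomorphic:
  assumes "X \<in> A" "Y \<in> A"
  shows "isomorphic (full_subcat C A) X Y \<longleftrightarrow> isomorphic C X Y"
  using assms full_subcat_iso_arr unfolding isomorphic_def mor_full_subcat by blast

lemma full_subcat_iso_class:
  assumes "X \<in> A"
  shows "iso_class (full_subcat C A) X = iso_class C X"
  using assms full_subcat_isomorphic replete A_obj unfolding iso_class_def by auto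

lemma full_subcat_zero_obj:
  assumes "X \<in> A"
  shows "zero_obj (full_subcat C A) X \<longleftrightarrow> zero_obj C X"
proof
  assume "zero_obj C X"
  then show "zero_obj (full_subcat C A) X"
    using assms unfolding zero_obj_def mor_full_subcat by auto
next
  assume "zero_obj (full_subcat C A) X"
  then have "\<exists>!f. f \<in> mor C X X"
    using assms A_obj unfolding zero_obj_def mor_full_subcat by auto
  moreover have "Idn C X \<in> mor C X X" "ZeroArr C X X \<in> mor C X X" using assms A_obj by (auto simp: mor_iff)
  ultimately show "zero_obj C X" unfolding zero_obj_iff using assms A_obj by blast
qed

text \<open>
  Closure under subobjects makes a monomorphism into \<open>X\<close> visible in the subcategory.  Conversely, a
  monomorphism of the subcategory into a simple object of \<open>C\<close> is zero or has a section, and the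
  section is an inverse by cancellation inside the subcategory.
\<close>

lemma full_subcat_simple:
  "simple_obj (full_subcat C A) X \<longleftrightarrow> simple_obj C X \<and> X \<in> A"
proof
  assume X: "simple_obj (full_subcat C A) X"
  then have XA: "X \<in> A" and XO: "X \<in> Obj C" by (auto simp: simple_obj_def)
  have "zero_obj C Y \<or> iso_arr C f" if f: "f \<in> mor C Y X" "mono_arr C f" for Y f
  proof -
    have YA: "Y \<in> A" using A_sub XA f by blast
    have "mono_arr (full_subcat C A) f"
      using f YA XA unfolding mono_arr_def mor_full_subcat by (auto simp: mor_iff full_subcat_def)
    then have "zero_obj (full_subcat C A) Y \<or> iso_arr (full_subcat C A) f"
      using X f YA XA A_obj unfolding simple_obj_def mor_full_subcat by auto
    then show ?thesis using full_subcat_zero_obj[OF YA] full_subcat_iso_arr[OF f(1) YA XA] by blast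
  qed
  moreover have "\<not> zero_obj C X" using X full_subcat_zero_obj[OF XA] by (simp add: simple_obj_def)
  ultimately show "simple_obj C X \<and> X \<in> A" using XA XO unfolding simple_obj_def by blast
next
  assume XA: "simple_obj C X \<and> X \<in> A"
  have XO: "X \<in> Obj C" using XA simple_objD by blast
  have "zero_obj (full_subcat C A) Y \<or> iso_arr (full_subcat C A) f"
    if f: "f \<in> mor (full_subcat C A) Y X" "mono_arr (full_subcat C A) f" for Y f
  proof -
    have YA: "Y \<in> A" and fm: "f \<in> mor C Y X" using f by (auto simp: mor_full_subcat)
    have fa: "f \<in> Arr C" "Dom C f = Y" "Cod C f = X" "Y \<in> Obj C" using fm mor_obj by (auto simp: mor_iff)
    have cancel: "v = w" if "v \<in> mor C Y Y" "w \<in> mor C Y Y" "f \<cdot> v = f \<cdot> w" for v w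
      using f(2) that YA fa unfolding mono_arr_def mor_full_subcat by auto
    show ?thesis
    proof (cases "f = ZeroArr C Y X")
      case True
      have "f \<cdot> Idn C Y = f \<cdot> ZeroArr C Y Y" using fa XO True by simp
      then have "Idn C Y = ZeroArr C Y Y" using cancel fa by (simp add: mor_iff)
      then have "zero_obj C Y" using fa zero_obj_iff by simp
      then show ?thesis using full_subcat_zero_obj[OF YA] by simp
    next
      case False
      then obtain t where t: "t \<in> mor C X Y" "f \<cdot> t = Idn C X" using nonzero_to_simple_split XA fm by blast
      have "f \<cdot> (t \<cdot> f) = f \<cdot> Idn C Y"
        using comp_cong_left[OF t(2), of f] t(1) fa by (simp add: mor_iff)
      then have "t \<cdot> f = Idn C Y" using cancel t fa by (simp add: mor_iff)
      then have "iso_arr C f" using t fa by (intro iso_arrI[of _ t]) (auto simp: mor_iff)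
      then show ?thesis using full_subcat_iso_arr[OF fm YA] XA by simp
    qed
  qed
  then show "simple_obj (full_subcat C A) X"
    using XA XO full_subcat_zero_obj[of X] unfolding simple_obj_def by simp
qed

lemma iso_class_eq_iff:
  assumes "X \<in> Obj C" "Y \<in> Obj C"
  shows "iso_class C X = iso_class C Y \<longleftrightarrow> isomorphic C X Y"
proof
  assume "iso_class C X = iso_class C Y"
  then have "X \<in> iso_class C Y" using assms isomorphic_refl unfolding iso_class_def by blast
  then show "isomorphic C X Y" by (simp add: iso_class_def)
next
  assume "isomorphic C X Y"
  then show "iso_class C X = iso_class C Y"
    unfolding iso_class_def using isomorphic_trans isomorphic_sym by blast
qed

lemma simple_object_group_mult:
  assumes "X \<in> A" "Y \<in> A"
  shows "iso_class C X \<otimes>\<^bsub>simple_object_group (full_subcat C A)\<^esub> iso_class C Y = iso_class C (X \<otimes>\<^sub>o Y)"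
proof -
  have O: "X \<in> Obj C" "Y \<in> Obj C" using assms A_obj by auto
  have "iso_class (full_subcat C A) (X' \<otimes>\<^sub>o Y') = iso_class C (X \<otimes>\<^sub>o Y)"
    if "X' \<in> iso_class C X" "Y' \<in> iso_class C Y" for X' Y'
  proof -
    have XY: "isomorphic C X' X" "isomorphic C Y' Y" using that by (auto simp: iso_class_def)
    then have "X' \<in> A" "Y' \<in> A" using replete assms by auto
    then have "iso_class (full_subcat C A) (X' \<otimes>\<^sub>o Y') = iso_class C (X' \<otimes>\<^sub>o Y')"
      using full_subcat_iso_class A_tensor by blast
    also have "\<dots> = iso_class C (X \<otimes>\<^sub>o Y)"
      using isomorphic_tensor[OF XY] iso_class_eq_iff isomorphic_obj by blast
    finally show ?thesis .
  qed
  moreover have "X \<in> iso_class C X" "Y \<in> iso_class C Y"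
    using O isomorphic_refl by (auto simp: iso_class_def)
  ultimately show ?thesis unfolding simple_object_group_def by auto
qed

lemma simple_object_group_carrier:
  "carrier (simple_object_group (full_subcat C A)) = iso_class C ` {X. simple_obj C X \<and> X \<in> A}"
  unfolding simple_object_group_def simple_classes_def
  by (auto simp: full_subcat_simple full_subcat_iso_class image_iff)

text \<open>
  Every element is its own inverse, so closure under tensor products is all that the group axioms
  require beyond associativity and the unit.
\<close>

lemma order_two_elementary:
  assumes two: "\<And>X. simple_obj C X \<Longrightarrow> X \<in> A \<Longrightarrow> isomorphic C (X \<otimes>\<^sub>o X) \<I>"
  shows "elementary_abelian_2_group (simple_object_group (full_subcat C A))" (is "elementary_abelian_2_group ?H")
proof -
  have one: "\<one>\<^bsub>?H\<^esub> = iso_class C \<I>"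
    by (simp add: simple_object_group_def full_subcat_iso_class[OF A_unit])
  have AO: "X \<in> Obj C" if "X \<in> A" for X using that A_obj by blast
  have tensor_simple: "simple_obj C (X \<otimes>\<^sub>o Y)" if "simple_obj C X" "X \<in> A" "simple_obj C Y" for X Y
    using invertible_tensor_simple[OF two[OF that(1,2)] two[OF that(1,2)] AO[OF that(2)] AO[OF that(2)] that(3)] .
  have sq: "x \<otimes>\<^bsub>?H\<^esub> x = \<one>\<^bsub>?H\<^esub>" if x: "x \<in> carrier ?H" for x
  proof -
    obtain X where X: "x = iso_class C X" "simple_obj C X" "X \<in> A" using x unfolding simple_object_group_carrier by blast
    have "iso_class C (X \<otimes>\<^sub>o X) = iso_class C \<I>"
      using two[OF X(2,3)] AO[OF X(3)] by (subst iso_class_eq_iff) simp_all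
    then show ?thesis unfolding X(1) one simple_object_group_mult[OF X(3,3)] .
  qed
  interpret group ?H
  proof (rule groupI)
    fix x y assume "x \<in> carrier ?H" "y \<in> carrier ?H"
    then obtain X Y where "x = iso_class C X" "simple_obj C X" "X \<in> A" "y = iso_class C Y" "simple_obj C Y" "Y \<in> A"
      unfolding simple_object_group_carrier by blast
    then show "x \<otimes>\<^bsub>?H\<^esub> y \<in> carrier ?H"
      unfolding simple_object_group_carrier using simple_object_group_mult tensor_simple A_tensor by auto
  next
    show "\<one>\<^bsub>?H\<^esub> \<in> carrier ?H" unfolding one simple_object_group_carrier using unit_simple A_unit by blast
  next
    fix x y z assume "x \<in> carrier ?H" "y \<in> carrier ?H" "z \<in> carrier ?H"
    then obtain X Y Z where X: "x = iso_class C X" "X \<in> A" and Y: "y = iso_class C Y" "Y \<in> A"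
      and Z: "z = iso_class C Z" "Z \<in> A"
      unfolding simple_object_group_carrier by blast
    have "iso_class C (X \<otimes>\<^sub>o Y \<otimes>\<^sub>o Z) = iso_class C (X \<otimes>\<^sub>o (Y \<otimes>\<^sub>o Z))"
      using isomorphic_assoc AO X(2) Y(2) Z(2) by (subst iso_class_eq_iff) simp_all
    then show "(x \<otimes>\<^bsub>?H\<^esub> y) \<otimes>\<^bsub>?H\<^esub> z = x \<otimes>\<^bsub>?H\<^esub> (y \<otimes>\<^bsub>?H\<^esub> z)"
      unfolding X(1) Y(1) Z(1) using X Y Z A_tensor by (simp add: simple_object_group_mult)
  next
    fix x assume "x \<in> carrier ?H"
    then obtain X where X: "x = iso_class C X" "X \<in> A" unfolding simple_object_group_carrier by blast
    have "iso_class C (\<I> \<otimes>\<^sub>o X) = iso_class C X"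
      using isomorphic_unit(1) AO[OF X(2)] by (subst iso_class_eq_iff) simp_all
    then show "\<one>\<^bsub>?H\<^esub> \<otimes>\<^bsub>?H\<^esub> x = x" unfolding one X(1) simple_object_group_mult[OF A_unit X(2)] .
  next
    fix x assume "x \<in> carrier ?H"
    then show "\<exists>y \<in> carrier ?H. y \<otimes>\<^bsub>?H\<^esub> x = \<one>\<^bsub>?H\<^esub>" using sq by blast
  qed
  have "carrier ?H \<subseteq> simple_classes C"
    unfolding simple_object_group_carrier simple_classes_def by blast
  then have "finite (carrier ?H)" using finite_simple_classes by (rule finite_subset)
  then show ?thesis using sq by (rule exponent_two_imp_elementary)
qed

end

end

theorem proposition1:
  fixes C :: "('o, 'm) moncat" and D :: "('p, 'q) moncat"
  assumes "fusion_category C"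
    and "pointed_fusion_category D"
    and "C2_graded_extension C D"
    and "braided C"
  shows "elementary_abelian_2_group (simple_object_group (adjoint_subcategory C))"
proof -
  obtain c where c: "braiding C c" using assms(4) by (auto simp: braided_def)
  obtain G where grading: "C2_grading C G" and eq: "monoidally_equivalent (full_subcat C (G 0)) D"
    using assms(3) by (auto simp: C2_graded_extension_def)
  interpret braided_fusion_category C c
    by (intro braided_fusion_category.intro assms(1) c)
  interpret C2_grading C G by (rule grading)
  have inv: "\<exists>v \<in> Obj C. isomorphic C (u \<otimes>\<^sub>o\<^bsub>C\<^esub> v) \<I>\<^bsub>C\<^esub>" if "simple_obj C u" "u \<in> G 0" for u
  proof (rule simple_invertible_transport[OF assms(2) eq])
    show "X \<otimes>\<^sub>o\<^bsub>C\<^esub> Y \<in> G 0" if "X \<in> G 0" "Y \<in> G 0" for X Y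
      using component_tensor[of 0 0 X Y] that by simp
  qed (use component_obj[of 0] unit_component[OF grading] that in auto)
  let ?gen = "{X \<otimes>\<^sub>o\<^bsub>C\<^esub> Y | X Y. simple_obj C X \<and> left_dual C X Y}"
  let ?A = "\<Inter>{S. fusion_subcategory C S \<and> ?gen \<subseteq> S}"
  have "?gen \<subseteq> order_two_objects" using dual_product_order_two[OF grading inv] by blast
  then have A: "?A \<subseteq> order_two_objects" using order_two_fusion_subcategory by blast
  have "elementary_abelian_2_group (simple_object_group (full_subcat C ?A))"
  proof (rule order_two_elementary)
    show "?A \<subseteq> Obj C" using A order_two_objectsD(1) by blast
    show "\<I>\<^bsub>C\<^esub> \<in> ?A" by (auto intro: fusion_subcategory.sub_unit)
    show "X \<otimes>\<^sub>o\<^bsub>C\<^esub> Y \<in> ?A" if "X \<in> ?A" "Y \<in> ?A" for X Y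
      using that by (auto intro: fusion_subcategory.sub_tensor)
    show "Y \<in> ?A" if "X \<in> ?A" "f \<in> mor C Y X" "mono_arr C f" for X Y f
      using that fusion_subcategory.sub_subobject[of C _ X f Y] by auto
    show "isomorphic C (X \<otimes>\<^sub>o\<^bsub>C\<^esub> X) \<I>\<^bsub>C\<^esub>" if "simple_obj C X" "X \<in> ?A" for X
      using order_two_objectsD(2)[OF _ that(1) id_mor] A that simple_objD[OF that(1)] by blast
  qed
  then show ?thesis by (simp add: adjoint_subcategory_def generated_fusion_subcategory_def)
qed

end
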